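(* Let $0\le u_0\in L^1(\mathbb{R}^N)\cap L^\infty(\mathbb{R}^N)$ with $u_0=0$ in $\mathcal{H}$, let $u$ be the solution of the nonlocal problem with initial datum $u_0$, let $\phi$ be the solution of the stationary problem, and let $M^*=\int_{\mathbb{R}^N}u_0(x)\phi(x)\,dx$. Then, for every $\delta>0$, $$t^{N/2}\,\|u(\cdot,t)-M^*\Gamma_\alpha(\cdot,t)\|_{L^\infty(\{x\in\mathbb{R}^N:\,|x|^2\ge\delta t\})}\to0\quad\text{as } t\to\infty.$$
   Context: Setting: $N\ge 3$; $\mathcal{H}\subset\mathbb{R}^N$ is a bounded open set with smooth boundary (not necessarily connected), $0\in\mathcal{H}$, and $\Omega=\mathbb{R}^N\setminus\mathcal{H}$. The kernel $J:\mathbb{R}^N\to[0,\infty)$ is smooth, radially symmetric, compactly supported in the unit ball centered at the origin, with $J(0)>0$ and $\int_{\mathbb{R}^N}J=1$. Nonlocal problem: $\partial_t u(x,t)=\int_{\mathbb{R}^N}J(x-y)(u(y,t)-u(x,t))\,dy$ in $\Omega\times(0,\infty)$, $u=0$ in $\mathcal{H}\times(0,\infty)$, $u(\cdot,0)=u_0$. A solution is a function $u\in C([0,\infty);L^1(\mathbb{R}^N))$ such that for all $t>0$, $u(\cdot,t)=u_0+\int_0^t(J*u(\cdot,s)-u(\cdot,s))\,ds$ a.e. in $\Omega$ and $u(\cdot,t)=0$ a.e. in $\mathcal{H}$; it exists and is unique. Stationary problem: $\phi\in L^1_{\rm loc}(\mathbb{R}^N)$ is the unique solution of $J*\phi=\phi$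 in $\Omega$, $\phi=0$ in $\mathcal{H}$, $\phi(x)\to1$ as $|x|\to\infty$. Heat kernel: $\alpha=\frac1{2N}\int_{\mathbb{R}^N}|z|^2J(z)\,dz$ and $\Gamma_\alpha(x,t)=(4\pi\alpha t)^{-N/2}e^{-|x|^2/(4\alpha t)}$. *)

theory Defs
  imports "HOL-Analysis.Analysis" "HOL-Probability.Essential_Supremum"
begin

primrec Ck_on :: "nat \<Rightarrow> ('a::real_normed_vector \<Rightarrow> 'b::real_normed_vector) \<Rightarrow> 'a set \<Rightarrow> bool" where
  "Ck_on 0 f S \<longleftrightarrow> continuous_on S f"
| "Ck_on (Suc k) f S \<longleftrightarrow>
     (\<forall>x\<in>S. f differentiable (at x)) \<and> (\<forall>v. Ck_on k (\<lambda>x. frechet_derivative f (at x) v) S)"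

(* Meant for open S only: the derivatives are taken in the whole space. *)
definition smooth_on :: "'a::real_normed_vector set \<Rightarrow> ('a \<Rightarrow> 'b::real_normed_vector) \<Rightarrow> bool" where
  "smooth_on S f \<longleftrightarrow> (\<forall>k. Ck_on k f S)"

(* Near each boundary point the open set is a strict sublevel set of a smooth function
   whose differential does not vanish on the boundary. *)
definition smooth_boundary :: "'a::euclidean_space set \<Rightarrow> bool" where
  "smooth_boundary H \<longleftrightarrow>
     (\<forall>p\<in>frontier H. \<exists>U (\<rho> :: 'a \<Rightarrow> real).
        open U \<and> p \<in> U \<and> smooth_on U \<rho> \<and>
        H \<inter> U = {x\<in>U. \<rho> x < 0} \<and>
        frontier H \<inter> U = {x\<in>U. \<rho> x = 0} \<and>
        (\<forall>x\<in>frontier H \<inter> U. \<exists>v. frechet_derivative \<rho> (at x) v \<noteq> 0))"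

definition nonlocal_kernel :: "('a::euclidean_space \<Rightarrow> real) \<Rightarrow> bool" where
  "nonlocal_kernel J \<longleftrightarrow>
     smooth_on UNIV J \<and>
     (\<forall>x. 0 \<le> J x) \<and>
     (\<forall>x y. norm x = norm y \<longrightarrow> J x = J y) \<and>
     closure {x. J x \<noteq> 0} \<subseteq> cball 0 1 \<and>
     0 < J 0 \<and>
     (LINT x|lebesgue. J x) = 1"

definition conv :: "('a::euclidean_space \<Rightarrow> real) \<Rightarrow> ('a \<Rightarrow> real) \<Rightarrow> 'a \<Rightarrow> real" where
  "conv J f x = (LINT y|lebesgue. J (x - y) * f y)"

(* Elements of L^1 are represented by integrable functions, so that a curve in L^1 is a
   map from times to such functions and u t x stands for u(x,t). *)
definition L1_curve :: "real set \<Rightarrow> (real \<Rightarrow> 'a::euclidean_space \<Rightarrow> real) \<Rightarrow> bool" where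
  "L1_curve T u \<longleftrightarrow>
     (\<forall>t\<in>T. integrable lebesgue (u t)) \<and>
     (\<forall>t\<in>T. ((\<lambda>s. LINT x|lebesgue. \<bar>u s x - u t x\<bar>) \<longlongrightarrow> 0) (at t within T))"

(* I represents the integral over [a,b] of the L^1-valued curve f: the Riemann sums
   converge to I in the L^1 norm as the mesh tends to 0. For curves that are continuous
   into L^1, the only ones it is used for, this is the Bochner integral. Integrating
   s |-> f s x for fixed x instead would depend on the representatives. *)
definition has_L1_integral ::
  "(real \<Rightarrow> 'a::euclidean_space \<Rightarrow> real) \<Rightarrow> ('a \<Rightarrow> real) \<Rightarrow> real \<Rightarrow> real \<Rightarrow> bool" where
  "has_L1_integral f I a b \<longleftrightarrow>
     (\<forall>s\<in>{a..b}. integrable lebesgue (f s)) \<and>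
     integrable lebesgue I \<and>
     (\<forall>e>0. \<exists>d>0. \<forall>D. D tagged_division_of {a..b} \<and> (\<lambda>s. ball s d) fine D \<longrightarrow>
        (LINT x|lebesgue. \<bar>(\<Sum>(s,K)\<in>D. measure lborel K * f s x) - I x\<bar>) < e)"

definition nonlocal_solution ::
  "('a::euclidean_space \<Rightarrow> real) \<Rightarrow> 'a set \<Rightarrow> ('a \<Rightarrow> real) \<Rightarrow> (real \<Rightarrow> 'a \<Rightarrow> real) \<Rightarrow> bool" where
  "nonlocal_solution J H u0 u \<longleftrightarrow>
     L1_curve {0..} u \<and>
     (\<forall>t>0.
        (\<exists>I. has_L1_integral (\<lambda>s x. conv J (u s) x - u s x) I 0 t \<and>
             (AE x in lebesgue. x \<in> - H \<longrightarrow> u t x = u0 x + I x)) \<and>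
        (AE x in lebesgue. x \<in> H \<longrightarrow> u t x = 0))"

(* As phi is only in L^1_loc, the equations hold almost everywhere and the limit at
   infinity is an essential limit. *)
definition stationary_solution ::
  "('a::euclidean_space \<Rightarrow> real) \<Rightarrow> 'a set \<Rightarrow> ('a \<Rightarrow> real) \<Rightarrow> bool" where
  "stationary_solution J H \<phi> \<longleftrightarrow>
     (\<forall>K. compact K \<longrightarrow> set_integrable lebesgue K \<phi>) \<and>
     (AE x in lebesgue. x \<in> - H \<longrightarrow> conv J \<phi> x = \<phi> x) \<and>
     (AE x in lebesgue. x \<in> H \<longrightarrow> \<phi> x = 0) \<and>
     (\<forall>e>0. \<exists>R. AE x in lebesgue. R \<le> norm x \<longrightarrow> \<bar>\<phi> x - 1\<bar> < e)"

definition diffusivity :: "('a::euclidean_space \<Rightarrow> real) \<Rightarrow> real" where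
  "diffusivity J = (LINT z|lebesgue. (norm z)\<^sup>2 * J z) / (2 * real DIM('a))"

definition heat_kernel :: "real \<Rightarrow> 'a::euclidean_space \<Rightarrow> real \<Rightarrow> real" where
  "heat_kernel \<alpha> x t =
     (4 * pi * \<alpha> * t) powr (- (real DIM('a) / 2)) * exp (- ((norm x)\<^sup>2 / (4 * \<alpha> * t)))"

(* Equal to infinity when f is not measurable on S. *)
definition Linf_norm :: "'a::euclidean_space set \<Rightarrow> ('a \<Rightarrow> real) \<Rightarrow> ennreal" where
  "Linf_norm S f = esssup (lebesgue_on S) (\<lambda>x. ennreal \<bar>f x\<bar>)"

end

theory Submission
  imports Defs "HOL-Probability.Probability"
begin

text \<open>
Two effects act on a solution: free diffusion by jumps with density \<open>J\<close>, and absorption in the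
hole \<open>H\<close>. The proof separates them after a long but fixed time and shows that the later absorption
cannot be felt at distance of order \<open>\<surd>t\<close> from the hole.

Time is made discrete first, without any loss. Testing the equation against bounded functions that
vanish on \<open>H\<close> and expanding in a Taylor series in \<open>t\<close> gives the exact formula
\<open>u(t) = exp(-t) \<Sum>n. t^n/n! w\<^sub>n\<close> (\<open>nonlocal_solution_poisson_walk\<close>), where \<open>w\<^sub>0 = u\<^sub>0\<close> and
\<open>w\<^sub>n\<^sub>+\<^sub>1\<close> is \<open>J * w\<^sub>n\<close> outside \<open>H\<close> and \<open>0\<close> in \<open>H\<close>: the law of a random walk with steps \<open>J\<close> killed in \<open>H\<close>,
observed after a Poisson number of steps. The Poisson law concentrates exponentially around \<open>t\<close>
(\<open>poisson_average_bound\<close>), so it suffices to find the asymptotics of \<open>w\<^sub>n\<close>.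

For the walk, three facts are combined. First, \<open>J * \<phi> = \<phi>\<close> outside \<open>H\<close> and \<open>\<phi> = 0\<close> in \<open>H\<close> make
\<open>\<integral> w\<^sub>n \<phi>\<close> independent of \<open>n\<close>, hence equal to \<open>M\<^sup>*\<close>. As the walk spreads out and \<open>\<phi>\<close> tends to \<open>1\<close> at
infinity, the total mass \<open>m\<^sub>n = \<integral> w\<^sub>n\<close> decreases to \<open>M\<^sup>*\<close> (\<open>mass_tendsto\<close>); so the mass absorbed after
step \<open>K\<close> is \<open>m\<^sub>K - M\<^sup>*\<close>, which is small for large \<open>K\<close>. Secondly, the free walk started from
\<open>w\<^sub>K\<close> satisfies a local limit theorem: \<open>n^(N/2) J^(*n) * w\<^sub>K\<close> is uniformly close to \<open>m\<^sub>K\<close> times the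
Gaussian profile (\<open>whole_space_asymptotics\<close>). Thirdly, by the discrete Duhamel formula, the
difference between the free and the killed walk is the free evolution of the mass absorbed in \<open>H\<close>
after step \<open>K\<close>, and the transition densities satisfy \<open>J^(*n)(z) \<le> C |z|^(-N)\<close> uniformly in \<open>n\<close>
(\<open>cvpow_off_diagonal\<close>). Where \<open>|x|\<^sup>2 \<ge> \<delta> n\<close>, the distance to the bounded set \<open>H\<close> is comparable to \<open>|x|\<close>,
so that this difference is at most \<open>C n^(-N/2) (m\<^sub>K - M\<^sup>*)\<close>. Letting first \<open>n\<close> and then \<open>K\<close> tend to
infinity gives the result (\<open>walk_asymptotics\<close>).

The bounds on convolution powers come from Fourier analysis. The cosine transform of \<open>J\<close> is
\<open>1 - \<alpha>|\<xi>|\<^sup>2 + O(|\<xi>|^4)\<close> near the origin, stays away from \<open>\<plusminus>1\<close> elsewhere, and is square integrable; its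
powers are therefore close to those of the Gaussian in \<open>L\<^sup>1\<close>, and the inversion formula turns
this into a uniform estimate of \<open>J^(*n)\<close> (\<open>local_limit_theorem\<close>). The decay in space follows by
splitting \<open>J^(*n)\<close> into two halves and tilting exponentially (\<open>cvpow_tilted_split\<close>).
\<close>

section \<open>Convolution\<close>

text \<open>Convolution integrals are manipulated by the substitution \<open>y \<mapsto> c - y\<close>, an affine map with
  factor \<open>-1\<close>.\<close>
lemma lborel_distr_reflect_shift:
  fixes c :: "'a::euclidean_space"
  shows "distr lborel borel (\<lambda>y. c - y) = lborel"
  using lborel_affine[of "-1" c] by (simp add: density_1)

lemma
  fixes f :: "'a::euclidean_space \<Rightarrow> 'b::{banach, second_countable_topology}"
  assumes [measurable]: "f \<in> borel_measurable borel"
  shows integral_reflect_shift: "(LINT y|lborel. f (c - y)) = (LINT y|lborel. f y)"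
    and integrable_reflect_shift: "integrable lborel (\<lambda>y. f (c - y)) \<longleftrightarrow> integrable lborel f"
proof -
  have "integral\<^sup>L (distr lborel borel (\<lambda>y. c - y)) f = (LINT y|lborel. f (c - y))"
    by (rule integral_distr) auto
  then show "(LINT y|lborel. f (c - y)) = (LINT y|lborel. f y)"
    by (simp add: lborel_distr_reflect_shift)
  have "integrable (distr lborel borel (\<lambda>y. c - y)) f \<longleftrightarrow> integrable lborel (\<lambda>y. f (c - y))"
    by (rule integrable_distr_eq) auto
  then show "integrable lborel (\<lambda>y. f (c - y)) \<longleftrightarrow> integrable lborel f"
    by (simp add: lborel_distr_reflect_shift)
qed

lemma
  fixes f :: "'a::euclidean_space \<Rightarrow> 'b::{banach, second_countable_topology}"
  assumes [measurable]: "f \<in> borel_measurable borel"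
  shows integral_shift: "(LINT y|lborel. f (y - c)) = (LINT y|lborel. f y)"
    and integrable_shift: "integrable lborel (\<lambda>y. f (y - c)) \<longleftrightarrow> integrable lborel f"
proof -
  have D: "distr lborel borel (\<lambda>y. y - c) = lborel"
    using lborel_affine[of 1 "-c"] by (simp add: density_1)
  have "integral\<^sup>L (distr lborel borel (\<lambda>y. y - c)) f = (LINT y|lborel. f (y - c))"
    by (rule integral_distr) auto
  then show "(LINT y|lborel. f (y - c)) = (LINT y|lborel. f y)" by (simp add: D)
  have "integrable (distr lborel borel (\<lambda>y. y - c)) f \<longleftrightarrow> integrable lborel (\<lambda>y. f (y - c))"
    by (rule integrable_distr_eq) auto
  then show "integrable lborel (\<lambda>y. f (y - c)) \<longleftrightarrow> integrable lborel f" by (simp add: D)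
qed

lemma integrable_bounded_mult:
  fixes f g :: "'a \<Rightarrow> real"
  assumes "integrable M f" "g \<in> borel_measurable M" "\<And>x. \<bar>g x\<bar> \<le> C"
  shows "integrable M (\<lambda>x. g x * f x)"
proof (rule Bochner_Integration.integrable_bound[where f="\<lambda>x. C * f x"])
  show "integrable M (\<lambda>x. C * f x)" using assms by simp
  show "(\<lambda>x. g x * f x) \<in> borel_measurable M"
    using assms borel_measurable_integrable by (intro borel_measurable_times) auto
  show "AE x in M. norm (g x * f x) \<le> norm (C * f x)"
    using assms(3) by (auto simp: abs_mult intro!: mult_right_mono order_trans[OF assms(3)])
qed

text \<open>The operator \<^const>\<open>conv\<close> with Borel instead of Lebesgue measure. The two agree up to the
  choice of representatives, and for Borel functions Fubini's theorem applies directly.\<close>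
definition cv :: "('a::euclidean_space \<Rightarrow> real) \<Rightarrow> ('a \<Rightarrow> real) \<Rightarrow> 'a \<Rightarrow> real" where
  "cv K f x = (LINT y|lborel. K (x - y) * f y)"

lemma cv_measurable [measurable]:
  assumes [measurable]: "K \<in> borel_measurable borel" "f \<in> borel_measurable borel"
  shows "cv K f \<in> borel_measurable borel"
  unfolding cv_def by measurable

lemma cv_commute:
  assumes [measurable]: "K \<in> borel_measurable borel" "f \<in> borel_measurable borel"
  shows "cv K f x = cv f K x"
  unfolding cv_def
  using integral_reflect_shift[of "\<lambda>y. K (x - y) * f y" x] by (simp add: mult.commute)

lemma integrable_cv_slice:
  fixes K f :: "'a::euclidean_space \<Rightarrow> real"
  assumes [measurable]: "K \<in> borel_measurable borel" and K: "\<And>x. \<bar>K x\<bar> \<le> B" and f: "integrable lborel f"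
  shows "integrable lborel (\<lambda>y. K (x - y) * f y)"
  by (rule integrable_bounded_mult[OF f, where C=B]) (auto simp: K)

lemma cv_le:
  assumes "K \<in> borel_measurable borel" and K: "\<And>x. \<bar>K x\<bar> \<le> B" and f: "integrable lborel f"
  shows "\<bar>cv K f x\<bar> \<le> B * (LINT y|lborel. \<bar>f y\<bar>)"
proof -
  have "\<bar>cv K f x\<bar> \<le> (LINT y|lborel. \<bar>K (x - y) * f y\<bar>)"
    unfolding cv_def by (rule integral_abs_bound)
  also have "\<dots> \<le> (LINT y|lborel. B * \<bar>f y\<bar>)"
    using integrable_norm[OF integrable_cv_slice[OF assms, of x]] f
    by (intro integral_mono) (auto simp: abs_mult intro!: mult_right_mono K)
  finally show ?thesis by simp
qed

text \<open>Multiplying by a multiplicative weight \<open>chi\<close> commutes with convolution, because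
  \<open>chi x = chi (x - y) chi y\<close>. With \<open>chi = 1\<close> this says that masses multiply, with
  \<open>chi = cis (_ \<bullet> \<xi>)\<close> that Fourier transforms multiply, and with a real exponential it gives the
  exponential moments of convolution powers.\<close>
lemma
  fixes chi :: "'a::euclidean_space \<Rightarrow> 'b::{real_normed_field, banach, second_countable_topology}"
  assumes mult: "\<And>x y. chi (x + y) = chi x * chi y"
    and [measurable]: "chi \<in> borel_measurable borel" "K \<in> borel_measurable borel" "f \<in> borel_measurable borel"
    and iK: "integrable lborel (\<lambda>x. K x *\<^sub>R chi x)" and iF: "integrable lborel (\<lambda>x. f x *\<^sub>R chi x)"
    and iKf: "\<And>x. integrable lborel (\<lambda>y. K (x - y) * f y)"
  shows cv_character_integrable: "integrable lborel (\<lambda>x. cv K f x *\<^sub>R chi x)"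
    and cv_character: "(LINT x|lborel. cv K f x *\<^sub>R chi x)
      = (LINT x|lborel. K x *\<^sub>R chi x) * (LINT x|lborel. f x *\<^sub>R chi x)"
proof -
  let ?F = "\<lambda>y x. (K (x - y) * f y) *\<^sub>R chi x"
  have F: "?F y x = (f y *\<^sub>R chi y) * (K (x - y) *\<^sub>R chi (x - y))" for x y
    using mult[of y "x - y"] by (simp add: algebra_simps)
  have slice: "integrable lborel (\<lambda>x. ?F y x)" for y
    unfolding F using iK integrable_shift[of "\<lambda>x. K x *\<^sub>R chi x" y]
    by (intro integrable_mult_right) simp
  have "(LINT x|lborel. norm (?F y x)) = norm (f y *\<^sub>R chi y) * (LINT x|lborel. norm (K x *\<^sub>R chi x))" for y
  proof -
    have "(LINT x|lborel. norm (?F y x))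
        = (LINT x|lborel. norm (f y *\<^sub>R chi y) * norm (K (x - y) *\<^sub>R chi (x - y)))"
      unfolding F by (simp only: norm_mult)
    then show ?thesis
      using integral_shift[of "\<lambda>x. norm (K x *\<^sub>R chi x)" y] by (simp only: integral_mult_right_zero) simp
  qed
  then have I: "integrable (lborel \<Otimes>\<^sub>M lborel) (\<lambda>(y, x). ?F y x)"
    using slice integrable_norm[OF iF] by (intro lborel_pair.Fubini_integrable) auto
  have inner: "(LINT y|lborel. ?F y x) = cv K f x *\<^sub>R chi x" for x
    unfolding cv_def using iKf[of x] by simp
  show "integrable lborel (\<lambda>x. cv K f x *\<^sub>R chi x)"
    using lborel_pair.integrable_snd[OF I] by (simp add: inner)
  have "(LINT x|lborel. cv K f x *\<^sub>R chi x) = (LINT y|lborel. LINT x|lborel. ?F y x)"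
    using lborel_pair.Fubini_integral[OF I] by (simp add: inner)
  also have "\<dots> = (LINT y|lborel. (f y *\<^sub>R chi y) * (LINT x|lborel. K x *\<^sub>R chi x))"
    unfolding F using integral_shift[of "\<lambda>x. K x *\<^sub>R chi x"]
    by (simp only: integral_mult_right_zero) simp
  also have "\<dots> = (LINT x|lborel. K x *\<^sub>R chi x) * (LINT x|lborel. f x *\<^sub>R chi x)"
    by (simp only: integral_mult_left_zero mult.commute)
  finally show "(LINT x|lborel. cv K f x *\<^sub>R chi x)
      = (LINT x|lborel. K x *\<^sub>R chi x) * (LINT x|lborel. f x *\<^sub>R chi x)" .
qed

lemma
  assumes "integrable lborel K" "integrable lborel f"
    "K \<in> borel_measurable borel" "\<And>x. \<bar>K x\<bar> \<le> B"
  shows cv_integrable: "integrable lborel (cv K f)"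
    and cv_integral: "(LINT x|lborel. cv K f x) = (LINT x|lborel. K x) * (LINT x|lborel. f x)"
  using assms cv_character_integrable[of "\<lambda>_. 1::real" K f] cv_character[of "\<lambda>_. 1::real" K f]
    integrable_cv_slice[of K B f] borel_measurable_integrable[OF assms(2)] by auto

lemma cv_assoc:
  assumes [measurable]: "J \<in> borel_measurable borel" "K \<in> borel_measurable borel"
    and J: "\<And>x. \<bar>J x\<bar> \<le> B" and K: "\<And>x. \<bar>K x\<bar> \<le> C" and iK: "integrable lborel K"
    and f: "integrable lborel f"
  shows "cv J (cv K f) x = cv (cv J K) f x"
proof -
  have [measurable]: "f \<in> borel_measurable borel" using f by auto
  let ?F = "\<lambda>z y. J (x - y) * (K (y - z) * f z)"
  have sl: "integrable lborel (\<lambda>y. K (y - z) * f z)" for z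
    using iK integrable_shift[of K z] by auto
  have slice: "integrable lborel (\<lambda>y. ?F z y)" for z
    by (rule integrable_cv_slice[OF _ J sl]) auto
  have b: "(LINT y|lborel. norm (?F z y)) \<le> B * (LINT y|lborel. \<bar>K y\<bar>) * \<bar>f z\<bar>" for z
  proof -
    have "(LINT y|lborel. norm (?F z y)) \<le> (LINT y|lborel. B * \<bar>K (y - z) * f z\<bar>)"
    proof (rule integral_mono)
      show "integrable lborel (\<lambda>y. norm (?F z y))" using slice by (rule integrable_norm)
      show "integrable lborel (\<lambda>y. B * \<bar>K (y - z) * f z\<bar>)" using sl by (intro integrable_mult_right integrable_abs)
      show "norm (?F z y) \<le> B * \<bar>K (y - z) * f z\<bar>" for y
        unfolding real_norm_def abs_mult[of "J _"] by (intro mult_right_mono J) auto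
    qed
    also have "\<dots> = B * (LINT y|lborel. \<bar>K y\<bar>) * \<bar>f z\<bar>"
      using integral_shift[of "\<lambda>y. \<bar>K y\<bar>" z] by (simp add: abs_mult)
    finally show ?thesis .
  qed
  have "integrable lborel (\<lambda>z. LINT y|lborel. norm (?F z y))"
    by (rule Bochner_Integration.integrable_bound[where f="\<lambda>z. B * (LINT y|lborel. \<bar>K y\<bar>) * \<bar>f z\<bar>"])
       (use f b in \<open>auto intro!: order_trans[OF _ abs_ge_self]\<close>)
  then have I: "integrable (lborel \<Otimes>\<^sub>M lborel) (\<lambda>(z, y). ?F z y)"
    using slice by (intro lborel_pair.Fubini_integrable) auto
  have "cv J (cv K f) x = (LINT y|lborel. LINT z|lborel. ?F z y)"
    unfolding cv_def by simp
  also have "\<dots> = (LINT z|lborel. LINT y|lborel. ?F z y)"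
    by (rule lborel_pair.Fubini_integral[OF I])
  also have "\<dots> = (LINT z|lborel. cv J K (x - z) * f z)"
  proof (intro Bochner_Integration.integral_cong refl)
    fix z
    have "(LINT y|lborel. J (x - y) * K (y - z)) = cv J K (x - z)"
      unfolding cv_def using integral_shift[of "\<lambda>y. J (x - z - y) * K y" z] by simp
    then show "(LINT y|lborel. ?F z y) = cv J K (x - z) * f z"
      by (simp flip: mult.assoc)
  qed
  finally show ?thesis unfolding cv_def[of "cv J K"] .
qed

text \<open>Convolution with an even kernel is symmetric with respect to the pairing \<open>\<integral> f g\<close>. Integrability is
  demanded for \<open>J * |f|\<close> times \<open>g\<close> only, so that \<open>g\<close> may be a function that is not integrable, such as the
  stationary solution.\<close>
lemma
  assumes [measurable]: "J \<in> borel_measurable borel" "f \<in> borel_measurable borel" "g \<in> borel_measurable borel"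
    and even: "\<And>x. J (- x) = J x" and J: "\<And>x. 0 \<le> J x"
    and sl: "\<And>x. integrable lborel (\<lambda>y. J (x - y) * f y)"
    and i: "integrable lborel (\<lambda>x. cv J (\<lambda>y. \<bar>f y\<bar>) x * g x)"
  shows cv_symmetric: "(LINT x|lborel. cv J f x * g x) = (LINT x|lborel. f x * cv J g x)"
    and cv_symmetric_integrable: "integrable lborel (\<lambda>x. f x * cv J g x)"
proof -
  let ?F = "\<lambda>x y. J (x - y) * f y * g x"
  have "(LINT y|lborel. norm (?F x y)) = \<bar>cv J (\<lambda>y. \<bar>f y\<bar>) x * g x\<bar>" for x
  proof -
    have "0 \<le> cv J (\<lambda>y. \<bar>f y\<bar>) x" unfolding cv_def by (intro integral_nonneg_AE) (auto simp: J)
    then show ?thesis by (simp add: cv_def abs_mult J)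
  qed
  then have I: "integrable (lborel \<Otimes>\<^sub>M lborel) (\<lambda>(x, y). ?F x y)"
    using sl i by (intro lborel_pair.Fubini_integrable) auto
  have J_swap: "J (x - y) = J (y - x)" for x y using even[of "x - y"] by simp
  have inner: "(LINT x|lborel. ?F x y) = f y * cv J g y" for y
    unfolding cv_def by (subst integral_mult_right_zero[symmetric]) (simp add: J_swap[of _ y] mult_ac)
  show "integrable lborel (\<lambda>x. f x * cv J g x)"
    using lborel_pair.integrable_snd[OF I] by (simp add: inner)
  have "(LINT x|lborel. cv J f x * g x) = (LINT x|lborel. LINT y|lborel. ?F x y)"
    unfolding cv_def by simp
  also have "\<dots> = (LINT y|lborel. LINT x|lborel. ?F x y)"
    by (rule lborel_pair.Fubini_integral[OF I, symmetric])
  finally show "(LINT x|lborel. cv J f x * g x) = (LINT x|lborel. f x * cv J g x)" by (simp add: inner)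
qed

section \<open>Gaussian integrals\<close>

text \<open>The characteristic function of the standard normal distribution, rescaled by \<open>\<surd>(2a)\<close>.\<close>
lemma gaussian_character_real:
  fixes a u :: real
  assumes a: "0 < a"
  shows "integrable lborel (\<lambda>s. exp (- (a * s\<^sup>2)) *\<^sub>R cis (u * s))"
    and "(LINT s|lborel. exp (- (a * s\<^sup>2)) *\<^sub>R cis (u * s)) = of_real (sqrt (pi / a) * exp (- (u\<^sup>2 / (4 * a))))"
proof -
  define c where "c = sqrt (2 * a)"
  have c: "c \<noteq> 0" "0 < c" "c\<^sup>2 = 2 * a" using a by (auto simp: c_def)
  have "char std_normal_distribution (u / c) = (LINT x|lborel. std_normal_density x *\<^sub>R cis (u / c * x))"
    unfolding char_def by (subst integral_density) (auto simp: cis_conv_exp intro!: Bochner_Integration.integral_cong normal_density_nonneg)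
  then have ch: "(LINT x|lborel. std_normal_density x *\<^sub>R cis (u / c * x)) = of_real (exp (- (u / c)\<^sup>2 / 2))"
    by (simp add: char_std_normal_distribution)
  have int: "integrable lborel (\<lambda>x. std_normal_density x *\<^sub>R cis (u / c * x))"
    using integrable_normal_density[of 1 0]
    by (rule Bochner_Integration.integrable_bound) (auto simp: cis_conv_exp)
  have eq: "std_normal_density (0 + c * s) *\<^sub>R cis (u / c * (0 + c * s))
      = (1 / sqrt (2 * pi)) *\<^sub>R (exp (- (a * s\<^sup>2)) *\<^sub>R cis (u * s))" for s
    using c by (simp add: normal_density_def power_mult_distrib)
  have "integrable lborel (\<lambda>s. std_normal_density (0 + c * s) *\<^sub>R cis (u / c * (0 + c * s)))"
    by (rule lborel_integrable_real_affine[OF int c(1)])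
  then show gi: "integrable lborel (\<lambda>s. exp (- (a * s\<^sup>2)) *\<^sub>R cis (u * s))"
    using integrable_scaleR_right[of "sqrt (2 * pi)"] unfolding eq by fastforce
  have "of_real (exp (- (u / c)\<^sup>2 / 2))
      = c *\<^sub>R (LINT s|lborel. std_normal_density (0 + c * s) *\<^sub>R cis (u / c * (0 + c * s)))"
    unfolding ch[symmetric] using lborel_integral_real_affine[OF c(1), of "\<lambda>x. std_normal_density x *\<^sub>R cis (u / c * x)" 0] c by simp
  then have *: "complex_of_real (exp (- (u / c)\<^sup>2 / 2))
      = (c / sqrt (2 * pi)) *\<^sub>R (LINT s|lborel. exp (- (a * s\<^sup>2)) *\<^sub>R cis (u * s))"
    unfolding eq integral_scaleR_right[of _ "1 / sqrt (2 * pi)" "\<lambda>s. exp (- (a * s\<^sup>2)) *\<^sub>R cis (u * s)"]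
    by (simp only: scaleR_scaleR times_divide_eq_right mult_1_right)
  have "c / sqrt (2 * pi) = 1 / sqrt (pi / a)"
    using a by (simp add: c_def real_sqrt_divide real_sqrt_mult)
  moreover have "- (u / c)\<^sup>2 / 2 = - (u\<^sup>2 / (4 * a))" using c(3) by (simp add: power_divide)
  ultimately have "complex_of_real (exp (- (u\<^sup>2 / (4 * a))))
      = (1 / sqrt (pi / a)) *\<^sub>R (LINT s|lborel. exp (- (a * s\<^sup>2)) *\<^sub>R cis (u * s))"
    using * by simp
  then have "sqrt (pi / a) *\<^sub>R complex_of_real (exp (- (u\<^sup>2 / (4 * a))))
      = (LINT s|lborel. exp (- (a * s\<^sup>2)) *\<^sub>R cis (u * s))"
    using a by simp
  then show "(LINT s|lborel. exp (- (a * s\<^sup>2)) *\<^sub>R cis (u * s)) = of_real (sqrt (pi / a) * exp (- (u\<^sup>2 / (4 * a))))"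
    by (simp add: scaleR_conv_of_real)
qed

text \<open>The integrand is a product of one-dimensional integrands over an orthonormal basis.\<close>
lemma gaussian_character:
  fixes x :: "'a::euclidean_space"
  assumes a: "0 < a"
  shows "integrable lborel (\<lambda>\<xi>. exp (- (a * (norm \<xi>)\<^sup>2)) *\<^sub>R cis (x \<bullet> \<xi>))" (is "integrable _ ?f")
    and "(LINT \<xi>|lborel. exp (- (a * (norm \<xi>)\<^sup>2)) *\<^sub>R cis (x \<bullet> \<xi>))
      = of_real ((pi / a) powr (real DIM('a) / 2) * exp (- ((norm x)\<^sup>2 / (4 * a))))"
proof -
  interpret product_sigma_finite "\<lambda>_::'a. lborel :: real measure" by standard
  let ?g = "\<lambda>b s. exp (- (a * s\<^sup>2)) *\<^sub>R cis ((x \<bullet> b) * s)"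
  let ?P = "\<Pi>\<^sub>M b\<in>(Basis::'a set). (lborel::real measure)"
  let ?T = "\<lambda>v. \<Sum>b\<in>Basis. v b *\<^sub>R b :: 'a"
  have prod: "?f (?T v) = (\<Prod>b\<in>Basis. ?g b (v b))" for v
  proof -
    have "(norm (?T v))\<^sup>2 = (\<Sum>b\<in>Basis. (v b)\<^sup>2)"
      unfolding power2_norm_eq_inner
      by (subst euclidean_inner) (simp add: inner_sum_left_Basis power2_eq_square)
    moreover have "x \<bullet> ?T v = (\<Sum>b\<in>Basis. (x \<bullet> b) * v b)"
      by (subst euclidean_inner) (simp add: inner_sum_left_Basis)
    moreover have "cis (\<Sum>b\<in>A. h b) = (\<Prod>b\<in>A. cis (h b))" for A and h :: "'a \<Rightarrow> real"
      by (induction A rule: infinite_finite_induct) (auto simp: cis_mult[symmetric])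
    ultimately show ?thesis
      by (simp add: sum_distrib_left sum_negf[symmetric] exp_sum prod.distrib scaleR_conv_of_real)
  qed
  have gi: "integrable lborel (?g b)" for b using gaussian_character_real(1)[OF a] .
  have Ti: "?T \<in> measurable ?P borel" by measurable
  have fm: "?f \<in> borel_measurable borel" by (simp add: cis_conv_exp)
  have "integrable ?P (\<lambda>v. ?f (?T v))"
    unfolding prod using gi by (intro product_integrable_prod) auto
  then have "integrable (distr ?P borel ?T) ?f"
    by (subst integrable_distr_eq[OF Ti fm])
  then show "integrable lborel ?f" by (simp add: lborel_eq[symmetric])
  have "integral\<^sup>L lborel ?f = (LINT v|?P. ?f (?T v))"
    by (subst lborel_eq) (rule integral_distr[OF Ti fm])
  also have "\<dots> = (\<Prod>b\<in>Basis. integral\<^sup>L lborel (?g b))"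
    unfolding prod by (rule product_integral_prod) (use gi in auto)
  also have "\<dots> = (\<Prod>b\<in>Basis. complex_of_real (sqrt (pi / a) * exp (- ((x \<bullet> b)\<^sup>2 / (4 * a)))))"
    by (simp add: gaussian_character_real(2)[OF a])
  also have "\<dots> = of_real (sqrt (pi / a) ^ DIM('a) * exp (\<Sum>b\<in>Basis. - ((x \<bullet> b)\<^sup>2 / (4 * a))))"
    by (simp add: prod.distrib exp_sum)
  also have "(\<Sum>b\<in>Basis. - ((x \<bullet> b)\<^sup>2 / (4 * a))) = - ((norm x)\<^sup>2 / (4 * a))"
    unfolding power2_norm_eq_inner
    by (subst (2) euclidean_inner) (simp add: sum_negf sum_divide_distrib power2_eq_square)
  also have "sqrt (pi / a) ^ DIM('a) = (pi / a) powr (real DIM('a) / 2)"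
    using a by (simp add: powr_half_sqrt[symmetric] powr_powr flip: powr_realpow)
  finally show "integral\<^sup>L lborel ?f = of_real ((pi / a) powr (real DIM('a) / 2) * exp (- ((norm x)\<^sup>2 / (4 * a))))" .
qed

lemma
  fixes x :: "'a::euclidean_space"
  assumes a: "0 < a"
  shows gaussian_cos_integrable: "integrable lborel (\<lambda>\<xi>. exp (- (a * (norm \<xi>)\<^sup>2)) * cos (x \<bullet> \<xi>))"
    and gaussian_cos_integral: "(LINT \<xi>|lborel. exp (- (a * (norm \<xi>)\<^sup>2)) * cos (x \<bullet> \<xi>))
      = (pi / a) powr (real DIM('a) / 2) * exp (- ((norm x)\<^sup>2 / (4 * a)))"
  using gaussian_character[OF a, of x] integral_Re[OF gaussian_character(1)[OF a, of x]]
    integrable_Re[OF gaussian_character(1)[OF a, of x]] by auto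

lemma
  assumes a: "0 < a"
  shows gaussian_integrable: "integrable lborel (\<lambda>\<xi>::'a::euclidean_space. exp (- (a * (norm \<xi>)\<^sup>2)))"
    and gaussian_integral: "(LINT \<xi>::'a|lborel. exp (- (a * (norm \<xi>)\<^sup>2))) = (pi / a) powr (real DIM('a) / 2)"
  using gaussian_cos_integrable[OF a, of "0::'a"] gaussian_cos_integral[OF a, of "0::'a"] by auto

lemma heat_kernel_fourier:
  fixes x :: "'a::euclidean_space"
  assumes "0 < \<alpha>" "0 < t"
  shows "heat_kernel \<alpha> x t =
    (LINT \<xi>|lborel. exp (- (\<alpha> * t * (norm \<xi>)\<^sup>2)) * cos (x \<bullet> \<xi>)) / (2 * pi) ^ DIM('a)"
proof -
  let ?d = "real DIM('a) / 2"
  have "(4 * pi * \<alpha> * t) powr (- ?d) = (pi / (\<alpha> * t)) powr ?d / ((2 * pi)\<^sup>2) powr ?d"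
  proof -
    have "pi / (\<alpha> * t) / (2 * pi)\<^sup>2 = inverse (4 * pi * \<alpha> * t)"
      using assms by (simp add: power2_eq_square field_simps)
    moreover have "(pi / (\<alpha> * t)) powr ?d / ((2 * pi)\<^sup>2) powr ?d = (pi / (\<alpha> * t) / (2 * pi)\<^sup>2) powr ?d"
      by (rule powr_divide[symmetric])
    ultimately show ?thesis by (simp only: powr_minus inverse_powr)
  qed
  also have "((2 * pi)\<^sup>2) powr ?d = (2 * pi) ^ DIM('a)"
  proof -
    have "(2 * pi)\<^sup>2 = (2 * pi) powr 2" by (rule powr_numeral[symmetric]) simp
    then have "((2 * pi)\<^sup>2) powr ?d = (2 * pi) powr (2 * ?d)" by (simp only: powr_powr)
    also have "\<dots> = (2 * pi) ^ DIM('a)" by (simp add: powr_realpow)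
    finally show ?thesis .
  qed
  finally show ?thesis
    using gaussian_cos_integral[of "\<alpha> * t" x] assms by (simp add: heat_kernel_def mult_ac)
qed

lemma heat_kernel_integrable:
  assumes "0 < \<alpha>" "0 < t"
  shows "integrable lborel (\<lambda>x::'a::euclidean_space. heat_kernel \<alpha> x t)"
    and "(LINT x::'a|lborel. heat_kernel \<alpha> x t) = 1"
proof -
  have a: "0 < 1 / (4 * \<alpha> * t)" using assms by simp
  have eq: "(\<lambda>x::'a. heat_kernel \<alpha> x t)
    = (\<lambda>x. (4 * pi * \<alpha> * t) powr (- (real DIM('a) / 2)) * exp (- (1 / (4 * \<alpha> * t) * (norm x)\<^sup>2)))"
    by (auto simp: heat_kernel_def)
  show "integrable lborel (\<lambda>x::'a. heat_kernel \<alpha> x t)"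
    unfolding eq using gaussian_integrable[OF a] by (rule integrable_mult_right)
  show "(LINT x::'a|lborel. heat_kernel \<alpha> x t) = 1"
    unfolding eq using assms gaussian_integral[OF a, where 'a='a]
    by (simp add: powr_minus field_simps)
qed

section \<open>Convolution powers of an isotropic kernel\<close>

text \<open>\<open>cvpow K n\<close> is the convolution power of order \<open>n + 1\<close>: the power of order zero would be a point
  mass. The order is therefore written as \<open>Suc n\<close> in the estimates below.\<close>
primrec cvpow :: "('a::euclidean_space \<Rightarrow> real) \<Rightarrow> nat \<Rightarrow> 'a \<Rightarrow> real" where
  "cvpow K 0 = K"
| "cvpow K (Suc n) = cv K (cvpow K n)"

lemma continuous_cv:
  fixes K f :: "'a::euclidean_space \<Rightarrow> real"
  assumes cont: "continuous_on UNIV K" and K: "\<And>x. \<bar>K x\<bar> \<le> B" and f: "integrable lborel f"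
  shows "continuous_on UNIV (cv K f)"
proof (rule continuous_on_sequentiallyI)
  fix s :: "nat \<Rightarrow> 'a" and a assume lim: "s \<longlonglongrightarrow> a"
  have [measurable]: "K \<in> borel_measurable borel" "f \<in> borel_measurable borel"
    using cont f by (auto intro: borel_measurable_continuous_onI)
  show "(\<lambda>n. cv K f (s n)) \<longlonglongrightarrow> cv K f a"
    unfolding cv_def
  proof (rule integral_dominated_convergence[where w="\<lambda>y. B * \<bar>f y\<bar>"])
    show "AE y in lborel. (\<lambda>n. K (s n - y) * f y) \<longlonglongrightarrow> K (a - y) * f y"
    proof (intro AE_I2 tendsto_mult_right)
      fix y
      have "isCont K (a - y)" using cont by (simp add: continuous_on_eq_continuous_at)
      then show "(\<lambda>n. K (s n - y)) \<longlonglongrightarrow> K (a - y)"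
        by (rule isCont_tendsto_compose) (intro tendsto_intros lim)
    qed
    show "integrable lborel (\<lambda>y. B * \<bar>f y\<bar>)" using f by simp
  qed (auto simp: abs_mult intro!: mult_right_mono K)
qed

lemma integral_pos_continuous:
  fixes f :: "'a::euclidean_space \<Rightarrow> real"
  assumes i: "integrable lborel f" and cont: "continuous_on UNIV f" and nn: "\<And>x. 0 \<le> f x" and a: "0 < f a"
  shows "0 < (LINT x|lborel. f x)"
proof (rule ccontr)
  assume "\<not> 0 < (LINT x|lborel. f x)"
  then have "(LINT x|lborel. f x) = 0" using Bochner_Integration.integral_nonneg[of lborel f] nn by (simp add: less_le)
  then have "AE x in lborel. f x = 0" using integral_nonneg_eq_0_iff_AE[OF i] nn by simp
  then have ae: "AE x in lebesgue. x \<in> {x. f x = 0}" by (auto intro: AE_completion)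
  have "open {x. 0 < f x}" using cont by (simp add: open_Collect_less continuous_on_const)
  then have "closed {x. f x = 0}" using cont by (simp add: closed_Collect_eq)
  with ae have "a \<in> {x. f x = 0}" by (intro mem_closed_if_AE_lebesgue)
  with a show False by simp
qed

text \<open>The properties of the jump kernel that the estimates depend on. Radial symmetry enters only through
  evenness and through the second moments, which are those of a multiple of the identity matrix; the
  parameter \<open>\<alpha>\<close> is then the diffusivity.\<close>
locale isotropic_kernel =
  fixes J :: "'a::euclidean_space \<Rightarrow> real" and \<alpha> :: real
  assumes J_cont: "continuous_on UNIV J"
    and J_nonneg: "0 \<le> J x"
    and J_even: "J (- x) = J x"
    and J_supp: "1 < norm x \<Longrightarrow> J x = 0"
    and J_0: "0 < J 0"
    and J_integral: "(LINT x|lborel. J x) = 1"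
    and J_isotropic: "(LINT x|lborel. (x \<bullet> \<xi>)\<^sup>2 * J x) = 2 * \<alpha> * (norm \<xi>)\<^sup>2"
begin

lemma J_measurable [measurable]: "J \<in> borel_measurable borel"
  using J_cont by (rule borel_measurable_continuous_onI)

definition Jmax :: real where "Jmax = (SUP x\<in>cball 0 1. J x)"

lemma J_le: "J x \<le> Jmax"
proof -
  have "compact (J ` cball 0 1)"
    by (intro compact_continuous_image continuous_on_subset[OF J_cont]) auto
  then have bdd: "bdd_above (J ` cball 0 1)" by (intro bounded_imp_bdd_above compact_imp_bounded)
  then have in_ball: "J y \<le> Jmax" if "norm y \<le> 1" for y
    unfolding Jmax_def using that by (intro cSUP_upper) auto
  show ?thesis
  proof (cases "norm x \<le> 1")
    case False
    then have "J x = 0" using J_supp by simp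
    then show ?thesis using in_ball[of 0] J_0 by simp
  qed (rule in_ball)
qed

lemma Jmax_pos: "0 < Jmax" using J_le[of 0] J_0 by simp

lemma J_abs_le: "\<bar>J x\<bar> \<le> Jmax" using J_le J_nonneg by simp

lemma J_mult_integrable:
  fixes g :: "'a \<Rightarrow> 'b::{banach, second_countable_topology}"
  assumes "continuous_on UNIV g"
  shows "integrable lborel (\<lambda>x. J x *\<^sub>R g x)"
proof -
  have "integrable lborel (\<lambda>x. indicator (cball 0 1) x *\<^sub>R (J x *\<^sub>R g x))"
    by (rule borel_integrable_compact)
       (auto intro!: continuous_intros continuous_on_subset[OF J_cont] continuous_on_subset[OF assms])
  moreover have "(\<lambda>x. indicator (cball 0 1) x *\<^sub>R (J x *\<^sub>R g x)) = (\<lambda>x. J x *\<^sub>R g x)"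
  proof
    fix x show "indicator (cball 0 1) x *\<^sub>R (J x *\<^sub>R g x) = J x *\<^sub>R g x"
    using J_supp[of x] by (cases "norm x \<le> 1") (auto simp: indicator_def not_le)
  qed
  ultimately show ?thesis by metis
qed

lemma J_integrable: "integrable lborel J"
  using J_mult_integrable[of "\<lambda>_. 1::real"] by simp

lemma J_moment: "integrable lborel (\<lambda>x. (x \<bullet> \<xi>)\<^sup>2 * J x)"
  using J_mult_integrable[of "\<lambda>x. (x \<bullet> \<xi>)\<^sup>2"] by (simp add: mult.commute continuous_intros)

lemma alpha_pos: "0 < \<alpha>"
proof -
  obtain b :: 'a where b: "b \<in> Basis" using nonempty_Basis by blast
  have "isCont J 0" using J_cont by (simp add: continuous_on_eq_continuous_at)
  then obtain r where r: "r > 0" "\<And>x. dist x 0 < r \<Longrightarrow> dist (J x) (J 0) < J 0"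
    unfolding continuous_at_eps_delta using J_0 by (metis dist_commute)
  have "0 < J ((r / 2) *\<^sub>R b)" using r(2)[of "(r / 2) *\<^sub>R b"] r(1) b by (auto simp: dist_norm)
  then have "0 < (LINT x|lborel. (x \<bullet> b)\<^sup>2 * J x)"
    using r(1) b
    by (intro integral_pos_continuous[where a="(r / 2) *\<^sub>R b"] J_moment continuous_intros J_cont)
       (auto simp: J_nonneg)
  then show ?thesis using b by (simp add: J_isotropic)
qed

lemma
  shows cvpow_continuous: "continuous_on UNIV (cvpow J n)"
    and cvpow_nonneg: "0 \<le> cvpow J n x"
    and cvpow_le: "cvpow J n x \<le> Jmax"
    and cvpow_integrable: "integrable lborel (cvpow J n)"
proof -
  have "continuous_on UNIV (cvpow J n) \<and> (\<forall>x. 0 \<le> cvpow J n x) \<and> (\<forall>x. cvpow J n x \<le> Jmax) \<and>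
     integrable lborel (cvpow J n) \<and> (LINT x|lborel. cvpow J n x) = 1"
  proof (induction n)
    case 0
    then show ?case using J_cont J_nonneg J_le J_integrable J_integral by auto
  next
    case (Suc n)
    have nn: "0 \<le> cv J (cvpow J n) x" for x
      using Suc J_nonneg unfolding cv_def by (intro Bochner_Integration.integral_nonneg) auto
    have "\<bar>cv J (cvpow J n) x\<bar> \<le> Jmax * (LINT y|lborel. \<bar>cvpow J n y\<bar>)" for x
      using Suc J_abs_le by (intro cv_le) auto
    then have "cv J (cvpow J n) x \<le> Jmax" for x
      using Suc by (auto intro: order_trans[OF abs_ge_self])
    then show ?case
      using Suc nn continuous_cv[OF J_cont J_abs_le, of "cvpow J n"]
        cv_integrable[OF J_integrable, of "cvpow J n", OF _ J_measurable J_abs_le]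
        cv_integral[OF J_integrable, of "cvpow J n", OF _ J_measurable J_abs_le]
      by (auto simp: J_integral)
  qed
  then show "continuous_on UNIV (cvpow J n)" "0 \<le> cvpow J n x" "cvpow J n x \<le> Jmax"
    "integrable lborel (cvpow J n)" by auto
qed

lemma cvpow_abs_le: "\<bar>cvpow J n x\<bar> \<le> Jmax" using cvpow_le cvpow_nonneg by simp

lemma cvpow_measurable [measurable]: "cvpow J n \<in> borel_measurable borel"
  using cvpow_continuous by (rule borel_measurable_continuous_onI)

lemma cvpow_even: "cvpow J n (- x) = cvpow J n x"
proof (induction n arbitrary: x)
  case (Suc n)
  have "cv J (cvpow J n) (- x) = (LINT y|lborel. J (- x - (0 - y)) * cvpow J n (0 - y))"
    unfolding cv_def by (rule integral_reflect_shift[symmetric]) measurable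
  also have "\<dots> = cv J (cvpow J n) x"
    unfolding cv_def using J_even[of "x - _"] Suc by (intro Bochner_Integration.integral_cong) (auto simp: algebra_simps)
  finally show ?case by simp
qed (simp add: J_even)

lemma cv_cvpow_add:
  assumes f: "integrable lborel f"
  shows "cv (cvpow J m) (cv (cvpow J n) f) = cv (cvpow J (Suc (m + n))) f"
proof (induction m)
  case 0
  then show ?case
    using cv_assoc[OF J_measurable cvpow_measurable J_abs_le cvpow_abs_le cvpow_integrable f] by auto
next
  case (Suc m)
  have A: "cv J (cv (cvpow J k) g) = cv (cvpow J (Suc k)) g" if "integrable lborel g" for k g
    using cv_assoc[OF J_measurable cvpow_measurable J_abs_le cvpow_abs_le cvpow_integrable that] by auto
  have "integrable lborel (cv (cvpow J n) f)"
    using cv_integrable[OF cvpow_integrable f cvpow_measurable cvpow_abs_le] .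
  then show ?case using Suc A f by (metis add_Suc)
qed

lemma cvpow_split: "cvpow J (Suc (m + n)) x = cv (cvpow J m) (cvpow J n) x"
proof (induction m arbitrary: x)
  case (Suc m)
  have "cv (cvpow J (Suc m)) (cvpow J n) x = cv J (cv (cvpow J m) (cvpow J n)) x"
    by (simp only: cvpow.simps)
       (rule cv_assoc[symmetric, OF J_measurable cvpow_measurable J_abs_le cvpow_abs_le cvpow_integrable cvpow_integrable])
  also have "cv (cvpow J m) (cvpow J n) = cvpow J (Suc (m + n))" using Suc by auto
  finally show ?case by simp
qed simp

lemma cvpow_character:
  fixes chi :: "'a \<Rightarrow> 'b::{real_normed_field, banach, second_countable_topology}"
  assumes mult: "\<And>x y. chi (x + y) = chi x * chi y" and cont: "continuous_on UNIV chi"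
  shows "integrable lborel (\<lambda>x. cvpow J n x *\<^sub>R chi x)"
    and "(LINT x|lborel. cvpow J n x *\<^sub>R chi x) = (LINT x|lborel. J x *\<^sub>R chi x) ^ Suc n"
proof -
  have [measurable]: "chi \<in> borel_measurable borel" using cont by (rule borel_measurable_continuous_onI)
  have "integrable lborel (\<lambda>x. cvpow J n x *\<^sub>R chi x) \<and>
    (LINT x|lborel. cvpow J n x *\<^sub>R chi x) = (LINT x|lborel. J x *\<^sub>R chi x) ^ Suc n"
  proof (induction n)
    case 0
    then show ?case using J_mult_integrable[OF cont] by simp
  next
    case (Suc n)
    have sl: "integrable lborel (\<lambda>y. J (x - y) * cvpow J n y)" for x
      using J_measurable J_abs_le cvpow_integrable by (rule integrable_cv_slice)
    show ?case
      using cv_character_integrable[OF mult _ _ _ J_mult_integrable[OF cont] _ sl]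
        cv_character[OF mult _ _ _ J_mult_integrable[OF cont] _ sl] Suc by simp
  qed
  then show "integrable lborel (\<lambda>x. cvpow J n x *\<^sub>R chi x)"
    "(LINT x|lborel. cvpow J n x *\<^sub>R chi x) = (LINT x|lborel. J x *\<^sub>R chi x) ^ Suc n" by auto
qed

section \<open>The Fourier transform of the kernel\<close>

definition Jhat :: "'a \<Rightarrow> real" where "Jhat \<xi> = (LINT x|lborel. J x * cos (x \<bullet> \<xi>))"

lemma integral_odd_zero:
  fixes f :: "'a \<Rightarrow> real"
  assumes [measurable]: "f \<in> borel_measurable borel" and "\<And>x. f (- x) = - f x"
  shows "(LINT x|lborel. f x) = 0"
proof -
  have "(LINT x|lborel. f x) = (LINT x|lborel. f (0 - x))"
    by (rule integral_reflect_shift[symmetric]) simp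
  also have "\<dots> = - (LINT x|lborel. f x)" by (simp add: assms)
  finally show ?thesis by simp
qed

text \<open>The cosine transform of an even function is its full Fourier transform, so it takes convolution
  powers to powers.\<close>
lemma cvpow_hat: "(LINT x|lborel. cvpow J n x * cos (x \<bullet> \<xi>)) = Jhat \<xi> ^ Suc n"
proof -
  let ?c = "\<lambda>x. cis (x \<bullet> \<xi>)"
  have m: "?c (x + y) = ?c x * ?c y" for x y by (simp add: cis_mult inner_add_left)
  have c: "continuous_on UNIV ?c" by (auto simp: cis_conv_exp intro!: continuous_intros)
  have "(LINT x|lborel. J x *\<^sub>R ?c x) = of_real (Jhat \<xi>)"
  proof (rule complex_eqI)
    show "Re (LINT x|lborel. J x *\<^sub>R ?c x) = Re (of_real (Jhat \<xi>))"
      using integral_Re[OF J_mult_integrable[OF c]] by (simp add: Jhat_def)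
    have "Im (LINT x|lborel. J x *\<^sub>R ?c x) = (LINT x|lborel. J x * sin (x \<bullet> \<xi>))"
      using integral_Im[OF J_mult_integrable[OF c]] by simp
    also have "\<dots> = 0" by (rule integral_odd_zero) (auto simp: J_even)
    finally show "Im (LINT x|lborel. J x *\<^sub>R ?c x) = Im (of_real (Jhat \<xi>))" by simp
  qed
  then have "Re (LINT x|lborel. cvpow J n x *\<^sub>R ?c x) = Jhat \<xi> ^ Suc n"
    unfolding cvpow_character(2)[OF m c] by (metis Re_complex_of_real of_real_power)
  then show ?thesis
    using integral_Re[OF cvpow_character(1)[OF m c, of n]] by simp
qed

end

lemma integral_scaling:
  fixes f :: "'a::euclidean_space \<Rightarrow> real"
  assumes [measurable]: "f \<in> borel_measurable borel" and c: "0 < c"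
  shows "(LINT y|lborel. f y) = c ^ DIM('a) * (LINT y|lborel. f (c *\<^sub>R y))"
proof -
  have "(LINT y|lborel. f y)
      = (LINT y|density (distr lborel borel (\<lambda>y. 0 + c *\<^sub>R y)) (\<lambda>_. ennreal (\<bar>c\<bar> ^ DIM('a))). f y)"
    using lborel_affine[of c "0::'a"] c by (simp add: ennreal_power)
  also have "\<dots> = (LINT y|distr lborel borel (\<lambda>y. 0 + c *\<^sub>R y). \<bar>c\<bar> ^ DIM('a) *\<^sub>R f y)"
    by (rule integral_density) auto
  also have "\<dots> = (LINT y|lborel. \<bar>c\<bar> ^ DIM('a) *\<^sub>R f (0 + c *\<^sub>R y))"
    by (rule integral_distr) auto
  finally show ?thesis using c by simp
qed

lemma heat_kernel_measurable [measurable]: "(\<lambda>x. heat_kernel a x t) \<in> borel_measurable borel"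
  unfolding heat_kernel_def by measurable

lemma heat_kernel_nonneg: "0 \<le> heat_kernel a x t"
  by (simp add: heat_kernel_def)

lemma heat_kernel_scale:
  fixes z :: "'a::euclidean_space"
  assumes s: "0 < s"
  shows "s ^ DIM('a) * heat_kernel 1 (s *\<^sub>R z) (s\<^sup>2) = heat_kernel 1 z 1"
proof -
  have "(s\<^sup>2) powr (- (real DIM('a) / 2)) = inverse (s ^ DIM('a))"
  proof -
    have "s\<^sup>2 = s powr 2" using s by simp
    then have "(s\<^sup>2) powr (- (real DIM('a) / 2)) = s powr (- real DIM('a))" by (simp only: powr_powr) simp
    then show ?thesis using s by (simp add: powr_minus powr_realpow)
  qed
  then have "s ^ DIM('a) * (4 * pi * s\<^sup>2) powr (- (real DIM('a) / 2)) = (4 * pi) powr (- (real DIM('a) / 2))"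
    using s by (simp add: powr_mult)
  then show ?thesis
    using s by (simp add: heat_kernel_def power_mult_distrib mult.assoc[symmetric])
qed

text \<open>Scaling moves the width of the Gaussian into the argument of \<open>P\<close>; then dominated convergence
  applies.\<close>
lemma approximate_identity:
  fixes P :: "'a::euclidean_space \<Rightarrow> real"
  assumes cont: "continuous_on UNIV P" and bd: "\<And>x. \<bar>P x\<bar> \<le> B"
    and s0: "\<And>k. 0 < s k" and s: "s \<longlonglongrightarrow> (0::real)"
  shows "(\<lambda>k. LINT y|lborel. P (x - y) * heat_kernel 1 y ((s k)\<^sup>2)) \<longlonglongrightarrow> P x"
proof -
  have [measurable]: "P \<in> borel_measurable borel" using cont by (rule borel_measurable_continuous_onI)
  let ?G = "\<lambda>z::'a. heat_kernel 1 z 1"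
  have eq: "(LINT y|lborel. P (x - y) * heat_kernel 1 y ((s k)\<^sup>2)) = (LINT z|lborel. P (x - s k *\<^sub>R z) * ?G z)" for k
  proof -
    have "(LINT y|lborel. P (x - y) * heat_kernel 1 y ((s k)\<^sup>2))
        = (LINT z|lborel. s k ^ DIM('a) * (P (x - s k *\<^sub>R z) * heat_kernel 1 (s k *\<^sub>R z) ((s k)\<^sup>2)))"
      by (subst integral_scaling[OF _ s0[of k]]) auto
    also have "\<dots> = (LINT z|lborel. P (x - s k *\<^sub>R z) * ?G z)"
      using heat_kernel_scale[OF s0[of k], where 'a='a]
      by (intro Bochner_Integration.integral_cong refl) (metis mult.left_commute)
    finally show ?thesis .
  qed
  have "(\<lambda>k. LINT z|lborel. P (x - s k *\<^sub>R z) * ?G z) \<longlonglongrightarrow> (LINT z|lborel. P x * ?G z)"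
  proof (rule integral_dominated_convergence[where w="\<lambda>z. B * ?G z"])
    show "integrable lborel (\<lambda>z. B * ?G z)" by (intro integrable_mult_right heat_kernel_integrable) auto
    show "AE z in lborel. (\<lambda>k. P (x - s k *\<^sub>R z) * ?G z) \<longlonglongrightarrow> P x * ?G z"
    proof (intro AE_I2 tendsto_mult_right)
      fix z
      have "isCont P x" using cont by (simp add: continuous_on_eq_continuous_at)
      moreover have "(\<lambda>k. x - s k *\<^sub>R z) \<longlonglongrightarrow> x"
        using tendsto_diff[OF tendsto_const tendsto_scaleR[OF s tendsto_const], of x z] by simp
      ultimately show "(\<lambda>k. P (x - s k *\<^sub>R z)) \<longlonglongrightarrow> P x" by (rule isCont_tendsto_compose)
    qed
  qed (auto simp: abs_mult heat_kernel_nonneg intro!: mult_right_mono bd)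
  then show ?thesis unfolding eq by (simp add: heat_kernel_integrable(2))
qed

text \<open>The tangent inequality \<open>ln y \<le> y - 1\<close> at \<open>y = c x / p\<close> is sharp at the maximum \<open>x = p / c\<close>.\<close>
lemma powr_exp_bounded:
  fixes p c :: real
  assumes "0 < p" "0 < c"
  obtains C where "0 < C" "\<And>x. 0 < x \<Longrightarrow> x powr p * exp (- c * x) \<le> C"
proof
  show "0 < exp (p * ln (p / c) - p)" by simp
  fix x :: real assume x: "0 < x"
  have "ln (c * x / p) \<le> c * x / p - 1" using assms x by (intro ln_le_minus_one) auto
  then have "p * ln (c * x / p) \<le> p * (c * x / p - 1)" using assms by (intro mult_left_mono) auto
  moreover have "ln (c * x / p) = ln x - ln (p / c)" using assms x by (simp add: ln_mult ln_div)
  ultimately have "p * (ln x - ln (p / c)) \<le> c * x - p" using assms by (simp add: right_diff_distrib)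
  then have "p * ln x - c * x \<le> p * ln (p / c) - p" by (simp add: right_diff_distrib)
  then have "exp (p * ln x - c * x) \<le> exp (p * ln (p / c) - p)" by simp
  then show "x powr p * exp (- c * x) \<le> exp (p * ln (p / c) - p)"
    using x by (simp add: powr_def exp_diff exp_minus field_simps)
qed

text \<open>The product of \<open>1 + y + y\<^sup>2/2\<close> and \<open>1 - y + y\<^sup>2/2\<close> is \<open>1 + y^4/4\<close>.\<close>
lemma exp_minus_le_quadratic:
  fixes y :: real
  assumes y: "0 \<le> y"
  shows "exp (- y) \<le> 1 - y + y\<^sup>2 / 2"
proof -
  have "1 + y + y\<^sup>2 / 2 \<le> exp y" using exp_lower_Taylor_quadratic[OF y] .
  moreover have p: "0 < 1 + y + y\<^sup>2 / 2" using y by (simp add: add_pos_nonneg)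
  ultimately have "exp (- y) \<le> 1 / (1 + y + y\<^sup>2 / 2)" by (simp add: exp_minus field_simps)
  also have "\<dots> \<le> 1 - y + y\<^sup>2 / 2"
  proof -
    have "(1 - y + y\<^sup>2 / 2) * (1 + y + y\<^sup>2 / 2) = 1 + y ^ 4 / 4"
      by (simp add: power2_eq_square power4_eq_xxxx algebra_simps)
    then have "1 \<le> (1 - y + y\<^sup>2 / 2) * (1 + y + y\<^sup>2 / 2)" by simp
    then show ?thesis using p by (simp add: divide_le_eq)
  qed
  finally show ?thesis .
qed

lemma cos_taylor: "\<bar>cos s - (1 - s\<^sup>2 / 2)\<bar> \<le> s ^ 4 / 24" for s :: real
proof -
  obtain t where "cos s = (\<Sum>m<4. cos_coeff m * s ^ m) + (cos (t + 1/2 * real 4 * pi) / fact 4) * s ^ 4"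
    using Maclaurin_cos_expansion[of s 4] by auto
  then have eq: "cos s - (1 - s\<^sup>2 / 2) = cos (t + 1/2 * real 4 * pi) * (s ^ 4 / 24)"
    by (simp add: lessThan_nat_numeral lessThan_Suc numeral_eq_Suc[symmetric] cos_coeff_def fact_numeral power2_eq_square)
  have "\<bar>cos s - (1 - s\<^sup>2 / 2)\<bar> = \<bar>cos (t + 1/2 * real 4 * pi)\<bar> * (s ^ 4 / 24)"
    unfolding eq by (simp add: abs_mult)
  also have "\<dots> \<le> 1 * (s ^ 4 / 24)" by (intro mult_right_mono) auto
  finally show ?thesis by simp
qed

lemma abs_power_diff_le:
  fixes a b r :: real
  assumes "\<bar>a\<bar> \<le> r" "\<bar>b\<bar> \<le> r"
  shows "\<bar>a ^ Suc n - b ^ Suc n\<bar> \<le> real (Suc n) * \<bar>a - b\<bar> * r ^ n"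
proof -
  have "\<bar>\<Sum>i<Suc n. a ^ i * b ^ (n - i)\<bar> \<le> (\<Sum>i<Suc n. r ^ n)"
  proof (rule order_trans[OF sum_abs], rule sum_mono)
    fix i assume "i \<in> {..<Suc n}"
    then have "r ^ n = r ^ i * r ^ (n - i)" by (simp add: power_add[symmetric])
    moreover have "\<bar>a ^ i * b ^ (n - i)\<bar> \<le> r ^ i * r ^ (n - i)"
      using assms by (auto simp: abs_mult power_abs intro!: mult_mono power_mono)
    ultimately show "\<bar>a ^ i * b ^ (n - i)\<bar> \<le> r ^ n" by simp
  qed
  then have "\<bar>a - b\<bar> * \<bar>\<Sum>i<Suc n. a ^ i * b ^ (n - i)\<bar> \<le> \<bar>a - b\<bar> * (real (Suc n) * r ^ n)"
    by (intro mult_left_mono) auto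
  moreover have "a ^ Suc n - b ^ Suc n = (a - b) * (\<Sum>i<Suc n. a ^ i * b ^ (n - i))"
    by (rule diff_power_eq_sum)
  ultimately show ?thesis by (simp only: abs_mult mult_ac)
qed

context isotropic_kernel
begin

lemma Jhat_measurable [measurable]: "Jhat \<in> borel_measurable borel"
  unfolding Jhat_def by measurable

lemma J_cos_integrable: "integrable lborel (\<lambda>x. J x * cos (x \<bullet> \<xi>))"
  using J_mult_integrable[of "\<lambda>x. cos (x \<bullet> \<xi>)"] by (simp add: continuous_intros)

lemma Jhat_abs_le: "\<bar>Jhat \<xi>\<bar> \<le> 1"
proof -
  have "\<bar>Jhat \<xi>\<bar> \<le> (LINT x|lborel. \<bar>J x * cos (x \<bullet> \<xi>)\<bar>)"
    unfolding Jhat_def by (rule integral_abs_bound)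
  also have "\<dots> \<le> (LINT x|lborel. J x)"
    using J_cos_integrable[of \<xi>] J_nonneg
    by (intro integral_mono integrable_abs J_integrable) (auto simp: abs_mult mult_left_le)
  finally show ?thesis by (simp add: J_integral)
qed

lemma continuous_Jhat: "continuous_on UNIV Jhat"
proof (rule continuous_on_sequentiallyI)
  fix s :: "nat \<Rightarrow> 'a" and a assume lim: "s \<longlonglongrightarrow> a"
  show "(\<lambda>n. Jhat (s n)) \<longlonglongrightarrow> Jhat a"
    unfolding Jhat_def
    by (rule integral_dominated_convergence[where w=J])
       (auto intro!: tendsto_intros lim J_integrable simp: abs_mult J_nonneg mult_left_le)
qed

text \<open>Fourier inversion after smoothing by a Gaussian: insert the Fourier representation of the heat
  kernel and exchange the integrals. The sine terms vanish since convolution powers are even.\<close>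
lemma regularized_inversion:
  assumes \<sigma>: "0 < \<sigma>"
  shows "(LINT y|lborel. cvpow J n (x - y) * heat_kernel 1 y \<sigma>)
    = (LINT \<xi>|lborel. exp (- (\<sigma> * (norm \<xi>)\<^sup>2)) * (Jhat \<xi> ^ Suc n * cos (x \<bullet> \<xi>))) / (2 * pi) ^ DIM('a)"
proof -
  let ?E = "\<lambda>\<xi>::'a. exp (- (\<sigma> * (norm \<xi>)\<^sup>2))"
  let ?P = "cvpow J n"
  let ?F = "\<lambda>y \<xi>. ?P y * (?E \<xi> * cos ((x - y) \<bullet> \<xi>))"
  have gi: "integrable lborel (\<lambda>\<xi>. ?E \<xi> * cos (z \<bullet> \<xi>))" for z :: 'a
    using gaussian_cos_integrable[OF \<sigma>] .
  have slice: "integrable lborel (\<lambda>\<xi>. ?F y \<xi>)" for y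
    using gi by (intro integrable_mult_right)
  have b: "(LINT \<xi>|lborel. norm (?F y \<xi>)) \<le> ?P y * (LINT \<xi>|lborel. ?E \<xi>)" for y
  proof -
    have "(LINT \<xi>|lborel. norm (?F y \<xi>)) \<le> (LINT \<xi>|lborel. ?P y * ?E \<xi>)"
      using cvpow_nonneg[of n y]
      by (intro integral_mono integrable_norm slice integrable_mult_right gaussian_integrable \<sigma>)
         (auto simp: abs_mult intro!: mult_left_mono mult_left_le)
    then show ?thesis by simp
  qed
  have "integrable lborel (\<lambda>y. LINT \<xi>|lborel. norm (?F y \<xi>))"
    by (rule Bochner_Integration.integrable_bound[where f="\<lambda>y. ?P y * (LINT \<xi>|lborel. ?E \<xi>)"])
       (use b in \<open>auto intro!: integrable_mult_left cvpow_integrable order_trans[OF _ abs_ge_self]\<close>)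
  then have I: "integrable (lborel \<Otimes>\<^sub>M lborel) (\<lambda>(y, \<xi>). ?F y \<xi>)"
    using slice by (intro lborel_pair.Fubini_integrable) auto
  have "(LINT y|lborel. ?P (x - y) * heat_kernel 1 y \<sigma>) = (LINT y|lborel. ?P y * heat_kernel 1 (x - y) \<sigma>)"
    using cv_commute[of ?P "\<lambda>y. heat_kernel 1 y \<sigma>" x] by (simp add: cv_def mult.commute)
  also have "\<dots> = (LINT y|lborel. LINT \<xi>|lborel. ?F y \<xi>) / (2 * pi) ^ DIM('a)"
    using \<sigma> by (simp add: heat_kernel_fourier)
  also have "(LINT y|lborel. LINT \<xi>|lborel. ?F y \<xi>) = (LINT \<xi>|lborel. LINT y|lborel. ?F y \<xi>)"
    by (rule lborel_pair.Fubini_integral[OF I, symmetric])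
  also have "\<dots> = (LINT \<xi>|lborel. ?E \<xi> * (Jhat \<xi> ^ Suc n * cos (x \<bullet> \<xi>)))"
  proof (intro Bochner_Integration.integral_cong refl)
    fix \<xi> :: 'a
    have ic: "integrable lborel (\<lambda>y. ?P y * cos (y \<bullet> \<xi>))" and is': "integrable lborel (\<lambda>y. ?P y * sin (y \<bullet> \<xi>))"
      using integrable_bounded_mult[OF cvpow_integrable[of n], of "\<lambda>y. cos (y \<bullet> \<xi>)" 1]
        integrable_bounded_mult[OF cvpow_integrable[of n], of "\<lambda>y. sin (y \<bullet> \<xi>)" 1] by (auto simp: mult.commute)
    have s0: "(LINT y|lborel. ?P y * sin (y \<bullet> \<xi>)) = 0"
      by (rule integral_odd_zero) (auto simp: cvpow_even)
    have "?F y \<xi> = ?E \<xi> * cos (x \<bullet> \<xi>) * (?P y * cos (y \<bullet> \<xi>)) + ?E \<xi> * sin (x \<bullet> \<xi>) * (?P y * sin (y \<bullet> \<xi>))" for y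
      by (simp add: inner_diff_left cos_diff algebra_simps)
    then have "(LINT y|lborel. ?F y \<xi>) = ?E \<xi> * cos (x \<bullet> \<xi>) * (LINT y|lborel. ?P y * cos (y \<bullet> \<xi>))
        + ?E \<xi> * sin (x \<bullet> \<xi>) * (LINT y|lborel. ?P y * sin (y \<bullet> \<xi>))"
      using ic is' by simp
    then show "(LINT y|lborel. ?F y \<xi>) = ?E \<xi> * (Jhat \<xi> ^ Suc n * cos (x \<bullet> \<xi>))"
      unfolding s0 cvpow_hat by simp
  qed
  finally show ?thesis .
qed

text \<open>Letting the smoothing tend to zero in \<open>regularized_inversion\<close>. At the origin and for \<open>n = 1\<close> the
  integrand is nonnegative, so monotone convergence proves that \<open>Jhat\<^sup>2\<close> is integrable; this makes the
  powers of order at least two integrable and justifies the inversion formula for them. The power of order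
  one is avoided since the transform of a merely continuous kernel need not be integrable.\<close>
lemma
  shows Jhat_square_integrable: "integrable lborel (\<lambda>\<xi>. (Jhat \<xi>)\<^sup>2)"
    and cvpow_fourier: "cvpow J (Suc n) x
      = (LINT \<xi>|lborel. Jhat \<xi> ^ Suc (Suc n) * cos (x \<bullet> \<xi>)) / (2 * pi) ^ DIM('a)"
proof -
  define s :: "nat \<Rightarrow> real" where "s k = 1 / real (Suc k)" for k
  have s0: "0 < s k" for k by (simp add: s_def)
  have slim: "s \<longlonglongrightarrow> 0" unfolding s_def using LIMSEQ_inverse_real_of_nat by (simp add: inverse_eq_divide)
  let ?E = "\<lambda>k \<xi>::'a. exp (- ((s k)\<^sup>2 * (norm \<xi>)\<^sup>2))"
  have Elim: "(\<lambda>k. ?E k \<xi>) \<longlonglongrightarrow> 1" for \<xi>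
  proof -
    have "(\<lambda>k. ?E k \<xi>) \<longlonglongrightarrow> exp (- (0\<^sup>2 * (norm \<xi>)\<^sup>2))" by (intro tendsto_intros slim)
    then show ?thesis by simp
  qed
  have lim: "(\<lambda>k. LINT \<xi>|lborel. ?E k \<xi> * (Jhat \<xi> ^ Suc m * cos (y \<bullet> \<xi>))) \<longlonglongrightarrow> cvpow J m y * (2 * pi) ^ DIM('a)" for m y
    using tendsto_mult_right[OF approximate_identity[OF cvpow_continuous cvpow_abs_le s0 slim, of m y], of "(2 * pi) ^ DIM('a)"]
    unfolding regularized_inversion[OF zero_less_power[OF s0]] by simp
  show sq: "integrable lborel (\<lambda>\<xi>. (Jhat \<xi>)\<^sup>2)"
  proof (rule integrable_monotone_convergence)
    have "(Jhat \<xi>)\<^sup>2 \<le> 1" for \<xi> using Jhat_abs_le by (simp add: abs_square_le_1)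
    then show "integrable lborel (\<lambda>\<xi>. ?E k \<xi> * (Jhat \<xi>)\<^sup>2)" for k
      using integrable_bounded_mult[OF gaussian_integrable[of "(s k)\<^sup>2", where 'a='a], of "\<lambda>\<xi>. (Jhat \<xi>)\<^sup>2" 1] s0[of k]
      by (simp add: mult.commute)
    have "s (Suc k) \<le> s k" for k by (simp add: s_def frac_le)
    then have "decseq s" by (rule decseq_SucI)
    then have "s j \<le> s i" if "i \<le> j" for i j using that by (simp add: decseqD)
    then have "(s j)\<^sup>2 \<le> (s i)\<^sup>2" if "i \<le> j" for i j
      using that s0[of j] by (intro power_mono) auto
    then have "?E i \<xi> \<le> ?E j \<xi>" if "i \<le> j" for i j \<xi>
      using that by (simp add: mult_right_mono)
    then have "mono (\<lambda>k. ?E k \<xi> * (Jhat \<xi>)\<^sup>2)" for \<xi>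
      by (intro monoI mult_right_mono) auto
    then show "AE \<xi> in lborel. mono (\<lambda>k. ?E k \<xi> * (Jhat \<xi>)\<^sup>2)" by simp
    show "AE \<xi> in lborel. (\<lambda>k. ?E k \<xi> * (Jhat \<xi>)\<^sup>2) \<longlonglongrightarrow> (Jhat \<xi>)\<^sup>2"
      using tendsto_mult_right[OF Elim] by auto
    show "(\<lambda>k. LINT \<xi>|lborel. ?E k \<xi> * (Jhat \<xi>)\<^sup>2) \<longlonglongrightarrow> cvpow J 1 0 * (2 * pi) ^ DIM('a)"
      using lim[of 1 0] by (simp add: power2_eq_square)
  qed simp
  have "(\<lambda>k. LINT \<xi>|lborel. ?E k \<xi> * (Jhat \<xi> ^ Suc (Suc n) * cos (x \<bullet> \<xi>)))
      \<longlonglongrightarrow> (LINT \<xi>|lborel. 1 * (Jhat \<xi> ^ Suc (Suc n) * cos (x \<bullet> \<xi>)))"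
  proof (rule integral_dominated_convergence[where w="\<lambda>\<xi>. (Jhat \<xi>)\<^sup>2"])
    show "AE \<xi> in lborel. norm (?E k \<xi> * (Jhat \<xi> ^ Suc (Suc n) * cos (x \<bullet> \<xi>))) \<le> (Jhat \<xi>)\<^sup>2" for k
    proof (rule AE_I2)
      fix \<xi> :: 'a
      have "norm (?E k \<xi> * (Jhat \<xi> ^ Suc (Suc n) * cos (x \<bullet> \<xi>))) = (Jhat \<xi>)\<^sup>2 * (?E k \<xi> * (\<bar>Jhat \<xi>\<bar> ^ n * \<bar>cos (x \<bullet> \<xi>)\<bar>))"
        by (simp add: abs_mult power_abs power2_eq_square)
      also have "\<dots> \<le> (Jhat \<xi>)\<^sup>2 * (1 * (1 * 1))"
        using Jhat_abs_le by (intro mult_left_mono mult_mono power_le_one) auto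
      finally show "norm (?E k \<xi> * (Jhat \<xi> ^ Suc (Suc n) * cos (x \<bullet> \<xi>))) \<le> (Jhat \<xi>)\<^sup>2" by simp
    qed
    show "AE \<xi> in lborel. (\<lambda>k. ?E k \<xi> * (Jhat \<xi> ^ Suc (Suc n) * cos (x \<bullet> \<xi>)))
      \<longlonglongrightarrow> 1 * (Jhat \<xi> ^ Suc (Suc n) * cos (x \<bullet> \<xi>))"
      using tendsto_mult_right[OF Elim] by blast
  qed (auto simp: sq)
  with lim[of "Suc n" x] have "cvpow J (Suc n) x * (2 * pi) ^ DIM('a) = (LINT \<xi>|lborel. Jhat \<xi> ^ Suc (Suc n) * cos (x \<bullet> \<xi>))"
    using LIMSEQ_unique by fastforce
  then show "cvpow J (Suc n) x
      = (LINT \<xi>|lborel. Jhat \<xi> ^ Suc (Suc n) * cos (x \<bullet> \<xi>)) / (2 * pi) ^ DIM('a)"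
    by (simp add: field_simps)
qed

text \<open>The second-order Taylor expansion of the cosine. In the remainder only two of the four factors
  \<open>x \<bullet> \<xi>\<close> are estimated by \<open>|\<xi>|\<close>; the other two produce the factor \<open>\<alpha>\<close>, so that the error is small
  relative to \<open>\<alpha> |\<xi>|\<^sup>2\<close> on the whole unit ball, however small \<open>\<alpha>\<close> is.\<close>
lemma Jhat_near_zero: "\<bar>Jhat \<xi> - (1 - \<alpha> * (norm \<xi>)\<^sup>2)\<bar> \<le> \<alpha> * (norm \<xi>) ^ 4 / 12"
proof -
  have eq: "Jhat \<xi> - (1 - \<alpha> * (norm \<xi>)\<^sup>2)
      = (LINT x|lborel. J x * (cos (x \<bullet> \<xi>) - (1 - (x \<bullet> \<xi>)\<^sup>2 / 2)))" (is "_ = (LINT x|lborel. ?g x)")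
  proof -
    have "?g x = J x * cos (x \<bullet> \<xi>) - J x + (x \<bullet> \<xi>)\<^sup>2 * J x / 2" for x by (simp add: algebra_simps)
    then have "(LINT x|lborel. ?g x) = Jhat \<xi> - 1 + (2 * \<alpha> * (norm \<xi>)\<^sup>2) / 2"
      using J_cos_integrable J_integrable J_moment by (simp add: Jhat_def J_integral J_isotropic)
    then show ?thesis by simp
  qed
  have gi: "integrable lborel ?g"
    using J_mult_integrable[of "\<lambda>x. cos (x \<bullet> \<xi>) - (1 - (x \<bullet> \<xi>)\<^sup>2 / 2)"] by (simp add: continuous_intros)
  have "\<bar>Jhat \<xi> - (1 - \<alpha> * (norm \<xi>)\<^sup>2)\<bar> \<le> (LINT x|lborel. \<bar>?g x\<bar>)"
    unfolding eq by (rule integral_abs_bound)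
  also have "\<dots> \<le> (LINT x|lborel. (norm \<xi>)\<^sup>2 / 24 * ((x \<bullet> \<xi>)\<^sup>2 * J x))"
  proof (rule integral_mono)
    show "integrable lborel (\<lambda>x. \<bar>?g x\<bar>)" using gi by (rule integrable_abs)
    show "integrable lborel (\<lambda>x. (norm \<xi>)\<^sup>2 / 24 * ((x \<bullet> \<xi>)\<^sup>2 * J x))" using J_moment by (rule integrable_mult_right)
    fix x
    show "\<bar>?g x\<bar> \<le> (norm \<xi>)\<^sup>2 / 24 * ((x \<bullet> \<xi>)\<^sup>2 * J x)"
    proof (cases "norm x \<le> 1")
      case True
      then have "\<bar>x \<bullet> \<xi>\<bar> \<le> 1 * norm \<xi>"
        by (intro order_trans[OF Cauchy_Schwarz_ineq2] mult_right_mono) auto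
      then have s: "(x \<bullet> \<xi>)\<^sup>2 \<le> (norm \<xi>)\<^sup>2" by (metis abs_le_square_iff abs_norm_cancel mult_1)
      have "\<bar>?g x\<bar> \<le> J x * ((x \<bullet> \<xi>) ^ 4 / 24)"
        unfolding abs_mult abs_of_nonneg[OF J_nonneg] by (rule mult_left_mono[OF cos_taylor J_nonneg])
      also have "(x \<bullet> \<xi>) ^ 4 = (x \<bullet> \<xi>)\<^sup>2 * (x \<bullet> \<xi>)\<^sup>2" by (simp add: power2_eq_square power4_eq_xxxx)
      also have "J x * ((x \<bullet> \<xi>)\<^sup>2 * (x \<bullet> \<xi>)\<^sup>2 / 24) \<le> J x * ((norm \<xi>)\<^sup>2 * (x \<bullet> \<xi>)\<^sup>2 / 24)"
        using s J_nonneg[of x] by (intro mult_left_mono divide_right_mono mult_right_mono) auto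
      finally show ?thesis by (simp add: mult_ac)
    qed (simp add: J_supp)
  qed
  also have "\<dots> = (norm \<xi>)\<^sup>2 / 24 * (2 * \<alpha> * (norm \<xi>)\<^sup>2)" by (simp only: integral_mult_right_zero J_isotropic)
  also have "\<dots> = \<alpha> * (norm \<xi>) ^ 4 / 12" by (simp add: power2_eq_square power4_eq_xxxx)
  finally show ?thesis .
qed

lemma alpha_le: "\<alpha> \<le> 1 / 2"
proof -
  obtain b :: 'a where b: "b \<in> Basis" using nonempty_Basis by blast
  have "(LINT x|lborel. (x \<bullet> b)\<^sup>2 * J x) \<le> (LINT x|lborel. J x)"
  proof (intro integral_mono J_moment J_integrable)
    fix x
    show "(x \<bullet> b)\<^sup>2 * J x \<le> J x"
    proof (cases "norm x \<le> 1")
      case True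
      then have "\<bar>x \<bullet> b\<bar> \<le> 1" using Cauchy_Schwarz_ineq2[of x b] b by simp
      then have "(x \<bullet> b)\<^sup>2 \<le> 1" by (simp add: abs_square_le_1)
      then show ?thesis using J_nonneg[of x] by (simp add: mult_left_le_one_le)
    qed (simp add: J_supp)
  qed
  then show ?thesis using b by (simp add: J_isotropic J_integral)
qed

lemma Jhat_small:
  assumes "norm \<xi> \<le> 1"
  shows "0 \<le> Jhat \<xi>" "Jhat \<xi> \<le> exp (- (\<alpha> * (norm \<xi>)\<^sup>2 / 2))"
proof -
  define s where "s = (norm \<xi>)\<^sup>2"
  have s: "0 \<le> s" "s \<le> 1" using assms by (auto simp: s_def abs_square_le_1)
  have q: "(norm \<xi>) ^ 4 = s\<^sup>2" by (simp add: s_def power2_eq_square power4_eq_xxxx)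
  have b: "\<alpha> * s\<^sup>2 / 12 \<le> \<alpha> * s / 12"
  proof -
    have "s\<^sup>2 \<le> s" using s by (simp add: power2_eq_square mult_left_le)
    then show ?thesis using alpha_pos by (simp add: mult_left_mono)
  qed
  have b': "\<alpha> * s \<le> 1 / 2 * 1"
    using alpha_pos alpha_le s by (intro mult_mono) auto
  have J: "\<bar>Jhat \<xi> - (1 - \<alpha> * s)\<bar> \<le> \<alpha> * s\<^sup>2 / 12" using Jhat_near_zero[of \<xi>] unfolding q s_def[symmetric] .
  show "0 \<le> Jhat \<xi>" using J b b' by linarith
  have "0 \<le> \<alpha> * s" using alpha_pos s by simp
  then have "Jhat \<xi> \<le> 1 + - (\<alpha> * s / 2)" using J b b' by linarith
  also have "\<dots> \<le> exp (- (\<alpha> * s / 2))" by (rule exp_ge_add_one_self)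
  finally show "Jhat \<xi> \<le> exp (- (\<alpha> * (norm \<xi>)\<^sup>2 / 2))" by (simp add: s_def)
qed

end

section \<open>The local limit theorem\<close>

context isotropic_kernel
begin

text \<open>Since \<open>J\<close> is positive near the origin, it charges points where \<open>cos (x \<bullet> \<xi>)\<close> is neither \<open>1\<close> nor \<open>-1\<close>.\<close>
lemma Jhat_less_one:
  assumes "\<xi> \<noteq> 0"
  shows "\<bar>Jhat \<xi>\<bar> < 1"
proof -
  have "isCont J 0" using J_cont by (simp add: continuous_on_eq_continuous_at)
  then obtain r where r: "r > 0" "\<And>x. dist x 0 < r \<Longrightarrow> dist (J x) (J 0) < J 0"
    unfolding continuous_at_eps_delta using J_0 by (metis dist_commute)
  define c where "c = min (r / (2 * norm \<xi>)) (1 / (norm \<xi>)\<^sup>2)"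
  have c: "0 < c" "c * norm \<xi> < r" "c * (norm \<xi>)\<^sup>2 \<le> 1"
  proof -
    show "0 < c" using assms r by (simp add: c_def)
    have "c * norm \<xi> \<le> r / (2 * norm \<xi>) * norm \<xi>" by (intro mult_right_mono) (auto simp: c_def)
    also have "\<dots> < r" using assms r by simp
    finally show "c * norm \<xi> < r" .
    have "c * (norm \<xi>)\<^sup>2 \<le> 1 / (norm \<xi>)\<^sup>2 * (norm \<xi>)\<^sup>2" by (intro mult_right_mono) (auto simp: c_def)
    then show "c * (norm \<xi>)\<^sup>2 \<le> 1" using assms by simp
  qed
  define a where "a = c *\<^sub>R \<xi>"
  have Ja: "0 < J a" using r(2)[of a] c by (auto simp: dist_norm a_def)
  have "cos (a \<bullet> \<xi>) < cos 0"
    using c assms pi_gt3 by (intro cos_monotone_0_pi) (auto simp: a_def power2_norm_eq_inner)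
  then have "0 < J a * (1 - cos (a \<bullet> \<xi>))" using Ja by simp
  then have "0 < (LINT x|lborel. J x * (1 - cos (x \<bullet> \<xi>)))"
    using J_mult_integrable[of "\<lambda>x. 1 - cos (x \<bullet> \<xi>)", OF continuous_on_diff[OF continuous_on_const continuous_on_cos[OF continuous_on_inner[OF continuous_on_id continuous_on_const]]]]
    by (intro integral_pos_continuous[where a=a]) (auto intro!: continuous_intros J_cont simp: J_nonneg)
  also have "\<dots> = 1 - Jhat \<xi>"
    using J_cos_integrable J_integrable by (simp add: right_diff_distrib Jhat_def J_integral)
  finally have 1: "Jhat \<xi> < 1" by simp
  have cp: "0 \<le> 1 + cos (x \<bullet> \<xi>)" for x using cos_ge_minus_one[of "x \<bullet> \<xi>"] by linarith
  have "0 < (LINT x|lborel. J x * (1 + cos (x \<bullet> \<xi>)))"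
    using J_mult_integrable[of "\<lambda>x. 1 + cos (x \<bullet> \<xi>)", OF continuous_on_add[OF continuous_on_const continuous_on_cos[OF continuous_on_inner[OF continuous_on_id continuous_on_const]]]] J_0
    by (intro integral_pos_continuous[where a=0]) (auto intro!: continuous_intros J_cont mult_nonneg_nonneg cp simp: J_nonneg)
  also have "\<dots> = 1 + Jhat \<xi>"
    using J_cos_integrable J_integrable by (simp add: distrib_left Jhat_def J_integral)
  finally show ?thesis using 1 by simp
qed

text \<open>The Riemann-Lebesgue lemma: a shift by \<open>h = \<pi> \<xi> / |\<xi>|\<^sup>2\<close> changes the sign of \<open>cos (x \<bullet> \<xi>)\<close>, so
  twice the transform is at most the \<open>L\<^sup>1\<close> distance of \<open>J\<close> from its translate, which vanishes as \<open>h\<close> does.\<close>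
lemma Jhat_riemann_lebesgue:
  obtains R where "0 < R" "\<And>\<xi>. R \<le> norm \<xi> \<Longrightarrow> \<bar>Jhat \<xi>\<bar> \<le> 1 / 2"
proof -
  define F where "F h = (LINT x|lborel. \<bar>J x - J (x - h)\<bar>)" for h
  have iJ: "integrable lborel (\<lambda>x. J (x - h))" for h using J_integrable integrable_shift[of J h] by simp
  have half: "2 * \<bar>Jhat \<xi>\<bar> \<le> F ((pi / (norm \<xi>)\<^sup>2) *\<^sub>R \<xi>)" if "\<xi> \<noteq> 0" for \<xi>
  proof -
    define h where "h = (pi / (norm \<xi>)\<^sup>2) *\<^sub>R \<xi>"
    have "h \<bullet> \<xi> = pi" using that by (simp add: h_def power2_norm_eq_inner)
    then have c: "cos ((x - h) \<bullet> \<xi>) = - cos (x \<bullet> \<xi>)" for x by (simp add: inner_diff_left cos_diff)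
    have "Jhat \<xi> = (LINT x|lborel. J (x - h) * cos ((x - h) \<bullet> \<xi>))"
      unfolding Jhat_def by (rule integral_shift[symmetric]) simp
    also have "\<dots> = - (LINT x|lborel. J (x - h) * cos (x \<bullet> \<xi>))" by (simp add: c)
    finally have s: "Jhat \<xi> = - (LINT x|lborel. J (x - h) * cos (x \<bullet> \<xi>))" .
    have i: "integrable lborel (\<lambda>x. J (x - h) * cos (x \<bullet> \<xi>))"
      using integrable_bounded_mult[OF iJ, of "\<lambda>x. cos (x \<bullet> \<xi>)" 1] by (simp add: mult.commute)
    have "2 * Jhat \<xi> = (LINT x|lborel. (J x - J (x - h)) * cos (x \<bullet> \<xi>))"
      using s i J_cos_integrable[of \<xi>] by (simp add: left_diff_distrib flip: Jhat_def)
    then have "2 * \<bar>Jhat \<xi>\<bar> = \<bar>LINT x|lborel. (J x - J (x - h)) * cos (x \<bullet> \<xi>)\<bar>" by (metis abs_mult abs_numeral)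
    also have "\<dots> \<le> (LINT x|lborel. \<bar>(J x - J (x - h)) * cos (x \<bullet> \<xi>)\<bar>)" by (rule integral_abs_bound)
    also have "\<dots> \<le> F h"
      unfolding F_def
    proof (intro integral_mono integrable_abs)
      show "integrable lborel (\<lambda>x. (J x - J (x - h)) * cos (x \<bullet> \<xi>))"
        using i J_cos_integrable[of \<xi>] by (simp add: left_diff_distrib)
      show "integrable lborel (\<lambda>x. J x - J (x - h))" using iJ J_integrable by simp
    qed (auto simp: abs_mult mult_left_le)
    finally show ?thesis by (simp add: h_def)
  qed
  have "isCont F 0"
  proof (rule continuous_at_sequentiallyI)
    fix s :: "nat \<Rightarrow> 'a" assume s: "s \<longlonglongrightarrow> 0"
    then have "eventually (\<lambda>n. norm (s n) < 1) sequentially"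
      using order_tendstoD(2)[OF tendsto_norm[OF s], of 1] by simp
    then obtain N where N: "\<And>n. N \<le> n \<Longrightarrow> norm (s n) < 1" by (auto simp: eventually_sequentially)
    have "(\<lambda>n. F (s (n + N))) \<longlonglongrightarrow> F 0"
      unfolding F_def
    proof (rule integral_dominated_convergence[where w="\<lambda>x. Jmax * indicator (cball 0 2) x"])
      show "AE x in lborel. (\<lambda>n. \<bar>J x - J (x - s (n + N))\<bar>) \<longlonglongrightarrow> \<bar>J x - J (x - 0)\<bar>"
      proof (intro AE_I2 tendsto_intros)
        fix x
        have "isCont J (x - 0)" using J_cont by (simp add: continuous_on_eq_continuous_at)
        then show "(\<lambda>n. J (x - s (n + N))) \<longlonglongrightarrow> J (x - 0)"
          by (rule isCont_tendsto_compose) (intro tendsto_intros LIMSEQ_ignore_initial_segment s)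
      qed
      show "integrable lborel (\<lambda>x. Jmax * indicator (cball 0 2) x)"
        by (intro integrable_mult_right integrable_real_indicator) (auto simp: emeasure_bounded_finite[OF bounded_cball, simplified])
      show "AE x in lborel. norm \<bar>J x - J (x - s (n + N))\<bar> \<le> Jmax * indicator (cball 0 2) x" for n
      proof (rule AE_I2)
        fix x
        show "norm \<bar>J x - J (x - s (n + N))\<bar> \<le> Jmax * indicator (cball 0 2) x"
        proof (cases "norm x \<le> 2")
          case True
          then show ?thesis
            using J_nonneg[of x] J_nonneg[of "x - s (n + N)"] J_le[of x] J_le[of "x - s (n + N)"] by auto
        next
          case False
          moreover have "norm x \<le> norm (x - s (n + N)) + norm (s (n + N))" by (metis diff_add_cancel norm_triangle_ineq)
          ultimately have "1 < norm x" "1 < norm (x - s (n + N))" using N[of "n + N"] by auto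
          then show ?thesis using False by (simp add: J_supp)
        qed
      qed
    qed auto
    then show "(\<lambda>n. F (s n)) \<longlonglongrightarrow> F 0" by (rule LIMSEQ_offset)
  qed
  moreover have "F 0 = 0" by (simp add: F_def)
  ultimately obtain d where d: "0 < d" "\<And>h. norm h < d \<Longrightarrow> F h < 1"
    unfolding continuous_at_eps_delta by (auto simp: dist_norm) (metis abs_less_iff zero_less_one)
  show thesis
  proof
    show "0 < pi / d + 1" using d by (simp add: add_pos_pos)
    fix \<xi> :: 'a assume \<xi>: "pi / d + 1 \<le> norm \<xi>"
    have "0 < pi / d" using d(1) by simp
    then have n: "pi / d < norm \<xi>" "0 < norm \<xi>" using \<xi> by linarith+
    then have "norm ((pi / (norm \<xi>)\<^sup>2) *\<^sub>R \<xi>) < d"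
      using d(1) by (simp add: power2_eq_square field_simps)
    then have "F ((pi / (norm \<xi>)\<^sup>2) *\<^sub>R \<xi>) < 1" by (rule d(2))
    then show "\<bar>Jhat \<xi>\<bar> \<le> 1 / 2" using half[of \<xi>] n by auto
  qed
qed

lemma Jhat_away_from_zero:
  obtains q where "0 < q" "q < 1" "\<And>\<xi>. 1 \<le> norm \<xi> \<Longrightarrow> \<bar>Jhat \<xi>\<bar> \<le> q"
proof -
  obtain R where R: "0 < R" "\<And>\<xi>. R \<le> norm \<xi> \<Longrightarrow> \<bar>Jhat \<xi>\<bar> \<le> 1 / 2" by (rule Jhat_riemann_lebesgue) blast
  define S where "S = cball (0::'a) (max 1 R) - ball 0 1"
  obtain b :: 'a where b: "b \<in> Basis" using nonempty_Basis by blast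
  have "b \<in> S" using b by (simp add: S_def)
  moreover have "compact S" unfolding S_def by (intro compact_diff) auto
  moreover have "continuous_on S (\<lambda>\<xi>. \<bar>Jhat \<xi>\<bar>)"
    by (intro continuous_intros continuous_on_subset[OF continuous_Jhat]) auto
  ultimately obtain m where m: "m \<in> S" "\<And>\<xi>. \<xi> \<in> S \<Longrightarrow> \<bar>Jhat \<xi>\<bar> \<le> \<bar>Jhat m\<bar>"
    using continuous_attains_sup[of S] by blast
  have "m \<noteq> 0" using m(1) by (auto simp: S_def)
  then have "\<bar>Jhat m\<bar> < 1" by (rule Jhat_less_one)
  show thesis
  proof
    show "0 < max (1/2) \<bar>Jhat m\<bar>" "max (1/2) \<bar>Jhat m\<bar> < 1" using \<open>\<bar>Jhat m\<bar> < 1\<close> by auto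
    fix \<xi> :: 'a assume "1 \<le> norm \<xi>"
    show "\<bar>Jhat \<xi>\<bar> \<le> max (1/2) \<bar>Jhat m\<bar>"
    proof (cases "R \<le> norm \<xi>")
      case False
      then have "\<xi> \<in> S" using \<open>1 \<le> norm \<xi>\<close> by (simp add: S_def)
      then show ?thesis using m(2) by (simp add: le_max_iff_disj)
    qed (use R in \<open>simp add: le_max_iff_disj\<close>)
  qed
qed

text \<open>Inside the unit ball both transforms are at most \<open>exp (-\<alpha>|\<xi>|\<^sup>2/2)\<close> and differ by \<open>O(|\<xi>|^4)\<close>; the \<open>m\<close>-th
  powers then differ by \<open>m |\<xi>|^4 exp (-\<alpha>(m-1)|\<xi>|\<^sup>2/2)\<close> up to a constant, and half of the exponent turns
  \<open>m |\<xi>|^4\<close> into \<open>1/m\<close>. Outside the unit ball both powers are exponentially small in \<open>m\<close>.\<close>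
lemma fourier_difference:
  obtains C q where "0 \<le> C" "0 < q" "q < 1"
    "\<And>n \<xi>. \<bar>Jhat \<xi> ^ Suc (Suc n) - exp (- (\<alpha> * real (Suc (Suc n)) * (norm \<xi>)\<^sup>2))\<bar>
      \<le> C / real (Suc (Suc n)) * exp (- (\<alpha> * real (Suc (Suc n)) / 4 * (norm \<xi>)\<^sup>2))
        + q ^ n * ((Jhat \<xi>)\<^sup>2 + exp (- (\<alpha> * (norm \<xi>)\<^sup>2)))"
proof -
  obtain q0 where q0: "0 < q0" "q0 < 1" "\<And>\<xi>. 1 \<le> norm \<xi> \<Longrightarrow> \<bar>Jhat \<xi>\<bar> \<le> q0"
    by (rule Jhat_away_from_zero) blast
  \<comment> \<open>\<open>q\<close> dominates both transforms outside the unit ball, \<open>K |\<xi>|^4\<close> bounds their difference inside it, and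
    \<open>C\<close> results from \<open>y\<^sup>2/2 \<le> exp y\<close> at \<open>y = \<alpha> m |\<xi>|\<^sup>2/4\<close>.\<close>
  define q where "q = max q0 (exp (- \<alpha>))"
  define K where "K = \<alpha> / 12 + \<alpha>\<^sup>2 / 2"
  define C where "C = 32 * K * exp (\<alpha> / 2) / \<alpha>\<^sup>2"
  show thesis
  proof
    show C0: "0 \<le> C" using alpha_pos by (simp add: C_def K_def)
    show q: "0 < q" "q < 1" using q0 alpha_pos by (auto simp: q_def)
    fix n and \<xi> :: 'a
    define m where "m = Suc (Suc n)"
    define s where "s = (norm \<xi>)\<^sup>2"
    have s0: "0 \<le> s" by (simp add: s_def)
    show "\<bar>Jhat \<xi> ^ Suc (Suc n) - exp (- (\<alpha> * real (Suc (Suc n)) * (norm \<xi>)\<^sup>2))\<bar>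
      \<le> C / real (Suc (Suc n)) * exp (- (\<alpha> * real (Suc (Suc n)) / 4 * (norm \<xi>)\<^sup>2))
        + q ^ n * ((Jhat \<xi>)\<^sup>2 + exp (- (\<alpha> * (norm \<xi>)\<^sup>2)))"
      unfolding m_def[symmetric] s_def[symmetric]
    proof (cases "norm \<xi> \<le> 1")
      case True
      let ?a = "Jhat \<xi>" and ?b = "exp (- (\<alpha> * s))" and ?r = "exp (- (\<alpha> * s / 2))"
      have s1: "s \<le> 1" using True by (simp add: s_def abs_square_le_1)
      have as0: "0 \<le> \<alpha> * s" using alpha_pos s0 by simp
      have bm: "exp (- (\<alpha> * real m * s)) = ?b ^ Suc (Suc n)"
        by (simp add: m_def exp_of_nat_mult[symmetric] mult_ac del: of_nat_Suc power_Suc)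
      have "\<bar>?b - (1 - \<alpha> * s)\<bar> \<le> (\<alpha> * s)\<^sup>2 / 2"
      proof -
        have "1 - \<alpha> * s \<le> ?b" using exp_ge_add_one_self[of "- (\<alpha> * s)"] by simp
        moreover have "?b \<le> 1 - \<alpha> * s + (\<alpha> * s)\<^sup>2 / 2"
          using exp_minus_le_quadratic[OF as0] .
        ultimately show ?thesis by simp
      qed
      moreover have "\<bar>?a - (1 - \<alpha> * s)\<bar> \<le> \<alpha> * s\<^sup>2 / 12"
        using Jhat_near_zero[of \<xi>] by (simp add: s_def)
      ultimately have "\<bar>?a - ?b\<bar> \<le> \<alpha> * s\<^sup>2 / 12 + (\<alpha> * s)\<^sup>2 / 2" by linarith
      also have "\<dots> = K * s\<^sup>2" by (simp add: K_def power_mult_distrib algebra_simps)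
      finally have ab: "\<bar>?a - ?b\<bar> \<le> K * s\<^sup>2" .
      have "\<bar>?a ^ Suc (Suc n) - ?b ^ Suc (Suc n)\<bar> \<le> real (Suc (Suc n)) * \<bar>?a - ?b\<bar> * ?r ^ Suc n"
        using Jhat_small[OF True] as0 by (intro abs_power_diff_le) (auto simp: s_def)
      moreover have "?r ^ Suc n = exp (\<alpha> * s / 2) * exp (- (\<alpha> * real m * s / 2))"
        by (simp add: m_def exp_of_nat_mult[symmetric] exp_add[symmetric] algebra_simps add_divide_distrib del: power_Suc)
      moreover have "exp (\<alpha> * s / 2) * exp (- (\<alpha> * real m * s / 2)) \<le> exp (\<alpha> / 2) * exp (- (\<alpha> * real m * s / 2))"
        using s1 alpha_pos by (intro mult_right_mono) (auto simp: mult_left_le)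
      ultimately have "\<bar>?a ^ m - ?b ^ m\<bar> \<le> real m * \<bar>?a - ?b\<bar> * ?r ^ Suc n"
          "?r ^ Suc n \<le> exp (\<alpha> / 2) * exp (- (\<alpha> * real m * s / 2))" unfolding m_def by simp_all
      moreover have "real m * \<bar>?a - ?b\<bar> * ?r ^ Suc n \<le> real m * (K * s\<^sup>2) * (exp (\<alpha> / 2) * exp (- (\<alpha> * real m * s / 2)))"
        using ab calculation(2) alpha_pos by (intro mult_mono) (auto simp: K_def)
      ultimately have 1: "\<bar>?a ^ m - ?b ^ m\<bar> \<le> real m * (K * s\<^sup>2) * (exp (\<alpha> / 2) * exp (- (\<alpha> * real m * s / 2)))"
        by linarith
      have "(\<alpha> * s * real m / 4)\<^sup>2 / 2 \<le> exp (\<alpha> * s * real m / 4)"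
      proof -
        have y0: "0 \<le> \<alpha> * s * real m / 4" using as0 by simp
        show ?thesis using exp_lower_Taylor_quadratic[OF y0] y0 by linarith
      qed
      then have "s\<^sup>2 \<le> 32 / (\<alpha> * real m)\<^sup>2 * exp (\<alpha> * s * real m / 4)"
      proof -
        assume *: "(\<alpha> * s * real m / 4)\<^sup>2 / 2 \<le> exp (\<alpha> * s * real m / 4)"
        have "0 < (\<alpha> * real m)\<^sup>2" using alpha_pos by (simp add: m_def)
        moreover have "(\<alpha> * s * real m / 4)\<^sup>2 / 2 = (\<alpha> * real m)\<^sup>2 * s\<^sup>2 / 32"
          by (simp add: power_mult_distrib power_divide)
        ultimately show ?thesis using * by (simp add: pos_le_divide_eq mult.commute)
      qed
      then have "real m * (K * s\<^sup>2) * (exp (\<alpha> / 2) * exp (- (\<alpha> * real m * s / 2)))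
        \<le> real m * (K * (32 / (\<alpha> * real m)\<^sup>2 * exp (\<alpha> * s * real m / 4))) * (exp (\<alpha> / 2) * exp (- (\<alpha> * real m * s / 2)))"
        using alpha_pos by (intro mult_right_mono mult_left_mono) (auto simp: K_def)
      also have "\<dots> = C / real m * (exp (\<alpha> * s * real m / 4) * exp (- (\<alpha> * real m * s / 2)))"
        using alpha_pos by (simp add: C_def m_def power2_eq_square field_simps del: of_nat_Suc)
      also have "exp (\<alpha> * s * real m / 4) * exp (- (\<alpha> * real m * s / 2)) = exp (- (\<alpha> * real m / 4 * s))"
        by (simp add: exp_add[symmetric] algebra_simps)
      finally have "\<bar>?a ^ m - ?b ^ m\<bar> \<le> C / real m * exp (- (\<alpha> * real m / 4 * s))" using 1 by simp
      moreover have "0 \<le> q ^ n * ((Jhat \<xi>)\<^sup>2 + exp (- (\<alpha> * s)))" using q by simp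
      ultimately show "\<bar>Jhat \<xi> ^ m - exp (- (\<alpha> * real m * s))\<bar>
         \<le> C / real m * exp (- (\<alpha> * real m / 4 * s)) + q ^ n * ((Jhat \<xi>)\<^sup>2 + exp (- (\<alpha> * s)))"
        unfolding bm by (simp only: m_def)
    next
      case False
      then have s1: "1 \<le> s" by (simp add: s_def)
      have "\<bar>Jhat \<xi> ^ m\<bar> = \<bar>Jhat \<xi>\<bar> ^ n * (Jhat \<xi>)\<^sup>2" by (simp add: m_def abs_mult power_abs power2_eq_square)
      also have "\<dots> \<le> q ^ n * (Jhat \<xi>)\<^sup>2"
        using q0(3)[of \<xi>] False by (intro mult_right_mono power_mono) (auto simp: q_def le_max_iff_disj)
      finally have 1: "\<bar>Jhat \<xi> ^ m\<bar> \<le> q ^ n * (Jhat \<xi>)\<^sup>2" .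
      have "exp (- (\<alpha> * real m * s)) = exp (- (\<alpha> * s)) ^ Suc n * exp (- (\<alpha> * s))"
        by (simp add: m_def exp_of_nat_mult[symmetric] exp_add[symmetric] algebra_simps del: power_Suc)
      also have "\<dots> \<le> q ^ n * exp (- (\<alpha> * s))"
      proof (intro mult_right_mono)
        have "exp (- (\<alpha> * s)) \<le> exp (- \<alpha>)" using s1 alpha_pos by simp
        then have "exp (- (\<alpha> * s)) \<le> q" unfolding q_def by (rule max.coboundedI2)
        then have "exp (- (\<alpha> * s)) ^ Suc n \<le> q ^ Suc n" by (intro power_mono) auto
        also have "\<dots> \<le> q ^ n" using q by (simp add: mult_left_le_one_le)
        finally show "exp (- (\<alpha> * s)) ^ Suc n \<le> q ^ n" .
      qed simp
      finally have 2: "exp (- (\<alpha> * real m * s)) \<le> q ^ n * exp (- (\<alpha> * s))" .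
      have "0 \<le> C / real m * exp (- (\<alpha> * real m / 4 * s))" using C0 by simp
      then show "\<bar>Jhat \<xi> ^ m - exp (- (\<alpha> * real m * s))\<bar>
         \<le> C / real m * exp (- (\<alpha> * real m / 4 * s)) + q ^ n * ((Jhat \<xi>)\<^sup>2 + exp (- (\<alpha> * s)))"
        using 1 2 exp_ge_zero[of "- (\<alpha> * real m * s)"] unfolding distrib_left by linarith
    qed
  qed
qed

text \<open>Integrating \<open>fourier_difference\<close> against the inversion formulas. The Gaussian integral contributes
  \<open>m^(-N/2)\<close> and the prefactor another \<open>1/m\<close>.\<close>
lemma local_limit_theorem:
  obtains C where "0 \<le> C"
    "\<And>n x. \<bar>cvpow J n x - heat_kernel \<alpha> x (real (Suc n))\<bar> \<le> C * real (Suc n) powr (- (real DIM('a) / 2) - 1)"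
proof -
  let ?d = "real DIM('a) / 2"
  obtain C q where Cq: "0 \<le> C" "0 < q" "q < 1"
    "\<And>n \<xi>. \<bar>Jhat \<xi> ^ Suc (Suc n) - exp (- (\<alpha> * real (Suc (Suc n)) * (norm \<xi>)\<^sup>2))\<bar>
      \<le> C / real (Suc (Suc n)) * exp (- (\<alpha> * real (Suc (Suc n)) / 4 * (norm \<xi>)\<^sup>2))
        + q ^ n * ((Jhat \<xi>)\<^sup>2 + exp (- (\<alpha> * (norm \<xi>)\<^sup>2)))"
    by (rule fourier_difference) blast
  define A where "A = (LINT \<xi>|lborel. (Jhat \<xi>)\<^sup>2 + exp (- (\<alpha> * (norm \<xi>)\<^sup>2)))"
  have iA: "integrable lborel (\<lambda>\<xi>. (Jhat \<xi>)\<^sup>2 + exp (- (\<alpha> * (norm \<xi>)\<^sup>2)))"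
    by (intro Bochner_Integration.integrable_add Jhat_square_integrable gaussian_integrable alpha_pos)
  have A0: "0 \<le> A" unfolding A_def by (intro Bochner_Integration.integral_nonneg) auto
  have d0: "0 < ?d + 1" by (simp add: add_pos_pos)
  have lnq: "0 < - ln q" using Cq by simp
  obtain D where D: "0 < D" "\<And>x. 0 < x \<Longrightarrow> x powr (?d + 1) * exp (- (- ln q) * x) \<le> D"
    by (rule powr_exp_bounded[OF d0 lnq]) blast
  define B where "B = C * (4 * pi / \<alpha>) powr ?d + D / q\<^sup>2 * A"
  have B0: "0 \<le> B" using Cq A0 D by (simp add: B_def)
  have large: "\<bar>cvpow J (Suc n) x - heat_kernel \<alpha> x (real (Suc (Suc n)))\<bar> \<le> B * real (Suc (Suc n)) powr (- ?d - 1)" for n x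
  proof -
    define m where "m = real (Suc (Suc n))"
    have m: "0 < m" "2 \<le> m" by (auto simp: m_def)
    let ?e = "\<lambda>\<xi>::'a. exp (- (\<alpha> * m * (norm \<xi>)\<^sup>2))"
    have am: "0 < \<alpha> * m" "0 < \<alpha> * m / 4" using alpha_pos m by auto
    have iJ: "integrable lborel (\<lambda>\<xi>. Jhat \<xi> ^ Suc (Suc n) * cos (x \<bullet> \<xi>))"
    proof (rule Bochner_Integration.integrable_bound[OF Jhat_square_integrable])
      show "AE \<xi> in lborel. norm (Jhat \<xi> ^ Suc (Suc n) * cos (x \<bullet> \<xi>)) \<le> norm ((Jhat \<xi>)\<^sup>2)"
      proof (rule AE_I2)
        fix \<xi> :: 'a
        have "norm (Jhat \<xi> ^ Suc (Suc n) * cos (x \<bullet> \<xi>)) = (Jhat \<xi>)\<^sup>2 * (\<bar>Jhat \<xi>\<bar> ^ n * \<bar>cos (x \<bullet> \<xi>)\<bar>)"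
          by (simp add: abs_mult power_abs power2_eq_square)
        also have "\<dots> \<le> (Jhat \<xi>)\<^sup>2 * (1 * 1)"
          using Jhat_abs_le by (intro mult_left_mono mult_mono power_le_one) auto
        finally show "norm (Jhat \<xi> ^ Suc (Suc n) * cos (x \<bullet> \<xi>)) \<le> norm ((Jhat \<xi>)\<^sup>2)" by simp
      qed
    qed simp
    have ig: "integrable lborel (\<lambda>\<xi>. ?e \<xi> * cos (x \<bullet> \<xi>))" using am by (intro gaussian_cos_integrable)
    let ?u = "\<lambda>\<xi>. C / m * exp (- (\<alpha> * m / 4 * (norm \<xi>)\<^sup>2)) + q ^ n * ((Jhat \<xi>)\<^sup>2 + exp (- (\<alpha> * (norm \<xi>)\<^sup>2)))"
    have P: "(2 * pi) ^ DIM('a) \<ge> 1" using pi_gt3 by (intro one_le_power) simp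
    have "cvpow J (Suc n) x - heat_kernel \<alpha> x m
      = (LINT \<xi>|lborel. Jhat \<xi> ^ Suc (Suc n) * cos (x \<bullet> \<xi>) - ?e \<xi> * cos (x \<bullet> \<xi>)) / (2 * pi) ^ DIM('a)"
      unfolding cvpow_fourier heat_kernel_fourier[OF alpha_pos m(1)]
      using iJ ig by (simp add: diff_divide_distrib)
    then have "\<bar>cvpow J (Suc n) x - heat_kernel \<alpha> x m\<bar>
      = \<bar>LINT \<xi>|lborel. Jhat \<xi> ^ Suc (Suc n) * cos (x \<bullet> \<xi>) - ?e \<xi> * cos (x \<bullet> \<xi>)\<bar> / (2 * pi) ^ DIM('a)"
      by (simp add: abs_divide)
    also have "\<dots> \<le> \<bar>LINT \<xi>|lborel. Jhat \<xi> ^ Suc (Suc n) * cos (x \<bullet> \<xi>) - ?e \<xi> * cos (x \<bullet> \<xi>)\<bar> / 1"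
      using P by (intro divide_left_mono) auto
    also have "\<dots> \<le> (LINT \<xi>|lborel. \<bar>Jhat \<xi> ^ Suc (Suc n) * cos (x \<bullet> \<xi>) - ?e \<xi> * cos (x \<bullet> \<xi>)\<bar>)"
      using integral_abs_bound by simp
    also have "\<dots> \<le> (LINT \<xi>|lborel. ?u \<xi>)"
    proof (rule integral_mono)
      show "integrable lborel (\<lambda>\<xi>. \<bar>Jhat \<xi> ^ Suc (Suc n) * cos (x \<bullet> \<xi>) - ?e \<xi> * cos (x \<bullet> \<xi>)\<bar>)"
        using iJ ig by (intro integrable_abs Bochner_Integration.integrable_diff)
      show "integrable lborel ?u"
        using am by (intro Bochner_Integration.integrable_add integrable_mult_right gaussian_integrable iA)
      fix \<xi> :: 'a
      have "\<bar>Jhat \<xi> ^ Suc (Suc n) * cos (x \<bullet> \<xi>) - ?e \<xi> * cos (x \<bullet> \<xi>)\<bar> = \<bar>Jhat \<xi> ^ Suc (Suc n) - ?e \<xi>\<bar> * \<bar>cos (x \<bullet> \<xi>)\<bar>"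
        by (simp only: left_diff_distrib[symmetric] abs_mult)
      also have "\<dots> \<le> \<bar>Jhat \<xi> ^ Suc (Suc n) - ?e \<xi>\<bar> * 1" by (intro mult_left_mono) auto
      also have "\<dots> \<le> ?u \<xi>" using Cq(4)[where n=n and \<xi>=\<xi>] by (simp only: m_def mult_1_right)
      finally show "\<bar>Jhat \<xi> ^ Suc (Suc n) * cos (x \<bullet> \<xi>) - ?e \<xi> * cos (x \<bullet> \<xi>)\<bar> \<le> ?u \<xi>" .
    qed
    also have "\<dots> = C / m * (LINT \<xi>::'a|lborel. exp (- (\<alpha> * m / 4 * (norm \<xi>)\<^sup>2))) + q ^ n * A"
      unfolding A_def using gaussian_integrable[OF am(2), where 'a='a] iA by simp
    also have "(LINT \<xi>::'a|lborel. exp (- (\<alpha> * m / 4 * (norm \<xi>)\<^sup>2))) = (4 * pi / \<alpha>) powr ?d * m powr (- ?d)"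
    proof -
      have "pi / (\<alpha> * m / 4) = (4 * pi / \<alpha>) * inverse m" using alpha_pos m by (simp add: field_simps)
      then show ?thesis
        unfolding gaussian_integral[OF am(2)] by (simp only: powr_mult powr_minus inverse_powr)
    qed
    also have "q ^ n \<le> D / q\<^sup>2 * m powr (- ?d - 1)"
    proof -
      have "exp (- (- ln q) * m) = q ^ Suc (Suc n)"
        using Cq(2) by (simp only: m_def exp_of_nat2_mult minus_minus exp_ln)
      then have "m powr (?d + 1) * (q ^ n * q\<^sup>2) \<le> D" using D(2)[OF m(1)] by (simp add: power2_eq_square mult_ac)
      then have "q ^ n \<le> D / q\<^sup>2 * inverse (m powr (?d + 1))"
        using m Cq(2) by (simp add: field_simps)
      moreover have "inverse (m powr (?d + 1)) = m powr (- ?d - 1)"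
        unfolding powr_minus[symmetric] by simp
      ultimately show ?thesis by simp
    qed
    also have "C / m * ((4 * pi / \<alpha>) powr ?d * m powr (- ?d)) = C * (4 * pi / \<alpha>) powr ?d * m powr (- ?d - 1)"
      using m by (simp add: powr_diff)
    finally have "\<bar>cvpow J (Suc n) x - heat_kernel \<alpha> x m\<bar>
        \<le> C * (4 * pi / \<alpha>) powr ?d * m powr (- ?d - 1) + D / q\<^sup>2 * m powr (- ?d - 1) * A"
      using A0 by (simp add: mult_right_mono)
    then show ?thesis unfolding B_def m_def[symmetric] by (simp only: distrib_right distrib_left mult_ac)
  qed
  \<comment> \<open>The inversion formula starts at the second power; the first one is covered by crude bounds.\<close>
  define B' where "B' = B + Jmax + (4 * pi * \<alpha>) powr (- ?d)"
  show thesis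
  proof
    show "0 \<le> B'" using B0 Jmax_pos by (simp add: B'_def)
    fix n and x :: 'a
    show "\<bar>cvpow J n x - heat_kernel \<alpha> x (real (Suc n))\<bar> \<le> B' * real (Suc n) powr (- ?d - 1)"
    proof (cases n)
      case 0
      have "heat_kernel \<alpha> x 1 \<le> (4 * pi * \<alpha>) powr (- ?d) * 1"
        unfolding heat_kernel_def using alpha_pos by (intro mult_mono) auto
      then show ?thesis
        using 0 J_le[of x] J_nonneg[of x] heat_kernel_nonneg[of \<alpha> x 1] B0 by (simp add: B'_def)
    next
      case (Suc k)
      have "B * real (Suc n) powr (- ?d - 1) \<le> B' * real (Suc n) powr (- ?d - 1)"
        using Jmax_pos by (intro mult_right_mono) (auto simp: B'_def)
      with large[of k x] show ?thesis unfolding Suc by (rule order_trans)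
    qed
  qed
qed

lemma heat_kernel_alpha_le:
  fixes x :: 'a
  assumes "0 < t"
  shows "heat_kernel \<alpha> x t \<le> (4 * pi * \<alpha>) powr (- (real DIM('a) / 2)) * t powr (- (real DIM('a) / 2))"
proof -
  have "heat_kernel \<alpha> x t \<le> (4 * pi * \<alpha> * t) powr (- (real DIM('a) / 2)) * 1"
    unfolding heat_kernel_def using alpha_pos assms by (intro mult_left_mono) auto
  then show ?thesis by (simp add: powr_mult)
qed

lemma cvpow_sup_decay:
  obtains C where "0 < C" "\<And>n x. cvpow J n x \<le> C * real (Suc n) powr (- (real DIM('a) / 2))"
proof -
  let ?d = "real DIM('a) / 2"
  obtain C where C: "0 \<le> C"
    "\<And>n x. \<bar>cvpow J n x - heat_kernel \<alpha> x (real (Suc n))\<bar> \<le> C * real (Suc n) powr (- ?d - 1)"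
    by (rule local_limit_theorem) blast
  let ?g = "(4 * pi * \<alpha>) powr (- ?d)"
  show thesis
  proof
    show "0 < C + ?g" using C alpha_pos by (simp add: add_nonneg_pos)
    fix n and x :: 'a
    have "cvpow J n x \<le> heat_kernel \<alpha> x (real (Suc n)) + C * real (Suc n) powr (- ?d - 1)"
      using C(2)[of n x] by linarith
    also have "\<dots> \<le> ?g * real (Suc n) powr (- ?d) + C * real (Suc n) powr (- ?d)"
      using C(1) heat_kernel_alpha_le[of "real (Suc n)" x]
      by (intro add_mono mult_left_mono powr_mono) auto
    finally show "cvpow J n x \<le> (C + ?g) * real (Suc n) powr (- ?d)" by (simp add: distrib_right)
  qed
qed

end

section \<open>Decay away from the origin\<close>

lemma exp_plus_exp_minus_le:
  fixes s :: real
  assumes "\<bar>s\<bar> \<le> 1"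
  shows "exp s + exp (- s) \<le> 2 + 2 * s\<^sup>2"
proof -
  have "exp \<bar>s\<bar> \<le> 1 + \<bar>s\<bar> + s\<^sup>2" using exp_bound[of "\<bar>s\<bar>"] assms by simp
  moreover have "exp (- \<bar>s\<bar>) \<le> 1 - \<bar>s\<bar> + s\<^sup>2 / 2" using exp_minus_le_quadratic[of "\<bar>s\<bar>"] by simp
  ultimately have "exp \<bar>s\<bar> + exp (- \<bar>s\<bar>) \<le> 2 + s\<^sup>2 + s\<^sup>2 / 2" by linarith
  moreover have "0 \<le> s\<^sup>2" by simp
  moreover have "exp \<bar>s\<bar> + exp (- \<bar>s\<bar>) = exp s + exp (- s)" by (simp add: abs_if)
  ultimately show ?thesis by linarith
qed

text \<open>The derivative \<open>-2z exp (-z\<^sup>2)\<close> is bounded by \<open>1\<close> since \<open>2|z| \<le> 1 + z\<^sup>2 \<le> exp (z\<^sup>2)\<close>.\<close>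
lemma exp_minus_square_lipschitz:
  fixes a b :: real
  shows "\<bar>exp (- (a\<^sup>2)) - exp (- (b\<^sup>2))\<bar> \<le> \<bar>a - b\<bar>"
proof -
  have "norm (exp (- (a\<^sup>2)) - exp (- (b\<^sup>2))) \<le> 1 * norm (a - b)"
  proof (rule field_differentiable_bound[where S=UNIV and f'="\<lambda>x. - 2 * x * exp (- (x\<^sup>2))"])
    show "((\<lambda>x. exp (- (x\<^sup>2))) has_field_derivative - 2 * z * exp (- (z\<^sup>2))) (at z within UNIV)" for z :: real
      by (auto intro!: derivative_eq_intros)
    fix z :: real
    have "2 * \<bar>z\<bar> \<le> 1 + z\<^sup>2" using zero_le_power2[of "\<bar>z\<bar> - 1"] by (simp add: power2_diff)
    also have "\<dots> \<le> exp (z\<^sup>2)" by (rule exp_ge_add_one_self)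
    finally show "norm (- 2 * z * exp (- (z\<^sup>2))) \<le> 1" by (simp add: abs_mult exp_minus field_simps)
  qed auto
  then show ?thesis by simp
qed

context isotropic_kernel
begin

lemma cvpow_supp: "real (Suc n) < norm x \<Longrightarrow> cvpow J n x = 0"
proof (induction n arbitrary: x)
  case 0
  then show ?case by (simp add: J_supp)
next
  case (Suc n)
  have "J (x - y) * cvpow J n y = 0" for y
  proof (cases "real (Suc n) < norm y")
    case False
    have "norm x \<le> norm (x - y) + norm y" by (metis diff_add_cancel norm_triangle_ineq)
    then have "1 < norm (x - y)" using False Suc.prems by simp
    then show ?thesis by (simp add: J_supp)
  qed (simp add: Suc.IH)
  then have "(\<lambda>y. J (x - y) * cvpow J n y) = (\<lambda>_. 0)" by (rule ext)
  then show ?case by (simp only: cvpow.simps cv_def) simp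
qed

text \<open>Evenness replaces the exponential by a hyperbolic cosine, which has no linear term.\<close>
lemma tilted_mass_le:
  assumes e: "norm e = 1" and l: "0 \<le> l" "l \<le> 1"
  shows "(LINT x|lborel. J x * exp (l * (x \<bullet> e))) \<le> exp (l\<^sup>2)"
proof -
  have i: "integrable lborel (\<lambda>x. J x * exp (c * (x \<bullet> e)))" for c
    using J_mult_integrable[of "\<lambda>x. exp (c * (x \<bullet> e))"] by (simp add: continuous_intros)
  have "(LINT x|lborel. J x * exp (l * (x \<bullet> e))) = (LINT x|lborel. J (0 - x) * exp (l * ((0 - x) \<bullet> e)))"
    by (rule integral_reflect_shift[symmetric]) simp
  also have "\<dots> = (LINT x|lborel. J x * exp (- l * (x \<bullet> e)))" by (simp add: J_even)
  finally have "2 * (LINT x|lborel. J x * exp (l * (x \<bullet> e)))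
    = (LINT x|lborel. J x * exp (l * (x \<bullet> e)) + J x * exp (- l * (x \<bullet> e)))"
    using i[of l] i[of "- l"] by simp
  also have "\<dots> \<le> (LINT x|lborel. J x * (2 + 2 * l\<^sup>2))"
  proof (rule integral_mono)
    show "integrable lborel (\<lambda>x. J x * exp (l * (x \<bullet> e)) + J x * exp (- l * (x \<bullet> e)))"
      by (rule Bochner_Integration.integrable_add[OF i i])
    show "integrable lborel (\<lambda>x. J x * (2 + 2 * l\<^sup>2))" using J_integrable by (rule integrable_mult_left)
    fix x
    show "J x * exp (l * (x \<bullet> e)) + J x * exp (- l * (x \<bullet> e)) \<le> J x * (2 + 2 * l\<^sup>2)"
    proof (cases "norm x \<le> 1")
      case True
      define s where "s = l * (x \<bullet> e)"
      have "\<bar>x \<bullet> e\<bar> \<le> 1" using Cauchy_Schwarz_ineq2[of x e] e True by simp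
      then have sl: "\<bar>s\<bar> \<le> l" using l by (simp add: s_def abs_mult mult_left_le)
      then have "s\<^sup>2 \<le> l\<^sup>2" using l by (metis abs_of_nonneg abs_le_square_iff)
      moreover have "exp s + exp (- s) \<le> 2 + 2 * s\<^sup>2" using sl l by (intro exp_plus_exp_minus_le) simp
      ultimately have "exp s + exp (- s) \<le> 2 + 2 * l\<^sup>2" by linarith
      then have "J x * (exp s + exp (- s)) \<le> J x * (2 + 2 * l\<^sup>2)" using J_nonneg by (rule mult_left_mono)
      then show ?thesis by (simp add: s_def distrib_left)
    qed (simp add: J_supp)
  qed
  also have "\<dots> = 2 * (1 + l\<^sup>2)" by (simp add: J_integral)
  also have "\<dots> \<le> 2 * exp (l\<^sup>2)" by (intro mult_left_mono exp_ge_add_one_self) simp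
  finally show ?thesis by simp
qed

text \<open>To reach \<open>z\<close> as a sum of two independent pieces, one of the pieces must cover at least half of the
  distance in the direction \<open>e\<close>. That piece pays the price \<open>exp (-h)\<close> of the exponential Chebyshev inequality, while the
  density of the other one is estimated by its supremum.\<close>
lemma cvpow_tilted_split:
  assumes e: "norm e = 1" and l: "0 \<le> l" "l \<le> 1" and h: "2 * h = l * (z \<bullet> e)"
    and a: "\<And>y. cvpow J a y \<le> A" and b: "\<And>y. cvpow J b y \<le> B"
  shows "cvpow J (Suc (a + b)) z \<le> (A * exp (l\<^sup>2) ^ Suc b + B * exp (l\<^sup>2) ^ Suc a) * exp (- h)"
proof -
  let ?c = "\<lambda>y. exp (l * (y \<bullet> e))"
  have mult: "?c (x + y) = ?c x * ?c y" for x y by (simp add: inner_add_left distrib_left exp_add)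
  have cont: "continuous_on UNIV ?c" by (intro continuous_intros)
  have int: "integrable lborel (\<lambda>y. cvpow J n y * ?c y)"
    and val: "(LINT y|lborel. cvpow J n y * ?c y) = (LINT y|lborel. J y * ?c y) ^ Suc n" for n
    using cvpow_character[OF mult cont, of n] by auto
  have le: "(LINT y|lborel. cvpow J n y * ?c y) \<le> exp (l\<^sup>2) ^ Suc n" for n
    unfolding val using tilted_mass_le[OF e l] J_nonneg
    by (intro power_mono) (auto intro!: Bochner_Integration.integral_nonneg)
  have AB: "0 \<le> A" "0 \<le> B" using a[of 0] b[of 0] cvpow_nonneg order_trans by blast+
  have intz: "integrable lborel (\<lambda>y. cvpow J a (z - y) * ?c (z - y))"
    using int[of a] by (subst integrable_reflect_shift) auto
  have "cvpow J (Suc (a + b)) z = (LINT y|lborel. cvpow J a (z - y) * cvpow J b y)"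
    unfolding cvpow_split cv_def ..
  also have "\<dots> \<le> (LINT y|lborel. A * exp (- h) * (cvpow J b y * ?c y) + B * exp (- h) * (cvpow J a (z - y) * ?c (z - y)))"
  proof (rule integral_mono)
    show "integrable lborel (\<lambda>y. cvpow J a (z - y) * cvpow J b y)"
      using cvpow_measurable cvpow_abs_le cvpow_integrable by (rule integrable_cv_slice)
    show "integrable lborel (\<lambda>y. A * exp (- h) * (cvpow J b y * ?c y) + B * exp (- h) * (cvpow J a (z - y) * ?c (z - y)))"
      using int intz by (intro Bochner_Integration.integrable_add integrable_mult_right)
    fix y
    let ?u = "cvpow J a (z - y)" and ?v = "cvpow J b y"
    have uv: "0 \<le> ?u" "0 \<le> ?v" by (auto simp: cvpow_nonneg)
    have sum: "l * (y \<bullet> e) - h + (l * ((z - y) \<bullet> e) - h) = 0" using h by (simp add: inner_diff_left algebra_simps)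
    have shift: "exp (l * (w \<bullet> e) - h) = exp (- h) * ?c w" for w by (simp add: exp_diff exp_minus field_simps)
    have one: "1 \<le> exp (- h) * ?c y + exp (- h) * ?c (z - y)"
    proof (cases "0 \<le> l * (y \<bullet> e) - h")
      case True
      then have "1 \<le> exp (l * (y \<bullet> e) - h)" by simp
      moreover have "0 \<le> exp (- h) * ?c (z - y)" by simp
      ultimately show ?thesis unfolding shift by linarith
    next
      case False
      then have "1 \<le> exp (l * ((z - y) \<bullet> e) - h)" using sum by simp
      moreover have "0 \<le> exp (- h) * ?c y" by simp
      ultimately show ?thesis unfolding shift by linarith
    qed
    have "?u * ?v * 1 \<le> ?u * ?v * (exp (- h) * ?c y + exp (- h) * ?c (z - y))"
      using one uv by (intro mult_left_mono) auto
    also have "\<dots> = ?u * (exp (- h) * (?v * ?c y)) + ?v * (exp (- h) * (?u * ?c (z - y)))" by (simp add: algebra_simps)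
    also have "\<dots> \<le> A * (exp (- h) * (?v * ?c y)) + B * (exp (- h) * (?u * ?c (z - y)))"
      using uv a b by (intro add_mono mult_right_mono) auto
    finally show "?u * ?v \<le> A * exp (- h) * (?v * ?c y) + B * exp (- h) * (?u * ?c (z - y))" by (simp add: mult_ac)
  qed
  also have "\<dots> = A * exp (- h) * (LINT y|lborel. cvpow J b y * ?c y)
      + B * exp (- h) * (LINT y|lborel. cvpow J a (z - y) * ?c (z - y))"
    using int intz by simp
  also have "(LINT y|lborel. cvpow J a (z - y) * ?c (z - y)) = (LINT y|lborel. cvpow J a y * ?c y)"
    by (rule integral_reflect_shift) simp
  also have "A * exp (- h) * (LINT y|lborel. cvpow J b y * ?c y) + B * exp (- h) * (LINT y|lborel. cvpow J a y * ?c y)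
    \<le> A * exp (- h) * exp (l\<^sup>2) ^ Suc b + B * exp (- h) * exp (l\<^sup>2) ^ Suc a"
    using le AB by (intro add_mono mult_left_mono) auto
  finally show ?thesis by (simp add: algebra_simps)
qed

text \<open>With halves of comparable length, \<open>cvpow_sup_decay\<close> and an optimal tilt give the Gaussian bound
  \<open>C p^(-N/2) exp (-|z|\<^sup>2/(16 p))\<close> for the power of order \<open>p\<close>. Its supremum over \<open>p\<close> is of order \<open>|z|^(-N)\<close>.\<close>
lemma cvpow_off_diagonal:
  obtains C where "0 < C" "\<And>n z. cvpow J n z * ((norm z)\<^sup>2) powr (real DIM('a) / 2) \<le> C"
proof -
  let ?d = "real DIM('a) / 2"
  obtain C where C: "0 < C" "\<And>n x. cvpow J n x \<le> C * real (Suc n) powr (- ?d)"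
    by (rule cvpow_sup_decay) blast
  have d0: "0 < ?d" by simp
  obtain D where D: "0 < D" "\<And>x. 0 < x \<Longrightarrow> x powr ?d * exp (- (1/16) * x) \<le> D"
    by (rule powr_exp_bounded[OF d0, of "1/16"]) auto
  define E where "E = Jmax + 2 * C * 3 powr ?d * D"
  show thesis
  proof
    show "0 < E" using Jmax_pos C D by (simp add: E_def add_pos_pos)
    fix n and z :: 'a
    have E: "Jmax \<le> E" "2 * C * 3 powr ?d * D \<le> E" using Jmax_pos C D by (auto simp: E_def)
    consider "z = 0 \<or> real (Suc n) < norm z" | "n = 0" "norm z \<le> 1" | "0 < n" "z \<noteq> 0" "norm z \<le> real (Suc n)"
      by force
    then show "cvpow J n z * ((norm z)\<^sup>2) powr ?d \<le> E"
    proof cases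
      case 1
      then show ?thesis using cvpow_supp[of n z] \<open>0 < E\<close> by auto
    next
      case 2
      then have "((norm z)\<^sup>2) powr ?d \<le> 1" by (intro powr_le1) (auto simp: abs_square_le_1)
      then have "J z * ((norm z)\<^sup>2) powr ?d \<le> Jmax * 1" using J_le J_nonneg Jmax_pos by (intro mult_mono) auto
      then show ?thesis using 2 E by simp
    next
      case 3
      define a where "a = (n - 1) div 2"
      define b where "b = n - 1 - a"
      define p where "p = real (Suc n)"
      have n: "n = Suc (a + b)" using 3 by (simp add: a_def b_def)
      have p: "0 < p" by (simp add: p_def)
      have ab: "p / 3 \<le> real (Suc a)" "p / 3 \<le> real (Suc b)" "real (Suc a) \<le> p" "real (Suc b) \<le> p"
      proof -
        have "Suc n \<le> 3 * Suc a" "Suc n \<le> 3 * Suc b" "Suc a \<le> Suc n" "Suc b \<le> Suc n"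
        proof -
          define r where "r = (n - 1) mod 2"
          have "n - 1 = 2 * a + r" "r < 2" by (simp_all add: a_def r_def)
          then show "Suc n \<le> 3 * Suc a" "Suc n \<le> 3 * Suc b" "Suc a \<le> Suc n" "Suc b \<le> Suc n"
            using 3(1) n by auto
        qed
        then have "real (Suc n) \<le> real (3 * Suc a)" "real (Suc n) \<le> real (3 * Suc b)"
          "real (Suc a) \<le> real (Suc n)" "real (Suc b) \<le> real (Suc n)" by (simp_all only: of_nat_le_iff)
        then show "p / 3 \<le> real (Suc a)" "p / 3 \<le> real (Suc b)" "real (Suc a) \<le> p" "real (Suc b) \<le> p"
          unfolding p_def by simp_all
      qed
      define e where "e = z /\<^sub>R norm z"
      \<comment> \<open>This tilt minimizes \<open>l\<^sup>2 p - l |z|/2\<close>. It is admissible, i.e. at most \<open>1\<close>, because \<open>|z| \<le> p\<close>.\<close>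
      define l where "l = norm z / (4 * p)"
      have e: "norm e = 1" "z \<bullet> e = norm z" using 3 by (auto simp: e_def power2_norm_eq_inner[symmetric] power2_eq_square)
      have l: "0 \<le> l" "l \<le> 1" using 3 p by (auto simp: l_def p_def)
      have dec: "C * real (Suc k) powr (- ?d) \<le> C * (p / 3) powr (- ?d)" if "p / 3 \<le> real (Suc k)" for k
        using that p C by (intro mult_left_mono powr_mono2') auto
      let ?A = "C * (p / 3) powr (- ?d)"
      have "cvpow J n z \<le> (?A * exp (l\<^sup>2) ^ Suc b + ?A * exp (l\<^sup>2) ^ Suc a) * exp (- (l * norm z / 2))"
        unfolding n
        by (rule cvpow_tilted_split[OF e(1) l]) (use C(2) dec ab e in \<open>auto intro: order_trans simp del: of_nat_Suc\<close>)
      also have "\<dots> \<le> (?A * exp (l\<^sup>2 * p) + ?A * exp (l\<^sup>2 * p)) * exp (- (l * norm z / 2))"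
      proof (intro mult_right_mono add_mono mult_left_mono)
        have "exp (l\<^sup>2) ^ k = exp (l\<^sup>2 * real k)" for k by (rule exp_of_nat2_mult[symmetric])
        then show "exp (l\<^sup>2) ^ Suc b \<le> exp (l\<^sup>2 * p)" "exp (l\<^sup>2) ^ Suc a \<le> exp (l\<^sup>2 * p)"
          using ab by (simp_all add: mult_left_mono del: of_nat_Suc power_Suc)
      qed (use C in auto)
      also have "\<dots> = 2 * ?A * exp (l\<^sup>2 * p - l * norm z / 2)"
      proof -
        have "exp (l\<^sup>2 * p) * exp (- (l * norm z / 2)) = exp (l\<^sup>2 * p - l * norm z / 2)"
          by (simp only: exp_add[symmetric] diff_conv_add_uminus)
        then show ?thesis by (simp only: distrib_right mult.assoc)
      qed
      also have "l\<^sup>2 * p - l * norm z / 2 = - (1/16) * ((norm z)\<^sup>2 / p)"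
        using p by (simp add: l_def power2_eq_square field_simps)
      also have "(p / 3) powr (- ?d) = 3 powr ?d * p powr (- ?d)"
        by (simp add: powr_divide powr_minus field_simps)
      finally have "cvpow J n z \<le> 2 * (C * (3 powr ?d * p powr (- ?d))) * exp (- (1/16) * ((norm z)\<^sup>2 / p))" .
      then have "cvpow J n z * ((norm z)\<^sup>2) powr ?d
        \<le> 2 * (C * (3 powr ?d * p powr (- ?d))) * exp (- (1/16) * ((norm z)\<^sup>2 / p)) * ((norm z)\<^sup>2) powr ?d"
        by (rule mult_right_mono) simp
      also have "\<dots> = 2 * C * 3 powr ?d * (((norm z)\<^sup>2 / p) powr ?d * exp (- (1/16) * ((norm z)\<^sup>2 / p)))"
        by (simp add: powr_divide powr_minus field_simps)
      also have "\<dots> \<le> 2 * C * 3 powr ?d * D" using D(2)[of "(norm z)\<^sup>2 / p"] C p 3 by (intro mult_left_mono) auto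
      finally show ?thesis using E by simp
    qed
  qed
qed

section \<open>The Gaussian profile and the free evolution\<close>

text \<open>The heat kernel multiplied by \<open>t^(N/2)\<close>; unlike the heat kernel it is bounded and varies slowly
  in \<open>t\<close>.\<close>
definition profile :: "'a \<Rightarrow> real \<Rightarrow> real" where
  "profile x t = (4 * pi * \<alpha>) powr (- (real DIM('a) / 2)) * exp (- ((norm x)\<^sup>2 / (4 * \<alpha> * t)))"

text \<open>The maximum of the profile, attained at the origin.\<close>
definition gamma :: real where "gamma = (4 * pi * \<alpha>) powr (- (real DIM('a) / 2))"

lemma gamma_pos: "0 < gamma" using alpha_pos by (simp add: gamma_def)

lemma profile_heat_kernel:
  assumes "0 < t"
  shows "t powr (real DIM('a) / 2) * heat_kernel \<alpha> x t = profile x t"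
proof -
  have "t powr (real DIM('a) / 2) * (4 * pi * \<alpha> * t) powr (- (real DIM('a) / 2)) = (4 * pi * \<alpha>) powr (- (real DIM('a) / 2))"
  proof -
    have U: "t powr (real DIM('a) / 2) * t powr (- (real DIM('a) / 2)) = 1"
      using assms by (simp add: powr_add[symmetric])
    have E: "(4 * pi * \<alpha> * t) powr (- (real DIM('a) / 2))
        = (4 * pi * \<alpha>) powr (- (real DIM('a) / 2)) * t powr (- (real DIM('a) / 2))" by (rule powr_mult)
    show ?thesis unfolding E by (subst mult.left_commute) (simp only: U mult_1_right)
  qed
  then show ?thesis by (simp only: heat_kernel_def profile_def mult.assoc[symmetric])
qed

lemma profile_nonneg: "0 \<le> profile x t" by (simp add: profile_def)

lemma profile_le:
  assumes "0 < t" shows "profile x t \<le> gamma"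
  using alpha_pos assms by (simp add: profile_def gamma_def mult_left_le)

text \<open>Changing the time rescales the exponent \<open>P\<close> by a factor close to \<open>1\<close>; large exponents do no harm
  since \<open>P exp (-P) \<le> 1\<close>.\<close>
lemma profile_time:
  assumes s: "0 < s" "s \<le> t"
  shows "\<bar>profile x s - profile x t\<bar> \<le> gamma * ((t - s) / s)"
proof -
  define P where "P = (norm x)\<^sup>2 / (4 * \<alpha> * t)"
  have P: "0 \<le> P" using s alpha_pos by (simp add: P_def)
  have eq: "(norm x)\<^sup>2 / (4 * \<alpha> * s) = P + P * ((t - s) / s)"
    using s alpha_pos by (simp add: P_def field_simps)
  let ?c = "P * ((t - s) / s)"
  have c: "0 \<le> ?c" using P s by simp
  have "exp (- P) - exp (- (P + ?c)) = exp (- P) * (1 - exp (- ?c))" by (simp add: exp_diff exp_minus exp_add field_simps)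
  also have "\<dots> \<le> exp (- P) * ?c" using exp_ge_add_one_self[of "- ?c"] by (intro mult_left_mono) auto
  also have "\<dots> = (P * exp (- P)) * ((t - s) / s)" by simp
  also have "\<dots> \<le> 1 * ((t - s) / s)"
  proof (rule mult_right_mono)
    have "P \<le> exp P" using exp_ge_add_one_self[of P] by linarith
    then show "P * exp (- P) \<le> 1" by (simp add: exp_minus field_simps)
  qed (use s in simp)
  finally have "\<bar>exp (- (P + ?c)) - exp (- P)\<bar> \<le> (t - s) / s" using c by simp
  then have "gamma * \<bar>exp (- (P + ?c)) - exp (- P)\<bar> \<le> gamma * ((t - s) / s)" using gamma_pos by (intro mult_left_mono) auto
  moreover have "\<bar>profile x s - profile x t\<bar> = gamma * \<bar>exp (- (P + ?c)) - exp (- P)\<bar>"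
    unfolding profile_def gamma_def[symmetric] eq P_def[symmetric] using gamma_pos
    by (simp add: right_diff_distrib[symmetric] abs_mult)
  ultimately show ?thesis by simp
qed

lemma profile_space:
  assumes t: "0 < t"
  shows "\<bar>profile (x - y) t - profile x t\<bar> \<le> gamma * min 1 (norm y / sqrt (4 * \<alpha> * t))"
proof -
  let ?r = "sqrt (4 * \<alpha> * t)"
  have r: "0 < ?r" "?r\<^sup>2 = 4 * \<alpha> * t" using t alpha_pos by auto
  have E: "profile z t = gamma * exp (- ((norm z / ?r)\<^sup>2))" for z
    using r by (simp add: profile_def gamma_def power_divide)
  have "\<bar>exp (- ((norm (x - y) / ?r)\<^sup>2)) - exp (- ((norm x / ?r)\<^sup>2))\<bar> \<le> \<bar>norm (x - y) / ?r - norm x / ?r\<bar>"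
    by (rule exp_minus_square_lipschitz)
  also have "\<dots> = \<bar>norm (x - y) - norm x\<bar> / ?r" using r by (simp add: diff_divide_distrib[symmetric] abs_divide)
  also have "\<dots> \<le> norm y / ?r"
  proof (rule divide_right_mono)
    have "\<bar>norm (x - y) - norm x\<bar> \<le> norm (x - y - x)" by (rule norm_triangle_ineq3)
    then show "\<bar>norm (x - y) - norm x\<bar> \<le> norm y" by simp
  qed (use r in simp)
  finally have 1: "\<bar>exp (- ((norm (x - y) / ?r)\<^sup>2)) - exp (- ((norm x / ?r)\<^sup>2))\<bar> \<le> norm y / ?r" .
  have "exp (- ((norm z / ?r)\<^sup>2)) \<le> 1" "0 \<le> exp (- ((norm z / ?r)\<^sup>2))" for z :: 'a by auto
  then have 2: "\<bar>exp (- ((norm (x - y) / ?r)\<^sup>2)) - exp (- ((norm x / ?r)\<^sup>2))\<bar> \<le> 1" by (smt (verit))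
  show ?thesis unfolding E right_diff_distrib[symmetric] abs_mult
    using 1 2 gamma_pos by (simp add: mult_left_mono)
qed

lemma profile_measurable [measurable]: "(\<lambda>x. profile x t) \<in> borel_measurable borel"
  unfolding profile_def by measurable

text \<open>The local limit theorem replaces the convolution power by the Gaussian, whose translates by fixed
  vectors are indistinguishable at scale \<open>\<surd>n\<close>; dominated convergence extends this from fixed vectors to an
  arbitrary integrable initial datum.\<close>
theorem whole_space_asymptotics:
  assumes f: "integrable lborel f" and eps: "0 < \<epsilon>"
  obtains n0 where "\<And>n x. n0 \<le> n \<Longrightarrow>
    \<bar>real (Suc n) powr (real DIM('a) / 2) * cv (cvpow J n) f x - (LINT y|lborel. f y) * profile x (real (Suc n))\<bar> \<le> \<epsilon>"
proof -
  let ?d = "real DIM('a) / 2"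
  have [measurable]: "f \<in> borel_measurable borel" using f by auto
  obtain C where C: "0 \<le> C"
    "\<And>n x. \<bar>cvpow J n x - heat_kernel \<alpha> x (real (Suc n))\<bar> \<le> C * real (Suc n) powr (- ?d - 1)"
    by (rule local_limit_theorem) blast
  define F where "F = (LINT y|lborel. \<bar>f y\<bar>)"
  define W where "W n = (LINT y|lborel. min 1 (norm y / sqrt (4 * \<alpha> * real (Suc n))) * \<bar>f y\<bar>)" for n
  have iW: "integrable lborel (\<lambda>y. min 1 (norm y / sqrt (4 * \<alpha> * real (Suc n))) * \<bar>f y\<bar>)" for n
    using alpha_pos f by (intro integrable_bounded_mult[where C=1] integrable_abs) auto
  have "W \<longlonglongrightarrow> (LINT y|lborel. 0 * \<bar>f y\<bar>)"
    unfolding W_def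
  proof (rule integral_dominated_convergence[where w="\<lambda>y. \<bar>f y\<bar>"])
    show "AE y in lborel. (\<lambda>n. min 1 (norm y / sqrt (4 * \<alpha> * real (Suc n))) * \<bar>f y\<bar>) \<longlonglongrightarrow> 0 * \<bar>f y\<bar>"
    proof (intro AE_I2 tendsto_mult_right)
      fix y :: 'a
      have "(\<lambda>n. norm y / sqrt (4 * \<alpha> * real (Suc n))) \<longlonglongrightarrow> 0"
        using alpha_pos by real_asymp
      then show "(\<lambda>n. min 1 (norm y / sqrt (4 * \<alpha> * real (Suc n)))) \<longlonglongrightarrow> 0"
        using tendsto_min[OF tendsto_const, of _ 0 sequentially "1::real"] by fastforce
    qed
    show "AE y in lborel. norm (min 1 (norm y / sqrt (4 * \<alpha> * real (Suc n))) * \<bar>f y\<bar>) \<le> \<bar>f y\<bar>" for n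
    proof (rule AE_I2)
      fix y :: 'a
      have "0 \<le> min 1 (norm y / sqrt (4 * \<alpha> * real (Suc n)))" using alpha_pos by simp
      then have "norm (min 1 (norm y / sqrt (4 * \<alpha> * real (Suc n))) * \<bar>f y\<bar>) = min 1 (norm y / sqrt (4 * \<alpha> * real (Suc n))) * \<bar>f y\<bar>"
        by (simp only: real_norm_def abs_mult abs_of_nonneg abs_idempotent)
      also have "\<dots> \<le> 1 * \<bar>f y\<bar>" by (intro mult_right_mono) auto
      finally show "norm (min 1 (norm y / sqrt (4 * \<alpha> * real (Suc n))) * \<bar>f y\<bar>) \<le> \<bar>f y\<bar>" by simp
    qed
  qed (use f in auto)
  then have Wlim: "W \<longlonglongrightarrow> 0" by simp
  have "(\<lambda>n. C * F / real (Suc n) + gamma * W n) \<longlonglongrightarrow> 0 + gamma * 0"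
    by (intro tendsto_add tendsto_mult tendsto_const Wlim) real_asymp
  then have "eventually (\<lambda>n. C * F / real (Suc n) + gamma * W n < \<epsilon>) sequentially"
    using eps by (intro order_tendstoD) auto
  then obtain n0 where n0: "\<And>n. n0 \<le> n \<Longrightarrow> C * F / real (Suc n) + gamma * W n < \<epsilon>"
    by (auto simp: eventually_sequentially)
  show thesis
  proof
    fix n and x :: 'a assume "n0 \<le> n"
    define m where "m = real (Suc n)"
    have m: "0 < m" by (simp add: m_def)
    have i1: "integrable lborel (\<lambda>y. cvpow J n (x - y) * f y)"
      using cvpow_measurable cvpow_abs_le f by (rule integrable_cv_slice)
    have i2: "integrable lborel (\<lambda>y. profile (x - y) m * f y)"
      using profile_le[OF m] profile_nonneg f by (intro integrable_cv_slice[where B=gamma]) auto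
    have "m powr ?d * cv (cvpow J n) f x - (LINT y|lborel. f y) * profile x m
      = (LINT y|lborel. m powr ?d * (cvpow J n (x - y) * f y) - profile x m * f y)"
      unfolding cv_def using i1 f by (simp add: mult.commute)
    then have "\<bar>m powr ?d * cv (cvpow J n) f x - (LINT y|lborel. f y) * profile x m\<bar>
      \<le> (LINT y|lborel. \<bar>m powr ?d * (cvpow J n (x - y) * f y) - profile x m * f y\<bar>)"
      by (simp only: integral_abs_bound)
    also have "\<dots> \<le> (LINT y|lborel. C / m * \<bar>f y\<bar> + gamma * (min 1 (norm y / sqrt (4 * \<alpha> * real (Suc n))) * \<bar>f y\<bar>))"
    proof (rule integral_mono)
      show "integrable lborel (\<lambda>y. \<bar>m powr ?d * (cvpow J n (x - y) * f y) - profile x m * f y\<bar>)"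
        using i1 f by (intro integrable_abs Bochner_Integration.integrable_diff integrable_mult_right)
      show "integrable lborel (\<lambda>y. C / m * \<bar>f y\<bar> + gamma * (min 1 (norm y / sqrt (4 * \<alpha> * real (Suc n))) * \<bar>f y\<bar>))"
        using iW f by (intro Bochner_Integration.integrable_add integrable_mult_right integrable_abs)
      fix y :: 'a
      have "\<bar>m powr ?d * cvpow J n (x - y) - profile (x - y) m\<bar>
        = m powr ?d * \<bar>cvpow J n (x - y) - heat_kernel \<alpha> (x - y) m\<bar>"
        unfolding profile_heat_kernel[OF m, symmetric] right_diff_distrib[symmetric] abs_mult by simp
      also have "\<dots> \<le> m powr ?d * (C * m powr (- ?d - 1))"
        using C(2)[of n "x - y"] by (intro mult_left_mono) (auto simp: m_def)
      also have "\<dots> = C / m"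
      proof -
        have "m powr ?d * m powr (- ?d - 1) = m powr (- 1)" by (simp add: powr_add[symmetric] del: of_nat_Suc)
        then have "m powr ?d * (C * m powr (- ?d - 1)) = C * m powr (- 1)" by (simp only: mult.left_commute[of _ C])
        also have "\<dots> = C / m" using m by (simp add: powr_minus_divide)
        finally show ?thesis .
      qed
      finally have "\<bar>m powr ?d * cvpow J n (x - y) - profile (x - y) m\<bar> \<le> C / m" .
      then have "\<bar>m powr ?d * cvpow J n (x - y) - profile x m\<bar> \<le> C / m + gamma * min 1 (norm y / sqrt (4 * \<alpha> * m))"
        using profile_space[OF m, of x y] by linarith
      then have "\<bar>m powr ?d * cvpow J n (x - y) - profile x m\<bar> * \<bar>f y\<bar> \<le> (C / m + gamma * min 1 (norm y / sqrt (4 * \<alpha> * m))) * \<bar>f y\<bar>"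
        by (rule mult_right_mono) simp
      moreover have "\<bar>m powr ?d * (cvpow J n (x - y) * f y) - profile x m * f y\<bar> = \<bar>m powr ?d * cvpow J n (x - y) - profile x m\<bar> * \<bar>f y\<bar>"
        unfolding abs_mult[symmetric] by (simp add: algebra_simps)
      ultimately show "\<bar>m powr ?d * (cvpow J n (x - y) * f y) - profile x m * f y\<bar>
        \<le> C / m * \<bar>f y\<bar> + gamma * (min 1 (norm y / sqrt (4 * \<alpha> * real (Suc n))) * \<bar>f y\<bar>)"
        unfolding m_def[symmetric] by (simp add: distrib_right)
    qed
    also have "\<dots> = C * F / m + gamma * W n"
      unfolding F_def W_def using iW[of n] f by simp
    finally show "\<bar>real (Suc n) powr ?d * cv (cvpow J n) f x - (LINT y|lborel. f y) * profile x (real (Suc n))\<bar> \<le> \<epsilon>"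
      using n0[OF \<open>n0 \<le> n\<close>] unfolding m_def by linarith
  qed
qed

end

section \<open>The walk killed in the hole\<close>

text \<open>One step of the walk, followed by removal of the mass that has landed in \<open>H\<close>.\<close>
definition kill :: "('a::euclidean_space \<Rightarrow> real) \<Rightarrow> 'a set \<Rightarrow> ('a \<Rightarrow> real) \<Rightarrow> 'a \<Rightarrow> real" where
  "kill J H g x = (if x \<in> H then 0 else cv J g x)"

lemma cv_diff:
  assumes "\<And>x. integrable lborel (\<lambda>y. K (x - y) * f y)" "\<And>x. integrable lborel (\<lambda>y. K (x - y) * g y)"
  shows "cv K (\<lambda>y. f y - g y) x = cv K f x - cv K g x"
  using assms by (simp add: cv_def right_diff_distrib)

lemma cv_sum:
  assumes "\<And>i x. i \<in> I \<Longrightarrow> integrable lborel (\<lambda>y. K (x - y) * f i y)"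
  shows "cv K (\<lambda>y. \<Sum>i\<in>I. f i y) x = (\<Sum>i\<in>I. cv K (f i) x)"
  using assms by (simp add: cv_def sum_distrib_left)

locale killed_walk = isotropic_kernel J \<alpha> for J :: "'a::euclidean_space \<Rightarrow> real" and \<alpha> +
  fixes H :: "'a set" and \<rho> :: real and f0 :: "'a \<Rightarrow> real" and B :: real
  assumes H_borel [measurable]: "H \<in> sets borel"
    and H_bounded: "\<And>x. x \<in> H \<Longrightarrow> norm x \<le> \<rho>" and rho_pos: "0 < \<rho>"
    and f0_integrable: "integrable lborel f0"
    and f0_nonneg: "0 \<le> f0 x" and f0_le: "f0 x \<le> B"
    and f0_H: "x \<in> H \<Longrightarrow> f0 x = 0"
begin

definition walk :: "nat \<Rightarrow> 'a \<Rightarrow> real" where "walk n = (kill J H ^^ n) f0"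

lemma walk_0: "walk 0 = f0" and walk_Suc: "walk (Suc n) = kill J H (walk n)"
  by (simp_all add: walk_def)

lemma B_nonneg: "0 \<le> B" using f0_nonneg f0_le order_trans by blast

lemma
  shows walk_nonneg: "0 \<le> walk n x" and walk_le: "walk n x \<le> B"
    and walk_integrable: "integrable lborel (walk n)" and walk_H: "x \<in> H \<Longrightarrow> walk n x = 0"
proof -
  have "(\<forall>x. 0 \<le> walk n x) \<and> (\<forall>x. walk n x \<le> B) \<and> integrable lborel (walk n) \<and> (\<forall>x\<in>H. walk n x = 0)"
  proof (induction n)
    case 0
    then show ?case using f0_nonneg f0_le f0_integrable f0_H by (simp add: walk_0)
  next
    case (Suc n)
    have [measurable]: "walk n \<in> borel_measurable borel" using Suc by auto
    have nn: "0 \<le> cv J (walk n) x" for x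
      using Suc J_nonneg unfolding cv_def by (intro Bochner_Integration.integral_nonneg) auto
    have le: "cv J (walk n) x \<le> B" for x
    proof -
      have "\<bar>cv (walk n) J x\<bar> \<le> B * (LINT y|lborel. \<bar>J y\<bar>)"
        using Suc J_integrable by (intro cv_le) auto
      then show ?thesis using cv_commute[of J "walk n" x] J_nonneg J_integral by auto
    qed
    have "integrable lborel (cv J (walk n))"
      using cv_integrable[OF J_integrable _ J_measurable J_abs_le, of "walk n"] Suc by auto
    then have "integrable lborel (\<lambda>x. indicator (- H) x * cv J (walk n) x)"
      by (rule integrable_bounded_mult[where C=1]) (auto simp: indicator_def)
    moreover have "(\<lambda>x. indicator (- H) x * cv J (walk n) x) = walk (Suc n)"
      by (auto simp: walk_Suc kill_def indicator_def)
    ultimately have "integrable lborel (walk (Suc n))" by simp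
    moreover have "0 \<le> walk (Suc n) x" "walk (Suc n) x \<le> B" "x \<in> H \<Longrightarrow> walk (Suc n) x = 0" for x
      using nn le B_nonneg by (auto simp: walk_Suc kill_def)
    ultimately show ?case by blast
  qed
  then show "0 \<le> walk n x" "walk n x \<le> B" "integrable lborel (walk n)" "x \<in> H \<Longrightarrow> walk n x = 0" by auto
qed

lemma walk_measurable [measurable]: "walk n \<in> borel_measurable borel"
  using walk_integrable by auto

lemma walk_abs_le: "\<bar>walk n x\<bar> \<le> B" using walk_nonneg walk_le by simp

lemma integrable_cvpow_slice: "integrable lborel g \<Longrightarrow> integrable lborel (\<lambda>y. cvpow J n (x - y) * g y)"
  using cvpow_measurable cvpow_abs_le by (rule integrable_cv_slice)

lemma integrable_J_slice: "integrable lborel g \<Longrightarrow> integrable lborel (\<lambda>y. J (x - y) * g y)"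
  using integrable_cvpow_slice[of g 0 x] by simp

lemma cv_J_integrable: "integrable lborel g \<Longrightarrow> integrable lborel (cv J g)"
  using cv_integrable[OF J_integrable _ J_measurable J_abs_le] .

definition absorbed :: "nat \<Rightarrow> 'a \<Rightarrow> real" where
  "absorbed n x = (if x \<in> H then cv J (walk n) x else 0)"

lemma cv_walk: "cv J (walk n) x = walk (Suc n) x + absorbed n x"
  by (simp add: walk_Suc kill_def absorbed_def)

lemma absorbed_nonneg: "0 \<le> absorbed n x"
  using walk_nonneg J_nonneg by (auto simp: absorbed_def cv_def intro!: Bochner_Integration.integral_nonneg)

lemma absorbed_integrable: "integrable lborel (absorbed n)"
proof -
  have "absorbed n = (\<lambda>x. cv J (walk n) x - walk (Suc n) x)" by (auto simp: cv_walk)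
  then show ?thesis using cv_J_integrable[OF walk_integrable] walk_integrable by simp
qed

definition mass :: "nat \<Rightarrow> real" where "mass n = (LINT x|lborel. walk n x)"

lemma mass_Suc: "mass n = mass (Suc n) + (LINT x|lborel. absorbed n x)"
proof -
  have "mass n = (LINT x|lborel. cv J (walk n) x)"
    using cv_integral[OF J_integrable walk_integrable J_measurable J_abs_le] by (simp add: mass_def J_integral)
  also have "\<dots> = mass (Suc n) + (LINT x|lborel. absorbed n x)"
    unfolding cv_walk mass_def using walk_integrable absorbed_integrable by simp
  finally show ?thesis .
qed

lemma mass_nonneg: "0 \<le> mass n"
  unfolding mass_def using walk_nonneg by (intro Bochner_Integration.integral_nonneg) auto

lemma mass_decseq: "decseq mass"
proof (rule decseq_SucI)
  fix n
  have "0 \<le> (LINT x|lborel. absorbed n x)" using absorbed_nonneg by (intro Bochner_Integration.integral_nonneg) auto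
  then show "mass (Suc n) \<le> mass n" using mass_Suc[of n] by simp
qed

lemma mass_absorbed: "(\<Sum>k<n. LINT x|lborel. absorbed (K + k) x) = mass K - mass (K + n)"
proof (induction n)
  case (Suc n)
  then show ?case using mass_Suc[of "K + n"] by simp
qed simp

end

section \<open>The stationary solution and the asymptotics of the killed walk\<close>

locale killed_walk_stationary = killed_walk J \<alpha> H \<rho> f0 B
  for J :: "'a::euclidean_space \<Rightarrow> real" and \<alpha> H \<rho> f0 B +
  fixes \<phi> :: "'a \<Rightarrow> real"
  assumes phi_measurable [measurable]: "\<phi> \<in> borel_measurable borel"
    and phi_local: "\<And>R. integrable lborel (\<lambda>x. indicator (cball 0 R) x * \<phi> x)"
    and phi_stationary: "AE x in lborel. x \<notin> H \<longrightarrow> cv J \<phi> x = \<phi> x"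
    and phi_H: "AE x in lborel. x \<in> H \<longrightarrow> \<phi> x = 0"
    and phi_infinity: "\<And>e. 0 < e \<Longrightarrow> \<exists>R. AE x in lborel. R \<le> norm x \<longrightarrow> \<bar>\<phi> x - 1\<bar> < e"
begin

text \<open>The stationary solution is integrable on balls and bounded outside a large ball.\<close>
lemma integrable_mult_phi:
  assumes f: "integrable lborel f" and b: "\<And>x. \<bar>f x\<bar> \<le> b"
  shows "integrable lborel (\<lambda>x. f x * \<phi> x)"
proof -
  have [measurable]: "f \<in> borel_measurable borel" using f by auto
  obtain R where R: "AE x in lborel. R \<le> norm x \<longrightarrow> \<bar>\<phi> x - 1\<bar> < 1" using phi_infinity[of 1] by auto
  have b0: "0 \<le> b" using b[of 0] by linarith
  show ?thesis
  proof (rule Bochner_Integration.integrable_bound)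
    show "integrable lborel (\<lambda>x. b * \<bar>indicator (cball 0 R) x * \<phi> x\<bar> + 2 * \<bar>f x\<bar>)"
      using phi_local[of R] f by (intro Bochner_Integration.integrable_add integrable_mult_right integrable_abs)
    show "AE x in lborel. norm (f x * \<phi> x) \<le> norm (b * \<bar>indicator (cball 0 R) x * \<phi> x\<bar> + 2 * \<bar>f x\<bar>)"
      using R
    proof eventually_elim
      case (elim x)
      show ?case
      proof (cases "norm x \<le> R")
        case True
        have "\<bar>f x\<bar> * \<bar>\<phi> x\<bar> \<le> b * \<bar>\<phi> x\<bar>" using b by (intro mult_right_mono) auto
        then show ?thesis using True b0 by (simp add: abs_mult)
      next
        case False
        then have "\<bar>\<phi> x\<bar> \<le> 2" using elim by auto
        then have "\<bar>f x\<bar> * \<bar>\<phi> x\<bar> \<le> \<bar>f x\<bar> * 2" by (intro mult_left_mono) auto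
        then show ?thesis using False by (simp add: abs_mult)
      qed
    qed
  qed simp
qed

text \<open>The mass killed in \<open>H\<close> does not count because \<open>\<phi>\<close> vanishes there. The step itself can be moved to
  \<open>\<phi>\<close>, where it acts as the identity outside \<open>H\<close>, and \<open>w\<^sub>n\<close> vanishes in \<open>H\<close>.\<close>
lemma conserved_step: "(LINT x|lborel. walk (Suc n) x * \<phi> x) = (LINT x|lborel. walk n x * \<phi> x)"
proof -
  have i: "integrable lborel (\<lambda>x. cv J (\<lambda>y. \<bar>walk n y\<bar>) x * \<phi> x)"
  proof (rule integrable_mult_phi)
    show "integrable lborel (cv J (\<lambda>y. \<bar>walk n y\<bar>))" using walk_integrable by (intro cv_J_integrable integrable_abs)
    show "\<bar>cv J (\<lambda>y. \<bar>walk n y\<bar>) x\<bar> \<le> Jmax * (LINT y|lborel. \<bar>\<bar>walk n y\<bar>\<bar>)" for x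
      using J_abs_le walk_integrable by (intro cv_le) auto
  qed
  have sym: "(LINT x|lborel. cv J (walk n) x * \<phi> x) = (LINT x|lborel. walk n x * cv J \<phi> x)"
    and i2: "integrable lborel (\<lambda>x. walk n x * cv J \<phi> x)"
    using cv_symmetric[OF _ _ _ J_even J_nonneg integrable_J_slice[OF walk_integrable] i]
      cv_symmetric_integrable[OF _ _ _ J_even J_nonneg integrable_J_slice[OF walk_integrable] i] by simp_all
  have "(LINT x|lborel. walk (Suc n) x * \<phi> x) = (LINT x|lborel. cv J (walk n) x * \<phi> x)"
  proof (rule integral_cong_AE)
    show "AE x in lborel. walk (Suc n) x * \<phi> x = cv J (walk n) x * \<phi> x"
      using phi_H by eventually_elim (auto simp: walk_Suc kill_def)
  qed auto
  also note sym
  also have "(LINT x|lborel. walk n x * cv J \<phi> x) = (LINT x|lborel. walk n x * \<phi> x)"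
  proof (rule integral_cong_AE)
    show "AE x in lborel. walk n x * cv J \<phi> x = walk n x * \<phi> x"
      using phi_stationary by eventually_elim (auto simp: walk_H)
  qed auto
  finally show ?thesis .
qed

definition M :: real where "M = (LINT x|lborel. f0 x * \<phi> x)"

lemma conserved: "(LINT x|lborel. walk n x * \<phi> x) = M"
  by (induction n) (simp_all add: walk_0 M_def conserved_step)

lemma walk_le_free: "walk (K + Suc n) x \<le> cv (cvpow J n) (walk K) x"
proof (induction n arbitrary: x)
  case 0
  show ?case using absorbed_nonneg[of K x] by (simp add: cv_walk)
next
  case (Suc n)
  have "walk (K + Suc (Suc n)) x \<le> cv J (walk (K + Suc n)) x"
    using absorbed_nonneg[of "K + Suc n" x] by (simp add: cv_walk)
  also have "\<dots> \<le> cv J (cv (cvpow J n) (walk K)) x"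
  proof -
    have "integrable lborel (cv (cvpow J n) (walk K))"
      using cv_integrable[OF cvpow_integrable walk_integrable cvpow_measurable cvpow_abs_le] .
    then show ?thesis
      unfolding cv_def[of J] using integrable_J_slice walk_integrable Suc J_nonneg
      by (intro integral_mono) (auto intro!: mult_left_mono)
  qed
  also have "\<dots> = cv (cvpow J (Suc n)) (walk K) x"
    using cv_cvpow_add[OF walk_integrable, of 0 n K] by simp
  finally show ?case .
qed

lemma cv_cvpow_decay:
  obtains C where "0 < C" "\<And>n g x. integrable lborel g \<Longrightarrow>
    \<bar>cv (cvpow J n) g x\<bar> \<le> C * real (Suc n) powr (- (real DIM('a) / 2)) * (LINT y|lborel. \<bar>g y\<bar>)"
proof -
  obtain C where C: "0 < C" "\<And>n x. cvpow J n x \<le> C * real (Suc n) powr (- (real DIM('a) / 2))"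
    by (rule cvpow_sup_decay) blast
  show thesis
  proof
    show "0 < C" by fact
    fix n and g :: "'a \<Rightarrow> real" and x :: 'a assume "integrable lborel g"
    then show "\<bar>cv (cvpow J n) g x\<bar> \<le> C * real (Suc n) powr (- (real DIM('a) / 2)) * (LINT y|lborel. \<bar>g y\<bar>)"
      using C(2) cvpow_nonneg by (intro cv_le) (auto simp: abs_of_nonneg)
  qed
qed

lemma mass_abs: "(LINT y|lborel. \<bar>walk n y\<bar>) = mass n"
  using walk_nonneg by (simp add: mass_def)

lemma walk_decay:
  obtains C where "0 < C" "\<And>n x. 0 < n \<Longrightarrow> walk n x \<le> C * real n powr (- (real DIM('a) / 2))"
proof -
  obtain C where C: "0 < C" "\<And>n g x. integrable lborel g \<Longrightarrow>
    \<bar>cv (cvpow J n) g x\<bar> \<le> C * real (Suc n) powr (- (real DIM('a) / 2)) * (LINT y|lborel. \<bar>g y\<bar>)"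
    by (rule cv_cvpow_decay) blast
  show thesis
  proof
    show "0 < C * (mass 0 + 1)" using C mass_nonneg[of 0] by (simp add: add_nonneg_pos)
    fix n :: nat and x assume "0 < n"
    then obtain m where n: "n = Suc m" by (cases n) auto
    let ?p = "real n powr (- (real DIM('a) / 2))"
    have "walk n x \<le> cv (cvpow J m) (walk 0) x" using walk_le_free[of 0 m x] n by simp
    also have "\<dots> \<le> C * ?p * mass 0" using C(2)[OF walk_integrable, of m 0 x] unfolding n mass_abs by linarith
    also have "\<dots> \<le> C * ?p * (mass 0 + 1)" using C by (intro mult_left_mono) auto
    finally show "walk n x \<le> C * (mass 0 + 1) * ?p" by (simp add: mult_ac)
  qed
qed

text \<open>The difference \<open>m\<^sub>n - M\<close> is \<open>\<integral> w\<^sub>n (1 - \<phi>)\<close>. Far out, \<open>1 - \<phi>\<close> is small; on a fixed ball \<open>w\<^sub>n\<close> tends to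
  zero uniformly.\<close>
lemma mass_tendsto: "mass \<longlonglongrightarrow> M"
proof (rule LIMSEQ_I)
  fix e :: real assume e: "0 < e"
  define \<eta> where "\<eta> = e / (2 * (mass 0 + 1))"
  have m0: "0 < mass 0 + 1" using mass_nonneg[of 0] by simp
  have eta: "0 < \<eta>" using e m0 by (simp add: \<eta>_def)
  obtain R where R: "AE x in lborel. R \<le> norm x \<longrightarrow> \<bar>\<phi> x - 1\<bar> < \<eta>" using phi_infinity[OF eta] by auto
  obtain C where C: "0 < C" "\<And>n x. 0 < n \<Longrightarrow> walk n x \<le> C * real n powr (- (real DIM('a) / 2))"
    by (rule walk_decay) blast
  let ?L = "\<lambda>x. indicator (cball 0 R) x * \<bar>1 - \<phi> x\<bar> :: real"
  have iL: "integrable lborel ?L"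
  proof -
    have "integrable lborel (\<lambda>x. \<bar>indicator (cball 0 R) x - indicator (cball 0 R) x * \<phi> x\<bar>)"
      using phi_local[of R] by (intro integrable_abs Bochner_Integration.integrable_diff integrable_real_indicator)
        (auto simp: emeasure_bounded_finite[OF bounded_cball, simplified])
    moreover have "(\<lambda>x. \<bar>indicator (cball 0 R) x - indicator (cball 0 R) x * \<phi> x\<bar>) = ?L"
      by (auto simp: indicator_def)
    ultimately show ?thesis by simp
  qed
  define A where "A = (LINT x|lborel. ?L x)"
  have A0: "0 \<le> A" unfolding A_def by (intro Bochner_Integration.integral_nonneg) auto
  have bound: "\<bar>mass n - M\<bar> \<le> e / 2 + C * real n powr (- (real DIM('a) / 2)) * A" if n: "0 < n" for n
  proof -
    let ?s = "C * real n powr (- (real DIM('a) / 2))"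
    have iw: "integrable lborel (\<lambda>x. walk n x * \<phi> x)" using walk_integrable walk_abs_le by (rule integrable_mult_phi)
    have "mass n - M = (LINT x|lborel. walk n x - walk n x * \<phi> x)"
      unfolding mass_def conserved[of n, symmetric] using walk_integrable iw by simp
    then have "\<bar>mass n - M\<bar> \<le> (LINT x|lborel. \<bar>walk n x - walk n x * \<phi> x\<bar>)" by simp
    also have "\<dots> \<le> (LINT x|lborel. \<eta> * walk n x + ?s * ?L x)"
    proof (rule integral_mono_AE)
      show "integrable lborel (\<lambda>x. \<bar>walk n x - walk n x * \<phi> x\<bar>)" using walk_integrable iw by simp
      show "integrable lborel (\<lambda>x. \<eta> * walk n x + ?s * ?L x)"
        using walk_integrable iL by (intro Bochner_Integration.integrable_add integrable_mult_right)
      show "AE x in lborel. \<bar>walk n x - walk n x * \<phi> x\<bar> \<le> \<eta> * walk n x + ?s * ?L x"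
        using R
      proof eventually_elim
        case (elim x)
        have eq: "\<bar>walk n x - walk n x * \<phi> x\<bar> = walk n x * \<bar>1 - \<phi> x\<bar>"
          using walk_nonneg[of n x] by (metis abs_mult abs_of_nonneg mult_1_right right_diff_distrib)
        show ?case
        proof (cases "norm x \<le> R")
          case True
          have "walk n x * \<bar>1 - \<phi> x\<bar> \<le> ?s * \<bar>1 - \<phi> x\<bar>" using C(2)[OF n] by (intro mult_right_mono) auto
          moreover have "0 \<le> \<eta> * walk n x" using eta walk_nonneg by simp
          ultimately show ?thesis unfolding eq using True by simp
        next
          case False
          then have "walk n x * \<bar>1 - \<phi> x\<bar> \<le> walk n x * \<eta>" using elim walk_nonneg by (intro mult_left_mono) auto
          then show ?thesis unfolding eq using False by (simp add: mult.commute)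
        qed
      qed
    qed
    also have "\<dots> = \<eta> * mass n + ?s * A"
      unfolding mass_def A_def using walk_integrable iL by simp
    also have "\<eta> * mass n \<le> \<eta> * (mass 0 + 1)"
      using eta decseqD[OF mass_decseq, of 0 n] by (intro mult_left_mono) auto
    also have "\<eta> * (mass 0 + 1) = e / 2"
    proof -
      have "e / (2 * S) * S = e / 2" if "0 < S" for S :: real using that by simp
      then show ?thesis unfolding \<eta>_def using m0 .
    qed
    finally show ?thesis by simp
  qed
  have "(\<lambda>n. C * real n powr (- (real DIM('a) / 2)) * A) \<longlonglongrightarrow> C * 0 * A"
    by (intro tendsto_mult tendsto_const tendsto_neg_powr filterlim_real_sequentially) simp
  then have "eventually (\<lambda>n. C * real n powr (- (real DIM('a) / 2)) * A < e / 2) sequentially"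
    using e by (intro order_tendstoD) auto
  then obtain n0 where n0: "\<And>n. n0 \<le> n \<Longrightarrow> C * real n powr (- (real DIM('a) / 2)) * A < e / 2"
    by (auto simp: eventually_sequentially)
  show "\<exists>no. \<forall>n\<ge>no. norm (mass n - M) < e"
  proof (intro exI[of _ "max 1 n0"] allI impI)
    fix n assume "max 1 n0 \<le> n"
    then have "0 < n" "n0 \<le> n" by auto
    then show "norm (mass n - M) < e" using bound[of n] n0[of n] by simp
  qed
qed

lemma M_le_mass: "M \<le> mass n"
  using decseq_ge[OF mass_decseq mass_tendsto] .

lemma M_nonneg: "0 \<le> M"
  using LIMSEQ_le_const[OF mass_tendsto] mass_nonneg by blast

text \<open>Mass absorbed at step \<open>K + k\<close> would have performed \<open>n - k\<close> further free steps. The last term is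
  separate since no step follows that absorption.\<close>
lemma duhamel:
  "walk (K + Suc n) x = cv (cvpow J n) (walk K) x
    - (\<Sum>k<n. cv (cvpow J (n - 1 - k)) (absorbed (K + k)) x) - absorbed (K + n) x"
proof (induction n arbitrary: x)
  case 0
  then show ?case by (simp add: cv_walk)
next
  case (Suc n)
  let ?S = "\<lambda>y. \<Sum>k<n. cv (cvpow J (n - 1 - k)) (absorbed (K + k)) y"
  have ic: "integrable lborel (cv (cvpow J j) g)" if "integrable lborel g" for j g
    using cv_integrable[OF cvpow_integrable that cvpow_measurable cvpow_abs_le] .
  have iS: "integrable lborel ?S" by (intro Bochner_Integration.integrable_sum ic absorbed_integrable)
  have add: "cv J (cv (cvpow J j) g) x = cv (cvpow J (Suc j)) g x" if "integrable lborel g" for j g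
    using cv_cvpow_add[OF that, of 0 j] by simp
  have "walk (K + Suc (Suc n)) x = cv J (walk (K + Suc n)) x - absorbed (K + Suc n) x"
    using cv_walk[of "K + Suc n" x] by simp
  also have "walk (K + Suc n) = (\<lambda>y. (cv (cvpow J n) (walk K) y - ?S y) - absorbed (K + n) y)"
    using Suc by auto
  also have "cv J \<dots> x = cv J (cv (cvpow J n) (walk K)) x - cv J ?S x - cv J (absorbed (K + n)) x"
  proof -
    have "cv J (\<lambda>y. (cv (cvpow J n) (walk K) y - ?S y) - absorbed (K + n) y) x
        = cv J (\<lambda>y. cv (cvpow J n) (walk K) y - ?S y) x - cv J (absorbed (K + n)) x"
      by (rule cv_diff; intro integrable_J_slice Bochner_Integration.integrable_diff ic iS walk_integrable absorbed_integrable)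
    also have "cv J (\<lambda>y. cv (cvpow J n) (walk K) y - ?S y) x = cv J (cv (cvpow J n) (walk K)) x - cv J ?S x"
      by (rule cv_diff; intro integrable_J_slice ic iS walk_integrable)
    finally show ?thesis .
  qed
  also have "cv J ?S x = (\<Sum>k<n. cv J (cv (cvpow J (n - 1 - k)) (absorbed (K + k))) x)"
    by (rule cv_sum) (intro integrable_J_slice ic absorbed_integrable)
  also have "\<dots> = (\<Sum>k<n. cv (cvpow J (n - k)) (absorbed (K + k)) x)"
  proof (rule sum.cong[OF refl])
    fix k assume "k \<in> {..<n}"
    then have "n - k = Suc (n - 1 - k)" by auto
    then show "cv J (cv (cvpow J (n - 1 - k)) (absorbed (K + k))) x = cv (cvpow J (n - k)) (absorbed (K + k)) x"
      using add[OF absorbed_integrable] by metis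
  qed
  finally show ?case using add[OF walk_integrable] by simp
qed

text \<open>Seen from a point \<open>x\<close> with \<open>|x| \<ge> 2\<rho>\<close>, every point of the hole is at distance at least \<open>|x|/2\<close>.\<close>
lemma absorbed_far:
  obtains E where "0 < E" "\<And>j k x. 2 * \<rho> \<le> norm x \<Longrightarrow>
    cv (cvpow J j) (absorbed k) x \<le> E * ((norm x)\<^sup>2) powr (- (real DIM('a) / 2)) * (LINT y|lborel. absorbed k y)"
proof -
  let ?d = "real DIM('a) / 2"
  obtain E where E: "0 < E" "\<And>n z. cvpow J n z * ((norm z)\<^sup>2) powr ?d \<le> E" by (rule cvpow_off_diagonal) blast
  show thesis
  proof
    show "0 < E * 4 powr ?d" using E by simp
    fix j k and x :: 'a assume x: "2 * \<rho> \<le> norm x"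
    let ?e = "E * 4 powr ?d * ((norm x)\<^sup>2) powr (- ?d)"
    have "cv (cvpow J j) (absorbed k) x \<le> (LINT y|lborel. ?e * absorbed k y)"
      unfolding cv_def
    proof (rule integral_mono)
      show "integrable lborel (\<lambda>y. cvpow J j (x - y) * absorbed k y)" by (rule integrable_cvpow_slice[OF absorbed_integrable])
      show "integrable lborel (\<lambda>y. ?e * absorbed k y)" using absorbed_integrable by (rule integrable_mult_right)
      fix y
      show "cvpow J j (x - y) * absorbed k y \<le> ?e * absorbed k y"
      proof (cases "y \<in> H")
        case True
        have "norm x \<le> norm (x - y) + norm y" by (metis diff_add_cancel norm_triangle_ineq)
        then have n: "norm x / 2 \<le> norm (x - y)" using H_bounded[OF True] x by linarith
        have nx: "0 < norm x" using x rho_pos by linarith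
        have "(norm x / 2)\<^sup>2 \<le> (norm (x - y))\<^sup>2" using n by (intro power_mono) auto
        then have "(norm x)\<^sup>2 / 4 \<le> (norm (x - y))\<^sup>2" by (simp add: power_divide)
        then have "((norm x)\<^sup>2 / 4) powr ?d \<le> ((norm (x - y))\<^sup>2) powr ?d" by (intro powr_mono2) auto
        then have "cvpow J j (x - y) * ((norm x)\<^sup>2 / 4) powr ?d \<le> cvpow J j (x - y) * ((norm (x - y))\<^sup>2) powr ?d"
          using cvpow_nonneg by (rule mult_left_mono)
        also have "\<dots> \<le> E" by (rule E(2))
        finally have "cvpow J j (x - y) \<le> E / ((norm x)\<^sup>2 / 4) powr ?d"
          using nx by (simp add: pos_le_divide_eq)
        also have "\<dots> = ?e" by (simp add: powr_divide powr_minus field_simps)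
        finally show ?thesis using absorbed_nonneg by (rule mult_right_mono)
      qed (simp add: absorbed_def)
    qed
    then show "cv (cvpow J j) (absorbed k) x \<le> E * 4 powr ?d * ((norm x)\<^sup>2) powr (- ?d) * (LINT y|lborel. absorbed k y)"
      by simp
  qed
qed

text \<open>The terms of the Duhamel sum add up to the mass lost after step \<open>K\<close>, because the bound in
  \<open>absorbed_far\<close> is independent of the number of remaining steps.\<close>
lemma walk_near_free:
  obtains E where "0 < E" "\<And>K n x. 2 * \<rho> \<le> norm x \<Longrightarrow>
    \<bar>walk (K + Suc n) x - cv (cvpow J n) (walk K) x\<bar> \<le> E * ((norm x)\<^sup>2) powr (- (real DIM('a) / 2)) * (mass K - M)"
proof -
  let ?d = "real DIM('a) / 2"
  obtain E where E: "0 < E" "\<And>j k x. 2 * \<rho> \<le> norm x \<Longrightarrow>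
    cv (cvpow J j) (absorbed k) x \<le> E * ((norm x)\<^sup>2) powr (- ?d) * (LINT y|lborel. absorbed k y)"
    by (rule absorbed_far) blast
  show thesis
  proof
    show "0 < E" by fact
    fix K n and x :: 'a assume x: "2 * \<rho> \<le> norm x"
    let ?e = "E * ((norm x)\<^sup>2) powr (- ?d)"
    have "x \<notin> H" using H_bounded[of x] x rho_pos by auto
    then have "cv (cvpow J n) (walk K) x - walk (K + Suc n) x
      = (\<Sum>k<n. cv (cvpow J (n - 1 - k)) (absorbed (K + k)) x)"
      unfolding duhamel by (simp add: absorbed_def)
    also have "\<dots> \<le> (\<Sum>k<n. ?e * (LINT y|lborel. absorbed (K + k) y))"
      by (intro sum_mono E(2) x)
    also have "\<dots> = ?e * (mass K - mass (K + n))" by (simp only: sum_distrib_left[symmetric] mass_absorbed)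
    also have "\<dots> \<le> ?e * (mass K - M)" using E M_le_mass by (intro mult_left_mono) auto
    finally show "\<bar>walk (K + Suc n) x - cv (cvpow J n) (walk K) x\<bar> \<le> ?e * (mass K - M)"
      using walk_le_free[of K n x] by simp
  qed
qed

text \<open>The walk is first compared with the free walk that starts from \<open>w\<^sub>K\<close>, where \<open>K\<close> is so large that
  hardly any mass is absorbed later, and the free walk is then compared with the profile of mass \<open>m\<^sub>K\<close>. The
  delay by \<open>K\<close> steps is negligible in the limit.\<close>
theorem walk_asymptotics:
  assumes \<delta>: "0 < \<delta>" and eps: "0 < \<epsilon>"
  obtains n0 where "0 < n0" "\<And>n x. n0 \<le> n \<Longrightarrow> \<delta> * real n \<le> (norm x)\<^sup>2 \<Longrightarrow>
    \<bar>real n powr (real DIM('a) / 2) * walk n x - M * profile x (real n)\<bar> \<le> \<epsilon>"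
proof -
  let ?d = "real DIM('a) / 2"
  obtain E where E: "0 < E" "\<And>K n x. 2 * \<rho> \<le> norm x \<Longrightarrow>
    \<bar>walk (K + Suc n) x - cv (cvpow J n) (walk K) x\<bar> \<le> E * ((norm x)\<^sup>2) powr (- ?d) * (mass K - M)"
    by (rule walk_near_free) blast
  \<comment> \<open>\<open>E'\<close> collects both places where \<open>m\<^sub>K - M\<close> enters: later absorption, and the mass of the profile.\<close>
  define E' where "E' = E * \<delta> powr (- ?d) + gamma"
  have E': "0 < E'" using E gamma_pos \<delta> by (simp add: E'_def add_pos_pos)
  have "eventually (\<lambda>K. mass K - M < \<epsilon> / (4 * E')) sequentially"
    using tendsto_diff[OF mass_tendsto tendsto_const, of M] eps E' by (intro order_tendstoD) auto
  then obtain K where K: "mass K - M < \<epsilon> / (4 * E')" by (auto simp: eventually_sequentially)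
  then have EK: "E' * (mass K - M) \<le> \<epsilon> / 4" using E' by (simp add: field_simps)
  obtain C where C: "0 < C" "\<And>n g x. integrable lborel g \<Longrightarrow>
    \<bar>cv (cvpow J n) g x\<bar> \<le> C * real (Suc n) powr (- ?d) * (LINT y|lborel. \<bar>g y\<bar>)"
    by (rule cv_cvpow_decay) blast
  obtain n1 where n1: "\<And>n x. n1 \<le> n \<Longrightarrow>
    \<bar>real (Suc n) powr ?d * cv (cvpow J n) (walk K) x - (LINT y|lborel. walk K y) * profile x (real (Suc n))\<bar> \<le> \<epsilon> / 4"
    using whole_space_asymptotics[OF walk_integrable[of K], of "\<epsilon> / 4"] eps by auto
  \<comment> \<open>The total cost of the delay: \<open>p = Suc m\<close> free steps against \<open>K + p\<close> steps in all.\<close>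
  define T where "T m = \<bar>(real (K + Suc m) / real (Suc m)) powr ?d - 1\<bar> * (C * mass K) + mass K * (gamma * (real K / real (Suc m)))" for m
  have "(\<lambda>m. real (K + Suc m) / real (Suc m)) \<longlonglongrightarrow> 1" by real_asymp
  then have "(\<lambda>m. (real (K + Suc m) / real (Suc m)) powr ?d) \<longlonglongrightarrow> 1 powr ?d"
    by (intro tendsto_powr tendsto_const) auto
  then have "T \<longlonglongrightarrow> \<bar>1 powr ?d - 1\<bar> * (C * mass K) + mass K * (gamma * 0)"
    unfolding T_def
    by (intro tendsto_add tendsto_mult tendsto_rabs tendsto_diff tendsto_const) (assumption, real_asymp)
  then have "eventually (\<lambda>m. T m < \<epsilon> / 4) sequentially" using eps by (intro order_tendstoD) auto
  then obtain n2 where n2: "\<And>m. n2 \<le> m \<Longrightarrow> T m < \<epsilon> / 4" by (auto simp: eventually_sequentially)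
  obtain n3 :: nat where n3: "4 * \<rho>\<^sup>2 / \<delta> \<le> real n3" using real_arch_simple by blast
  show thesis
  proof
    show "0 < Suc (K + n1 + n2 + n3)" by simp
    fix n and x :: 'a assume n: "Suc (K + n1 + n2 + n3) \<le> n" and x: "\<delta> * real n \<le> (norm x)\<^sup>2"
    define m where "m = n - Suc K"
    have nm: "n = K + Suc m" "n1 \<le> m" "n2 \<le> m" "n3 \<le> n" using n by (auto simp: m_def)
    define N where "N = real n"
    define p where "p = real (Suc m)"
    have p: "0 < p" "p \<le> N" "N - p = real K" by (auto simp: p_def N_def nm)
    have N: "0 < N" using p by simp
    have "4 * \<rho>\<^sup>2 / \<delta> \<le> N" using n3 nm(4) by (simp add: N_def)
    then have "4 * \<rho>\<^sup>2 \<le> \<delta> * N" using \<delta> by (simp add: field_simps)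
    then have "(2 * \<rho>)\<^sup>2 \<le> (norm x)\<^sup>2" using x by (simp add: N_def power_mult_distrib)
    then have far: "2 * \<rho> \<le> norm x" by (rule power2_le_imp_le) simp
    let ?F = "cv (cvpow J m) (walk K) x"
    have s1: "\<bar>N powr ?d * walk n x - N powr ?d * ?F\<bar> \<le> E * \<delta> powr (- ?d) * (mass K - M)"
    proof -
      have "((norm x)\<^sup>2) powr (- ?d) \<le> (\<delta> * N) powr (- ?d)"
        using x \<delta> N by (intro powr_mono2') (auto simp: N_def)
      then have "E * ((norm x)\<^sup>2) powr (- ?d) * (mass K - M) \<le> E * (\<delta> * N) powr (- ?d) * (mass K - M)"
        using E M_le_mass by (intro mult_right_mono mult_left_mono) auto
      then have "\<bar>walk n x - ?F\<bar> \<le> E * (\<delta> * N) powr (- ?d) * (mass K - M)"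
        using E(2)[OF far, of K m] unfolding nm(1) by linarith
      then have "N powr ?d * \<bar>walk n x - ?F\<bar> \<le> N powr ?d * (E * (\<delta> * N) powr (- ?d) * (mass K - M))"
        by (rule mult_left_mono) simp
      also have "\<dots> = E * \<delta> powr (- ?d) * (mass K - M)"
      proof -
        have "N powr ?d * N powr (- ?d) = 1" using N by (simp add: powr_add[symmetric])
        moreover have "N powr ?d * (E * (\<delta> * N) powr (- ?d) * (mass K - M))
          = (N powr ?d * N powr (- ?d)) * (E * \<delta> powr (- ?d) * (mass K - M))"
          by (simp only: powr_mult mult_ac)
        ultimately show ?thesis by simp
      qed
      finally show ?thesis by (simp add: right_diff_distrib[symmetric] abs_mult)
    qed
    have s2: "\<bar>N powr ?d * ?F - p powr ?d * ?F\<bar> \<le> \<bar>(N / p) powr ?d - 1\<bar> * (C * mass K)"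
    proof -
      have "N powr ?d = (N / p) powr ?d * p powr ?d" using p N by (simp add: powr_divide)
      then have "N powr ?d * ?F - p powr ?d * ?F = ((N / p) powr ?d - 1) * (p powr ?d * ?F)"
        by (simp add: algebra_simps)
      moreover have "\<bar>p powr ?d * ?F\<bar> \<le> C * mass K"
      proof -
        have "p powr ?d * \<bar>?F\<bar> \<le> p powr ?d * (C * p powr (- ?d) * mass K)"
          using C(2)[OF walk_integrable, of m K x] unfolding mass_abs p_def by (rule mult_left_mono) simp
        also have "\<dots> = C * mass K" using p by (simp add: powr_minus field_simps)
        finally show ?thesis by (simp add: abs_mult)
      qed
      ultimately show ?thesis by (simp only: abs_mult[of "_ - 1"] mult_left_mono abs_ge_zero)
    qed
    have s3: "\<bar>p powr ?d * ?F - mass K * profile x p\<bar> \<le> \<epsilon> / 4"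
      using n1[OF nm(2), of x] unfolding mass_def p_def .
    have s4: "\<bar>mass K * profile x p - mass K * profile x N\<bar> \<le> mass K * (gamma * (real K / p))"
      using mult_left_mono[OF profile_time[OF p(1,2), of x] mass_nonneg[of K]]
      unfolding p(3) right_diff_distrib[symmetric] abs_mult abs_of_nonneg[OF mass_nonneg] .
    have s5: "\<bar>mass K * profile x N - M * profile x N\<bar> \<le> gamma * (mass K - M)"
    proof -
      have "\<bar>mass K * profile x N - M * profile x N\<bar> = (mass K - M) * profile x N"
        using M_le_mass[of K] profile_nonneg[of x N] by (simp add: left_diff_distrib[symmetric] abs_mult)
      also have "\<dots> \<le> (mass K - M) * gamma" using M_le_mass[of K] profile_le[OF N] by (intro mult_left_mono) auto
      finally show ?thesis by (simp add: mult.commute)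
    qed
    have T: "\<bar>(N / p) powr ?d - 1\<bar> * (C * mass K) + mass K * (gamma * (real K / p)) < \<epsilon> / 4"
      using n2[OF nm(3)] unfolding T_def N_def p_def nm(1) .
    have "E * \<delta> powr (- ?d) * (mass K - M) + gamma * (mass K - M) \<le> \<epsilon> / 4"
      using EK by (simp add: E'_def distrib_right)
    then have "\<bar>N powr ?d * walk n x - M * profile x N\<bar> \<le> \<epsilon>"
      using s1 s2 s3 s4 s5 T eps by linarith
    then show "\<bar>real n powr ?d * walk n x - M * profile x (real n)\<bar> \<le> \<epsilon>" by (simp add: N_def)
  qed
qed

end

section \<open>From the evolution equation to the killed walk\<close>

lemma borel_representative:
  fixes f :: "'a::euclidean_space \<Rightarrow> real"
  assumes "f \<in> borel_measurable lebesgue"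
  obtains g where "g \<in> borel_measurable borel" "AE x in lebesgue. f x = g x"
proof -
  obtain g where "g \<in> borel_measurable lborel" "AE x in lborel. f x = g x"
    using completion_ex_borel_measurable_real[OF assms] by auto
  then show thesis by (intro that[of g]) (auto intro: AE_completion)
qed

lemma
  fixes g :: "'a::euclidean_space \<Rightarrow> real"
  assumes g: "g \<in> borel_measurable borel" and ae: "AE x in lebesgue. f x = g x" and f: "f \<in> borel_measurable lebesgue"
  shows integrable_representative: "integrable lebesgue f \<longleftrightarrow> integrable lborel g"
    and integral_representative: "(LINT x|lebesgue. f x) = (LINT x|lborel. g x)"
proof -
  have g': "g \<in> borel_measurable lborel" "g \<in> borel_measurable lebesgue"
    using g by (auto intro: measurable_completion)
  have "integrable lebesgue f \<longleftrightarrow> integrable lebesgue g" using ae f g' by (intro integrable_cong_AE) auto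
  then show "integrable lebesgue f \<longleftrightarrow> integrable lborel g" using integrable_completion[OF g'(1)] by simp
  have "(LINT x|lebesgue. f x) = (LINT x|lebesgue. g x)" using ae f g' by (intro integral_cong_AE) auto
  then show "(LINT x|lebesgue. f x) = (LINT x|lborel. g x)" using integral_completion[OF g'(1)] by simp
qed

lemma borel_imp_lebesgue_measurable: "g \<in> borel_measurable borel \<Longrightarrow> g \<in> borel_measurable lebesgue"
  by (auto intro: measurable_completion)

lemma conv_eq_cv:
  fixes J f :: "'a::euclidean_space \<Rightarrow> real"
  assumes J: "J \<in> borel_measurable borel" and g: "g \<in> borel_measurable borel"
    and f: "f \<in> borel_measurable lebesgue" and ae: "AE x in lebesgue. f x = g x"
  shows "conv J f x = cv J g x"
  unfolding conv_def cv_def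
proof (rule integral_representative)
  have Jx: "(\<lambda>y. J (x - y)) \<in> borel_measurable borel" using J by measurable
  then show "(\<lambda>y. J (x - y) * g y) \<in> borel_measurable borel" using g by (rule borel_measurable_times)
  show "AE y in lebesgue. J (x - y) * f y = J (x - y) * g y" using ae by eventually_elim simp
  show "(\<lambda>y. J (x - y) * f y) \<in> borel_measurable lebesgue"
    using borel_imp_lebesgue_measurable[OF Jx] f by (rule borel_measurable_times)
qed

text \<open>Integration against a bounded function is continuous on \<open>L\<^sup>1\<close>, so it takes Riemann sums that converge
  in \<open>L\<^sup>1\<close> to convergent Riemann sums of a real function.\<close>
lemma has_integral_L1_test:
  fixes f :: "real \<Rightarrow> 'a::euclidean_space \<Rightarrow> real"
  assumes I: "has_L1_integral f I a b" and \<psi>: "\<psi> \<in> borel_measurable lebesgue" and C: "\<And>x. \<bar>\<psi> x\<bar> \<le> C"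
  shows "((\<lambda>s. LINT x|lebesgue. \<psi> x * f s x) has_integral (LINT x|lebesgue. \<psi> x * I x)) {a..b}"
  unfolding has_integral_real
proof (intro allI impI)
  fix e :: real assume e: "0 < e"
  have C0: "0 \<le> C" using C[of undefined] by linarith
  have fi: "integrable lebesgue (f s)" if "s \<in> {a..b}" for s using I that by (simp add: has_L1_integral_def)
  have Ii: "integrable lebesgue I" using I by (simp add: has_L1_integral_def)
  have "0 < e / (C + 1)" using e C0 by simp
  then obtain d where d: "0 < d" "\<And>D. D tagged_division_of {a..b} \<Longrightarrow> (\<lambda>s. ball s d) fine D \<Longrightarrow>
      (LINT x|lebesgue. \<bar>(\<Sum>(s,K)\<in>D. measure lborel K * f s x) - I x\<bar>) < e / (C + 1)"
  proof -
    have "\<forall>e>0. \<exists>d>0. \<forall>D. D tagged_division_of {a..b} \<and> (\<lambda>s. ball s d) fine D \<longrightarrow>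
        (LINT x|lebesgue. \<bar>(\<Sum>(s,K)\<in>D. measure lborel K * f s x) - I x\<bar>) < e"
      using I unfolding has_L1_integral_def by (elim conjE)
    from this[rule_format, OF \<open>0 < e / (C + 1)\<close>] show thesis using that by auto
  qed
  show "\<exists>\<gamma>. gauge \<gamma> \<and> (\<forall>D. D tagged_division_of {a..b} \<and> \<gamma> fine D \<longrightarrow>
    norm ((\<Sum>(s, K)\<in>D. measure lborel K *\<^sub>R (LINT x|lebesgue. \<psi> x * f s x)) - (LINT x|lebesgue. \<psi> x * I x)) < e)"
  proof (intro exI[of _ "\<lambda>s. ball s d"] conjI allI impI)
    show "gauge (\<lambda>s. ball s d)" using d by (intro gauge_ball) auto
    fix D assume D: "D tagged_division_of {a..b} \<and> (\<lambda>s. ball s d) fine D"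
    have fs: "integrable lebesgue (f (fst p))" if "p \<in> D" for p
    proof -
      have "fst p \<in> snd p" "snd p \<subseteq> {a..b}"
        using D that tagged_division_ofD(2,3)[of D "{a..b}" "fst p" "snd p"] by auto
      then show ?thesis by (intro fi) auto
    qed
    define S where "S x = (\<Sum>p\<in>D. measure lborel (snd p) * f (fst p) x)" for x
    have Si: "integrable lebesgue S"
      unfolding S_def using fs by (intro Bochner_Integration.integrable_sum integrable_mult_right)
    have SI: "integrable lebesgue (\<lambda>x. S x - I x)" using Si Ii by (rule Bochner_Integration.integrable_diff)
    have "(\<Sum>p\<in>D. measure lborel (snd p) *\<^sub>R (LINT x|lebesgue. \<psi> x * f (fst p) x)) = (LINT x|lebesgue. \<psi> x * S x)"
    proof -
      have "(LINT x|lebesgue. \<psi> x * S x) = (LINT x|lebesgue. (\<Sum>p\<in>D. measure lborel (snd p) * (\<psi> x * f (fst p) x)))"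
        unfolding S_def by (simp add: sum_distrib_left mult.left_commute)
      also have "\<dots> = (\<Sum>p\<in>D. LINT x|lebesgue. measure lborel (snd p) * (\<psi> x * f (fst p) x))"
        using fs by (intro Bochner_Integration.integral_sum integrable_mult_right integrable_bounded_mult[OF _ \<psi> C])
      finally show ?thesis by simp
    qed
    then have "(\<Sum>p\<in>D. measure lborel (snd p) *\<^sub>R (LINT x|lebesgue. \<psi> x * f (fst p) x)) - (LINT x|lebesgue. \<psi> x * I x)
        = (LINT x|lebesgue. \<psi> x * (S x - I x))"
      using integrable_bounded_mult[OF Si \<psi> C] integrable_bounded_mult[OF Ii \<psi> C] by (simp add: right_diff_distrib)
    also have "\<bar>\<dots>\<bar> \<le> (LINT x|lebesgue. \<bar>\<psi> x * (S x - I x)\<bar>)" by (rule integral_abs_bound)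
    also have "\<dots> \<le> (LINT x|lebesgue. C * \<bar>S x - I x\<bar>)"
      using integrable_bounded_mult[OF SI \<psi> C] SI
      by (intro integral_mono integrable_abs integrable_mult_right) (auto simp: abs_mult intro!: mult_right_mono C)
    also have "\<dots> \<le> C * (e / (C + 1))"
    proof -
      have "(LINT x|lebesgue. \<bar>S x - I x\<bar>) < e / (C + 1)"
        using d(2)[of D] D by (simp add: S_def case_prod_beta)
      from mult_left_mono[OF less_imp_le[OF this] C0] show ?thesis by simp
    qed
    also have "\<dots> < e" using e C0 by (simp add: field_simps)
    finally show "norm ((\<Sum>(s, K)\<in>D. measure lborel K *\<^sub>R (LINT x|lebesgue. \<psi> x * f s x)) - (LINT x|lebesgue. \<psi> x * I x)) < e"
      by (simp add: case_prod_beta)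
  qed
qed

context killed_walk
begin

text \<open>The parameter \<open>C\<close> records a bound, which is the same for all iterates under \<^const>\<open>kill\<close>.\<close>
definition test_function :: "('a \<Rightarrow> real) \<Rightarrow> real \<Rightarrow> bool" where
  "test_function \<psi> C \<longleftrightarrow> \<psi> \<in> borel_measurable borel \<and> (\<forall>x. \<bar>\<psi> x\<bar> \<le> C) \<and> (\<forall>x\<in>H. \<psi> x = 0)"

lemma test_function_kill:
  assumes "test_function \<psi> C"
  shows "test_function (kill J H \<psi>) C"
proof -
  have [measurable]: "\<psi> \<in> borel_measurable borel" and C: "\<And>x. \<bar>\<psi> x\<bar> \<le> C" using assms by (auto simp: test_function_def)
  have C0: "0 \<le> C" using C[of 0] by linarith
  have "\<bar>cv \<psi> J x\<bar> \<le> C * (LINT y|lborel. \<bar>J y\<bar>)" for x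
    using C J_integrable by (intro cv_le) auto
  then have "\<bar>cv J \<psi> x\<bar> \<le> C" for x using cv_commute[of J \<psi> x] J_nonneg J_integral by simp
  moreover have "kill J H \<psi> \<in> borel_measurable borel" unfolding kill_def by measurable
  ultimately show ?thesis using C0 by (simp add: test_function_def kill_def)
qed

lemma test_function_funpow: "test_function \<psi> C \<Longrightarrow> test_function ((kill J H ^^ n) \<psi>) C"
  by (induction n) (auto intro: test_function_kill)

lemma test_function_integrable:
  assumes "test_function \<psi> C" "integrable lborel g"
  shows "integrable lborel (\<lambda>x. \<psi> x * g x)"
  using assms by (intro integrable_bounded_mult[where C=C]) (auto simp: test_function_def)

text \<open>Outside \<open>H\<close> one step is a convolution, which is symmetric; in \<open>H\<close> one of the two factors vanishes on
  either side.\<close>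
lemma kill_symmetric:
  assumes \<psi>: "test_function \<psi> C" and g: "integrable lborel g" and gH: "AE x in lborel. x \<in> H \<longrightarrow> g x = 0"
  shows "(LINT x|lborel. kill J H \<psi> x * g x) = (LINT x|lborel. \<psi> x * cv J g x)"
proof -
  have [measurable]: "\<psi> \<in> borel_measurable borel" "g \<in> borel_measurable borel" using \<psi> g by (auto simp: test_function_def)
  have i: "integrable lborel (\<lambda>x. cv J (\<lambda>y. \<bar>g y\<bar>) x * \<psi> x)"
    using test_function_integrable[OF \<psi> cv_J_integrable[OF integrable_abs[OF g]]] by (simp add: mult.commute)
  have "(LINT x|lborel. kill J H \<psi> x * g x) = (LINT x|lborel. g x * cv J \<psi> x)"
  proof (rule integral_cong_AE)
    show "AE x in lborel. kill J H \<psi> x * g x = g x * cv J \<psi> x"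
      using gH by eventually_elim (auto simp: kill_def)
  qed (auto simp: kill_def)
  also have "\<dots> = (LINT x|lborel. cv J g x * \<psi> x)"
    using cv_symmetric[OF _ _ _ J_even J_nonneg integrable_J_slice[OF g] i] by simp
  finally show ?thesis by (simp add: mult.commute)
qed

text \<open>The adjoint of the step of the walk is the step itself, acting on test functions.\<close>
lemma dual_walk:
  assumes "test_function \<psi> C"
  shows "(LINT x|lborel. (kill J H ^^ n) \<psi> x * f0 x) = (LINT x|lborel. \<psi> x * walk n x)"
  using assms
proof (induction n arbitrary: \<psi>)
  case 0
  then show ?case by (simp add: walk_0)
next
  case (Suc n)
  have "(LINT x|lborel. (kill J H ^^ Suc n) \<psi> x * f0 x) = (LINT x|lborel. (kill J H ^^ n) (kill J H \<psi>) x * f0 x)"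
    by (simp add: funpow_swap1)
  also have "\<dots> = (LINT x|lborel. kill J H \<psi> x * walk n x)"
    using Suc by (auto intro: test_function_kill)
  also have "\<dots> = (LINT x|lborel. \<psi> x * cv J (walk n) x)"
    using Suc.prems walk_integrable walk_H by (intro kill_symmetric) auto
  also have "\<dots> = (LINT x|lborel. \<psi> x * walk (Suc n) x)"
    using Suc.prems by (intro Bochner_Integration.integral_cong) (auto simp: walk_Suc kill_def test_function_def)
  finally show ?case .
qed

text \<open>By symmetry the generator moves to the test function, so that the tested evolution equation involves only
  pairings of the solution with test functions, which are independent of representatives. The function \<open>v\<close> consists of Borel representatives.\<close>
lemma weak_formulation:
  assumes sol: "nonlocal_solution J H u0 u" and u0: "AE x in lebesgue. u0 x = f0 x"
  obtains v where "\<And>s. 0 \<le> s \<Longrightarrow> integrable lborel (v s)" "\<And>s. 0 \<le> s \<Longrightarrow> AE x in lebesgue. u s x = v s x"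
    "\<And>s. 0 \<le> s \<Longrightarrow> ((\<lambda>r. LINT x|lborel. \<bar>v r x - v s x\<bar>) \<longlongrightarrow> 0) (at s within {0..})"
    "\<And>s. 0 < s \<Longrightarrow> AE x in lborel. x \<in> H \<longrightarrow> v s x = 0"
    "\<And>\<psi> C t. test_function \<psi> C \<Longrightarrow> 0 < t \<Longrightarrow>
      ((\<lambda>s. (LINT x|lborel. kill J H \<psi> x * v s x) - (LINT x|lborel. \<psi> x * v s x))
        has_integral (LINT x|lborel. \<psi> x * v t x) - (LINT x|lborel. \<psi> x * f0 x)) {0..t}"
proof -
  have ui: "integrable lebesgue (u s)" if "0 \<le> s" for s
    using sol that by (auto simp: nonlocal_solution_def L1_curve_def)
  have ul: "((\<lambda>r. LINT x|lebesgue. \<bar>u r x - u s x\<bar>) \<longlongrightarrow> 0) (at s within {0..})" if "0 \<le> s" for s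
    using sol that by (auto simp: nonlocal_solution_def L1_curve_def)
  have "\<forall>s. \<exists>g. 0 \<le> s \<longrightarrow> g \<in> borel_measurable borel \<and> (AE x in lebesgue. u s x = g x)"
    using borel_representative borel_measurable_integrable[OF ui] by metis
  then obtain v where v': "\<And>s. 0 \<le> s \<longrightarrow> v s \<in> borel_measurable borel \<and> (AE x in lebesgue. u s x = v s x)"
    by metis
  then have vm: "v s \<in> borel_measurable borel" and uv: "AE x in lebesgue. u s x = v s x" if "0 \<le> s" for s
    using that by auto
  have um: "u s \<in> borel_measurable lebesgue" if "0 \<le> s" for s using ui[OF that] by auto
  have vi: "integrable lborel (v s)" if "0 \<le> s" for s
    using integrable_representative[OF vm[OF that] uv[OF that] um[OF that]] ui[OF that] by simp
  have test_int: "(LINT x|lebesgue. \<psi> x * u s x) = (LINT x|lborel. \<psi> x * v s x)"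
    if "test_function \<psi> C" "0 \<le> s" for \<psi> C s
  proof (rule integral_representative)
    have \<psi>: "\<psi> \<in> borel_measurable borel" using that by (simp add: test_function_def)
    then show "(\<lambda>x. \<psi> x * v s x) \<in> borel_measurable borel" using vm[OF that(2)] by (rule borel_measurable_times)
    show "AE x in lebesgue. \<psi> x * u s x = \<psi> x * v s x" using uv[OF that(2)] by eventually_elim simp
    show "(\<lambda>x. \<psi> x * u s x) \<in> borel_measurable lebesgue"
      using borel_imp_lebesgue_measurable[OF \<psi>] um[OF that(2)] by (rule borel_measurable_times)
  qed
  have vH: "AE x in lborel. x \<in> H \<longrightarrow> v s x = 0" if "0 < s" for s
  proof -
    have "AE x in lebesgue. x \<in> H \<longrightarrow> u s x = 0" using sol that by (auto simp: nonlocal_solution_def)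
    moreover have "AE x in lebesgue. u s x = v s x" using uv that by simp
    ultimately have "AE x in lebesgue. x \<in> H \<longrightarrow> v s x = 0" by eventually_elim auto
    then show ?thesis by (simp add: AE_completion_iff)
  qed
  show thesis
  proof (rule that[of v])
    show "integrable lborel (v s)" if "0 \<le> s" for s using vi that .
    show "AE x in lebesgue. u s x = v s x" if "0 \<le> s" for s using uv that .
    show "AE x in lborel. x \<in> H \<longrightarrow> v s x = 0" if "0 < s" for s using vH that .
    show "((\<lambda>r. LINT x|lborel. \<bar>v r x - v s x\<bar>) \<longlongrightarrow> 0) (at s within {0..})" if s: "0 \<le> s" for s
    proof -
      have "(LINT x|lebesgue. \<bar>u r x - u s x\<bar>) = (LINT x|lborel. \<bar>v r x - v s x\<bar>)" if r: "0 \<le> r" for r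
      proof (rule integral_representative)
        show "(\<lambda>x. \<bar>v r x - v s x\<bar>) \<in> borel_measurable borel" using vm r s by (intro borel_measurable_abs borel_measurable_diff)
        show "(\<lambda>x. \<bar>u r x - u s x\<bar>) \<in> borel_measurable lebesgue" using um r s by (intro borel_measurable_abs borel_measurable_diff)
        show "AE x in lebesgue. \<bar>u r x - u s x\<bar> = \<bar>v r x - v s x\<bar>" using uv[OF r] uv[OF s] by eventually_elim simp
      qed
      then show ?thesis
        using ul[OF s] by (elim Lim_transform_eventually) (auto simp: eventually_at_filter)
    qed
    fix \<psi> C and t :: real assume \<psi>: "test_function \<psi> C" and t: "0 < t"
    have \<psi>b: "\<psi> \<in> borel_measurable borel" and \<psi>C: "\<And>x. \<bar>\<psi> x\<bar> \<le> C" and \<psi>H: "\<And>x. x \<in> H \<Longrightarrow> \<psi> x = 0"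
      using \<psi> by (auto simp: test_function_def)
    have \<psi>l: "\<psi> \<in> borel_measurable lebesgue" using \<psi>b by (rule borel_imp_lebesgue_measurable)
    obtain I where I: "has_L1_integral (\<lambda>s x. conv J (u s) x - u s x) I 0 t"
      and uI: "AE x in lebesgue. x \<in> - H \<longrightarrow> u t x = u0 x + I x"
      using sol t unfolding nonlocal_solution_def by blast
    have Ii: "integrable lebesgue I" using I by (simp add: has_L1_integral_def)
    have "((\<lambda>s. LINT x|lebesgue. \<psi> x * (conv J (u s) x - u s x)) has_integral (LINT x|lebesgue. \<psi> x * I x)) {0..t}"
      using I \<psi>l \<psi>C by (rule has_integral_L1_test)
    moreover have "(LINT x|lebesgue. \<psi> x * I x) = (LINT x|lborel. \<psi> x * v t x) - (LINT x|lborel. \<psi> x * f0 x)"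
    proof -
      have ti: "integrable lebesgue (\<lambda>x. \<psi> x * u t x)" using ui t by (intro integrable_bounded_mult[OF _ \<psi>l \<psi>C]) auto
      have f0l: "integrable lebesgue f0" using f0_integrable by (simp add: integrable_completion)
      have fi: "integrable lebesgue (\<lambda>x. \<psi> x * f0 x)" using f0l by (rule integrable_bounded_mult[OF _ \<psi>l \<psi>C])
      have "(LINT x|lebesgue. \<psi> x * I x) = (LINT x|lebesgue. \<psi> x * u t x - \<psi> x * f0 x)"
      proof (rule integral_cong_AE)
        show "AE x in lebesgue. \<psi> x * I x = \<psi> x * u t x - \<psi> x * f0 x"
          using uI u0 by eventually_elim (use \<psi>H in \<open>auto simp: algebra_simps\<close>)
      qed (use integrable_bounded_mult[OF Ii \<psi>l \<psi>C] ti fi in auto)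
      also have "\<dots> = (LINT x|lebesgue. \<psi> x * u t x) - (LINT x|lebesgue. \<psi> x * f0 x)" using ti fi by simp
      also have "(LINT x|lebesgue. \<psi> x * f0 x) = (LINT x|lborel. \<psi> x * f0 x)"
        using \<psi>b f0_integrable by (intro integral_completion) auto
      also have "(LINT x|lebesgue. \<psi> x * u t x) = (LINT x|lborel. \<psi> x * v t x)" using \<psi> t by (intro test_int) auto
      finally show ?thesis .
    qed
    moreover have "(LINT x|lborel. kill J H \<psi> x * v s x) - (LINT x|lborel. \<psi> x * v s x)
        = (LINT x|lebesgue. \<psi> x * (conv J (u s) x - u s x))" if "s \<in> {0..t} - {0}" for s
    proof -
      have s: "0 \<le> s" "0 < s" using that by auto
      have cu: "conv J (u s) x = cv J (v s) x" for x
        using vm[OF s(1)] um[OF s(1)] uv[OF s(1)] by (rule conv_eq_cv[OF J_measurable])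
      have "(LINT x|lebesgue. \<psi> x * (conv J (u s) x - u s x)) = (LINT x|lborel. \<psi> x * (cv J (v s) x - v s x))"
        unfolding cu
      proof (rule integral_representative)
        have cb: "cv J (v s) \<in> borel_measurable borel" using vm[OF s(1)] by measurable
        show "(\<lambda>x. \<psi> x * (cv J (v s) x - v s x)) \<in> borel_measurable borel"
          using \<psi>b cb vm[OF s(1)] by (intro borel_measurable_times borel_measurable_diff)
        show "(\<lambda>x. \<psi> x * (cv J (v s) x - u s x)) \<in> borel_measurable lebesgue"
          using \<psi>l borel_imp_lebesgue_measurable[OF cb] um[OF s(1)] by (intro borel_measurable_times borel_measurable_diff)
        show "AE x in lebesgue. \<psi> x * (cv J (v s) x - u s x) = \<psi> x * (cv J (v s) x - v s x)"
          using uv[OF s(1)] by eventually_elim simp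
      qed
      also have "\<dots> = (LINT x|lborel. \<psi> x * cv J (v s) x) - (LINT x|lborel. \<psi> x * v s x)"
        using test_function_integrable[OF \<psi> cv_J_integrable[OF vi[OF s(1)]]] test_function_integrable[OF \<psi> vi[OF s(1)]]
        by (simp add: right_diff_distrib)
      also have "(LINT x|lborel. \<psi> x * cv J (v s) x) = (LINT x|lborel. kill J H \<psi> x * v s x)"
        using \<psi> vi[OF s(1)] vH[OF s(2)] by (rule kill_symmetric[symmetric])
      finally show ?thesis by simp
    qed
    \<comment> \<open>The condition in \<open>H\<close> is imposed at positive times, so the two integrands may differ at time \<open>0\<close>.\<close>
    ultimately show "((\<lambda>s. (LINT x|lborel. kill J H \<psi> x * v s x) - (LINT x|lborel. \<psi> x * v s x))
        has_integral (LINT x|lborel. \<psi> x * v t x) - (LINT x|lborel. \<psi> x * f0 x)) {0..t}"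
      using has_integral_spike_finite[of "{0}" "{0..t}"] by (metis (no_types, lifting) finite.emptyI finite.insertI)
  qed
qed

end

text \<open>The integral form of the Taylor remainder of order \<open>q\<close> is at most \<open>K t^(q+1) / q!\<close>.\<close>
lemma taylor_sums_of_iterated_derivatives:
  fixes g :: "nat \<Rightarrow> real \<Rightarrow> real"
  assumes t: "0 \<le> t"
    and deriv: "\<And>n x. x \<in> {0..t} \<Longrightarrow> (g n has_vector_derivative g (Suc n) x) (at x within {0..t})"
    and bound: "\<And>n x. x \<in> {0..t} \<Longrightarrow> \<bar>g n x\<bar> \<le> K"
  shows "(\<lambda>n. t ^ n / fact n * g n 0) sums g 0 t"
proof -
  have cont: "continuous_on {0..t} (g n)" for n
    using deriv by (rule continuous_on_vector_derivative)
  let ?S = "\<lambda>q. \<Sum>i<q. t ^ i / fact i * g i 0"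
  have rem: "\<bar>g 0 t - ?S (Suc q)\<bar> \<le> t ^ q / fact q * K * t" for q
  proof -
    let ?i = "\<lambda>x. ((t - x) ^ (Suc q - 1) / fact (Suc q - 1)) *\<^sub>R g (Suc q) x"
    have "g 0 t = (\<Sum>i<Suc q. ((t - 0) ^ i / fact i) *\<^sub>R g i 0) + integral {0..t} ?i"
      by (rule Taylor_integral) (use deriv t in auto)
    moreover have "norm (integral {0..t} ?i) \<le> t ^ q / fact q * K * (t - 0)"
    proof (rule integral_bound)
      show "continuous_on {0..t} ?i" by (intro continuous_intros cont) auto
      fix x assume x: "x \<in> {0..t}"
      have "(t - x) ^ q / fact q * \<bar>g (Suc q) x\<bar> \<le> t ^ q / fact q * K"
        using x bound[OF x] by (intro mult_mono divide_right_mono power_mono) (auto intro: order_trans[OF abs_ge_zero])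
      then show "norm (?i x) \<le> t ^ q / fact q * K" using x by (simp add: abs_mult)
    qed fact
    ultimately show ?thesis by simp
  qed
  have "(\<lambda>q. t ^ q / fact q * K * t) \<longlonglongrightarrow> 0 * K * t"
    using summable_LIMSEQ_zero[OF summable_exp[of t]]
    by (intro tendsto_mult tendsto_const) (simp add: field_simps)
  then have lim: "(\<lambda>q. t ^ q / fact q * K * t) \<longlonglongrightarrow> 0" by simp
  have "eventually (\<lambda>q. norm (g 0 t - ?S (Suc q)) \<le> t ^ q / fact q * K * t) sequentially"
    unfolding real_norm_def by (intro always_eventually allI rem)
  then have "(\<lambda>q. g 0 t - ?S (Suc q)) \<longlonglongrightarrow> 0" using lim by (rule Lim_null_comparison)
  then have "(\<lambda>q. g 0 t - (g 0 t - ?S (Suc q))) \<longlonglongrightarrow> g 0 t - 0" by (intro tendsto_intros)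
  then have "(\<lambda>q. ?S (Suc q)) \<longlonglongrightarrow> g 0 t" by simp
  then show ?thesis unfolding sums_def by (rule LIMSEQ_imp_Suc)
qed

context killed_walk
begin

text \<open>The law of the killed walk after a Poisson number of steps with mean \<open>t\<close>.\<close>
definition poisson_walk :: "real \<Rightarrow> 'a \<Rightarrow> real" where
  "poisson_walk t x = exp (- t) * (\<Sum>n. t ^ n / fact n * walk n x)"

lemma summable_walk: "summable (\<lambda>n. norm (t ^ n / fact n * walk n x))"
proof (rule summable_comparison_test'[where N=0])
  show "summable (\<lambda>n. B * (inverse (fact n) * \<bar>t\<bar> ^ n))" by (intro summable_mult summable_exp)
  show "norm (norm (t ^ n / fact n * walk n x)) \<le> B * (inverse (fact n) * \<bar>t\<bar> ^ n)" for n
  proof -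
    have "\<bar>t\<bar> ^ n / fact n * \<bar>walk n x\<bar> \<le> \<bar>t\<bar> ^ n / fact n * B"
      using walk_abs_le by (intro mult_left_mono) auto
    then show ?thesis by (simp add: abs_mult power_abs divide_inverse mult_ac)
  qed
qed

lemma
  shows poisson_walk_integrable: "integrable lborel (poisson_walk t)"
    and poisson_walk_pairing: "test_function \<psi> C \<Longrightarrow>
      (\<lambda>n. t ^ n / fact n * (LINT x|lborel. \<psi> x * walk n x)) sums (exp t * (LINT x|lborel. \<psi> x * poisson_walk t x))"
proof -
  have L1: "summable (\<lambda>n. LINT x|lborel. norm (t ^ n / fact n * (\<psi> x * walk n x)))"
    and int: "integrable lborel (\<lambda>x. t ^ n / fact n * (\<psi> x * walk n x))"
    if m: "\<psi> \<in> borel_measurable borel" and b: "\<And>x. \<bar>\<psi> x\<bar> \<le> C" for \<psi> C n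
  proof -
    have i: "integrable lborel (\<lambda>x. \<psi> x * walk n x)" for n
      using walk_integrable m b by (intro integrable_bounded_mult) auto
    then show "integrable lborel (\<lambda>x. t ^ n / fact n * (\<psi> x * walk n x))" by (rule integrable_mult_right)
    have C0: "0 \<le> C" using b[of 0] by linarith
    show "summable (\<lambda>n. LINT x|lborel. norm (t ^ n / fact n * (\<psi> x * walk n x)))"
    proof (rule summable_comparison_test'[where N=0])
      show "summable (\<lambda>n. C * mass 0 * (inverse (fact n) * \<bar>t\<bar> ^ n))" by (intro summable_mult summable_exp)
      fix n
      have "(LINT x|lborel. \<bar>\<psi> x * walk n x\<bar>) \<le> (LINT x|lborel. C * walk n x)"
        using i walk_integrable walk_nonneg
        by (intro integral_mono integrable_abs integrable_mult_right) (auto simp: abs_mult intro!: mult_right_mono b)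
      also have "\<dots> \<le> C * mass 0"
        using decseqD[OF mass_decseq, of 0 n] C0 by (simp add: mass_def[symmetric] mult_left_mono)
      finally have "\<bar>t\<bar> ^ n / fact n * (LINT x|lborel. \<bar>\<psi> x * walk n x\<bar>) \<le> \<bar>t\<bar> ^ n / fact n * (C * mass 0)"
        by (rule mult_left_mono) simp
      moreover have "(LINT x|lborel. norm (t ^ n / fact n * (\<psi> x * walk n x))) = \<bar>t\<bar> ^ n / fact n * (LINT x|lborel. \<bar>\<psi> x * walk n x\<bar>)"
        by (simp add: abs_mult power_abs)
      ultimately show "norm (LINT x|lborel. norm (t ^ n / fact n * (\<psi> x * walk n x))) \<le> C * mass 0 * (inverse (fact n) * \<bar>t\<bar> ^ n)"
        by (simp add: divide_inverse mult_ac abs_mult)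
    qed
  qed
  have s: "summable (\<lambda>n. norm (t ^ n / fact n * (c * walk n x)))" for c x
    using summable_mult[OF summable_walk[of t x], of "\<bar>c\<bar>"] by (simp add: abs_mult mult_ac)
  have pull: "(\<Sum>n. t ^ n / fact n * (c * walk n x)) = c * (exp t * poisson_walk t x)" for c x
  proof -
    have "(\<Sum>n. c * (t ^ n / fact n * walk n x)) = c * (\<Sum>n. t ^ n / fact n * walk n x)"
      by (rule suminf_mult) (rule summable_norm_cancel[OF summable_walk])
    then show ?thesis by (simp add: poisson_walk_def mult_ac exp_minus)
  qed
  have "integrable lborel (\<lambda>x. \<Sum>n. t ^ n / fact n * (1 * walk n x))"
    by (rule integrable_suminf) (use L1[of "\<lambda>_. 1" 1] int[of "\<lambda>_. 1" 1] s[of 1] in auto)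
  then have "integrable lborel (\<lambda>x. exp t * poisson_walk t x)" unfolding pull by simp
  then show "integrable lborel (poisson_walk t)" by simp
  assume "test_function \<psi> C"
  then have \<psi>: "\<psi> \<in> borel_measurable borel" "\<And>x. \<bar>\<psi> x\<bar> \<le> C" by (auto simp: test_function_def)
  have "(\<lambda>n. LINT x|lborel. t ^ n / fact n * (\<psi> x * walk n x)) sums (LINT x|lborel. (\<Sum>n. t ^ n / fact n * (\<psi> x * walk n x)))"
    by (rule sums_integral) (use L1[OF \<psi>] int[OF \<psi>] s in auto)
  moreover have "(LINT x|lborel. \<psi> x * (exp t * poisson_walk t x)) = exp t * (LINT x|lborel. \<psi> x * poisson_walk t x)"
    by (simp add: mult.left_commute)
  ultimately show "(\<lambda>n. t ^ n / fact n * (LINT x|lborel. \<psi> x * walk n x)) sums (exp t * (LINT x|lborel. \<psi> x * poisson_walk t x))"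
    unfolding pull by simp
qed

text \<open>Let \<open>m\<^sub>n(s)\<close> be the pairing of \<open>u(s)\<close> with the \<open>n\<close>-th iterate of a test function \<open>\<psi>\<close>. The weak
  formulation is \<open>m\<^sub>n' = m\<^sub>n\<^sub>+\<^sub>1 - m\<^sub>n\<close>, so the functions \<open>exp(s) m\<^sub>n(s)\<close> are successive derivatives of each other. Since
  they are uniformly bounded, the first one is the sum of its Taylor series, whose coefficients are the
  pairings of \<open>\<psi>\<close> with the killed walk. As \<open>\<psi>\<close> is arbitrary, this determines \<open>u(t)\<close> outside \<open>H\<close>.\<close>
theorem nonlocal_solution_poisson_walk:
  assumes sol: "nonlocal_solution J H u0 u" and u0: "AE x in lebesgue. u0 x = f0 x" and t: "0 < t"
  shows "AE x in lebesgue. u t x = poisson_walk t x"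
proof -
  obtain v where vi: "\<And>s. 0 \<le> s \<Longrightarrow> integrable lborel (v s)" and uv: "\<And>s. 0 \<le> s \<Longrightarrow> AE x in lebesgue. u s x = v s x"
    and vlim: "\<And>s. 0 \<le> s \<Longrightarrow> ((\<lambda>r. LINT x|lborel. \<bar>v r x - v s x\<bar>) \<longlongrightarrow> 0) (at s within {0..})"
    and vH: "\<And>s. 0 < s \<Longrightarrow> AE x in lborel. x \<in> H \<longrightarrow> v s x = 0"
    and weak: "\<And>\<psi> C t. test_function \<psi> C \<Longrightarrow> 0 < t \<Longrightarrow>
      ((\<lambda>s. (LINT x|lborel. kill J H \<psi> x * v s x) - (LINT x|lborel. \<psi> x * v s x))
        has_integral (LINT x|lborel. \<psi> x * v t x) - (LINT x|lborel. \<psi> x * f0 x)) {0..t}"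
    by (rule weak_formulation[OF sol u0]) blast
  have cont: "continuous_on {0..} F"
    if F: "\<And>r s. 0 \<le> r \<Longrightarrow> 0 \<le> s \<Longrightarrow> \<bar>F r - F s\<bar> \<le> C * (LINT x|lborel. \<bar>v r x - v s x\<bar>)" for F :: "real \<Rightarrow> real" and C
    unfolding continuous_on_def
  proof
    fix s :: real assume "s \<in> {0..}"
    then have s: "0 \<le> s" by simp
    have "((\<lambda>r. C * (LINT x|lborel. \<bar>v r x - v s x\<bar>)) \<longlongrightarrow> C * 0) (at s within {0..})"
      by (intro tendsto_intros vlim s)
    then have lim: "((\<lambda>r. C * (LINT x|lborel. \<bar>v r x - v s x\<bar>)) \<longlongrightarrow> 0) (at s within {0..})" by simp
    have "eventually (\<lambda>r. r \<in> {0..}) (at s within {0..})" by (simp add: eventually_at_filter)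
    then have "eventually (\<lambda>r. norm (F r - F s) \<le> C * (LINT x|lborel. \<bar>v r x - v s x\<bar>)) (at s within {0..})"
      by (rule eventually_mono) (simp add: F[OF _ s])
    then have "((\<lambda>r. F r - F s) \<longlongrightarrow> 0) (at s within {0..})" using lim by (rule Lim_null_comparison)
    then show "(F \<longlongrightarrow> F s) (at s within {0..})" by (simp add: Lim_null[symmetric])
  qed
  have diff_i: "integrable lborel (\<lambda>x. v r x - v s x)" if "0 \<le> r" "0 \<le> s" for r s
    using vi that by simp
  have cont_pair: "continuous_on {0..} (\<lambda>s. LINT x|lborel. \<psi> x * v s x)" if \<psi>: "test_function \<psi> C" for \<psi> C
  proof (rule cont[where C=C])
    fix r s :: real assume rs: "0 \<le> r" "0 \<le> s"
    have "(LINT x|lborel. \<psi> x * v r x) - (LINT x|lborel. \<psi> x * v s x) = (LINT x|lborel. \<psi> x * (v r x - v s x))"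
      using test_function_integrable[OF \<psi> vi[OF rs(1)]] test_function_integrable[OF \<psi> vi[OF rs(2)]]
      by (simp add: right_diff_distrib)
    also have "\<bar>\<dots>\<bar> \<le> (LINT x|lborel. \<bar>\<psi> x * (v r x - v s x)\<bar>)" by (rule integral_abs_bound)
    also have "\<dots> \<le> (LINT x|lborel. C * \<bar>v r x - v s x\<bar>)"
      using test_function_integrable[OF \<psi> diff_i[OF rs]] diff_i[OF rs] \<psi>
      by (intro integral_mono integrable_abs integrable_mult_right)
         (auto simp: abs_mult test_function_def intro!: mult_right_mono)
    finally show "\<bar>(LINT x|lborel. \<psi> x * v r x) - (LINT x|lborel. \<psi> x * v s x)\<bar> \<le> C * (LINT x|lborel. \<bar>v r x - v s x\<bar>)"
      by simp
  qed
  have cont_norm: "continuous_on {0..} (\<lambda>s. LINT x|lborel. \<bar>v s x\<bar>)"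
  proof (rule cont[where C=1])
    fix r s :: real assume rs: "0 \<le> r" "0 \<le> s"
    have "(LINT x|lborel. \<bar>v r x\<bar>) - (LINT x|lborel. \<bar>v s x\<bar>) = (LINT x|lborel. \<bar>v r x\<bar> - \<bar>v s x\<bar>)"
      using vi rs by simp
    also have "\<bar>\<dots>\<bar> \<le> (LINT x|lborel. \<bar>\<bar>v r x\<bar> - \<bar>v s x\<bar>\<bar>)" by (rule integral_abs_bound)
    also have "\<dots> \<le> (LINT x|lborel. \<bar>v r x - v s x\<bar>)"
      using vi rs diff_i[OF rs] by (intro integral_mono integrable_abs Bochner_Integration.integrable_diff) auto
    finally show "\<bar>(LINT x|lborel. \<bar>v r x\<bar>) - (LINT x|lborel. \<bar>v s x\<bar>)\<bar> \<le> 1 * (LINT x|lborel. \<bar>v r x - v s x\<bar>)"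
      by simp
  qed
  have "compact ((\<lambda>s. LINT x|lborel. \<bar>v s x\<bar>) ` {0..t})"
    by (intro compact_continuous_image continuous_on_subset[OF cont_norm]) auto
  then obtain D where D: "\<And>s. s \<in> {0..t} \<Longrightarrow> (LINT x|lborel. \<bar>v s x\<bar>) \<le> D"
    using bounded_imp_bdd_above[OF compact_imp_bounded] unfolding bdd_above_def by (metis imageI)
  have "0 \<le> (LINT x|lborel. \<bar>v 0 x\<bar>)" by (intro Bochner_Integration.integral_nonneg) auto
  from order_trans[OF this D[of 0]] t have D0: "0 \<le> D" by simp
  have deriv: "((\<lambda>s. LINT x|lborel. \<psi> x * v s x) has_vector_derivative
      (LINT x|lborel. kill J H \<psi> x * v s x) - (LINT x|lborel. \<psi> x * v s x)) (at s within {0..t})"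
    and initial: "(LINT x|lborel. \<psi> x * v 0 x) = (LINT x|lborel. \<psi> x * f0 x)"
    if \<psi>: "test_function \<psi> C" and s: "s \<in> {0..t}" for \<psi> C s
  proof -
    define m where "m s = (LINT x|lborel. \<psi> x * v s x)" for s
    define k where "k s = (LINT x|lborel. kill J H \<psi> x * v s x) - m s" for s
    define F where "F s = (LINT x|lborel. \<psi> x * f0 x) + integral {0..s} k" for s
    have kc: "continuous_on {0..t} k"
      unfolding k_def m_def
      by (intro continuous_intros continuous_on_subset[OF cont_pair[OF \<psi>]]
          continuous_on_subset[OF cont_pair[OF test_function_kill[OF \<psi>]]]) auto
    have Fd: "(F has_vector_derivative k s) (at s within {0..t})" if "s \<in> {0..t}" for s
      unfolding F_def using has_vector_derivative_add[OF has_vector_derivative_const integral_has_vector_derivative[OF kc that]] by simp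
    have mF: "m s = F s" if "0 < s" for s
      using integral_unique[OF weak[OF \<psi> that]] by (simp add: F_def m_def k_def[abs_def])
    have Fc: "continuous_on {0..t} F" using Fd by (intro continuous_on_vector_derivative) auto
    have mc: "continuous_on {0..t} m" unfolding m_def by (intro continuous_on_subset[OF cont_pair[OF \<psi>]]) auto
    \<comment> \<open>The weak formulation determines the pairing for positive times; its value at time \<open>0\<close> follows by
      continuity along the sequence \<open>r\<close>.\<close>
    define r where "r j = t / real (Suc j)" for j
    have r: "r j \<in> {0..t}" "0 < r j" for j using t by (auto simp: r_def field_simps)
    have r0: "r \<longlonglongrightarrow> 0" unfolding r_def by real_asymp
    have "(\<lambda>j. m (r j)) \<longlonglongrightarrow> m 0" by (rule continuous_on_tendsto_compose[OF mc r0]) (use r t in auto)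
    moreover have "(\<lambda>j. F (r j)) \<longlonglongrightarrow> F 0" by (rule continuous_on_tendsto_compose[OF Fc r0]) (use r t in auto)
    ultimately have m0: "m 0 = F 0" using mF[OF r(2)] LIMSEQ_unique by simp
    then show "(LINT x|lborel. \<psi> x * v 0 x) = (LINT x|lborel. \<psi> x * f0 x)" by (simp add: m_def F_def)
    have "m s' = F s'" if "s' \<in> {0..t}" for s' using m0 mF[of s'] that by (cases "s' = 0") auto
    then have "(m has_vector_derivative k s) (at s within {0..t})"
      using Fd[OF s] s by (intro has_vector_derivative_transform[OF s _ Fd[OF s]]) auto
    then show "((\<lambda>s. LINT x|lborel. \<psi> x * v s x) has_vector_derivative
      (LINT x|lborel. kill J H \<psi> x * v s x) - (LINT x|lborel. \<psi> x * v s x)) (at s within {0..t})"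
      unfolding k_def m_def .
  qed
  have pairing: "(LINT x|lborel. \<psi> x * v t x) = (LINT x|lborel. \<psi> x * poisson_walk t x)" if \<psi>: "test_function \<psi> C" for \<psi> C
  proof -
    define g where "g n s = exp s * (LINT x|lborel. (kill J H ^^ n) \<psi> x * v s x)" for n s
    have C0: "0 \<le> C" using \<psi> by (auto simp: test_function_def intro: order_trans[OF abs_ge_zero])
    have "(\<lambda>n. t ^ n / fact n * g n 0) sums g 0 t"
    proof (rule taylor_sums_of_iterated_derivatives[where K="exp t * (C * D)"])
      show "0 \<le> t" using t by simp
      fix n and s :: real assume s: "s \<in> {0..t}"
      have "(exp has_vector_derivative exp s) (at s within {0..t})"
        using has_vector_derivative_at_within[OF DERIV_exp[of s, unfolded has_real_derivative_iff_has_vector_derivative]] .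
      from has_vector_derivative_mult[OF this deriv[OF test_function_funpow[OF \<psi>, of n] s]]
      show "(g n has_vector_derivative g (Suc n) s) (at s within {0..t})"
        unfolding g_def by (simp add: algebra_simps)
      have tf: "test_function ((kill J H ^^ n) \<psi>) C" using \<psi> by (rule test_function_funpow)
      have s0: "0 \<le> s" using s by simp
      have "\<bar>LINT x|lborel. (kill J H ^^ n) \<psi> x * v s x\<bar> \<le> (LINT x|lborel. \<bar>(kill J H ^^ n) \<psi> x * v s x\<bar>)"
        by (rule integral_abs_bound)
      also have "\<dots> \<le> (LINT x|lborel. C * \<bar>v s x\<bar>)"
        using test_function_integrable[OF tf vi[OF s0]] vi[OF s0] tf
        by (intro integral_mono integrable_abs integrable_mult_right)
           (auto simp: abs_mult test_function_def intro!: mult_right_mono)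
      also have "\<dots> \<le> C * D" using D[OF s] C0 by (simp add: mult_left_mono)
      finally have "\<bar>LINT x|lborel. (kill J H ^^ n) \<psi> x * v s x\<bar> \<le> C * D" .
      then have "exp s * \<bar>LINT x|lborel. (kill J H ^^ n) \<psi> x * v s x\<bar> \<le> exp t * (C * D)"
        using s C0 D0 by (intro mult_mono) auto
      then show "\<bar>g n s\<bar> \<le> exp t * (C * D)" by (simp add: g_def abs_mult)
    qed
    moreover have "g n 0 = (LINT x|lborel. \<psi> x * walk n x)" for n
      using initial[OF test_function_funpow[OF \<psi>, of n], of 0] t dual_walk[OF \<psi>, of n] by (simp add: g_def)
    ultimately have "(\<lambda>n. t ^ n / fact n * (LINT x|lborel. \<psi> x * walk n x)) sums (exp t * (LINT x|lborel. \<psi> x * v t x))"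
      by (simp add: g_def)
    then show ?thesis using sums_unique2[OF _ poisson_walk_pairing[OF \<psi>]] by fastforce
  qed
  have t0: "0 \<le> t" using t by simp
  have vt [measurable]: "v t \<in> borel_measurable borel" using vi[OF t0] by auto
  have pw [measurable]: "poisson_walk t \<in> borel_measurable borel" using poisson_walk_integrable by auto
  define d where "d x = v t x - poisson_walk t x" for x
  have di: "integrable lborel d" unfolding d_def using vi[OF t0] poisson_walk_integrable by simp
  \<comment> \<open>This test function turns the pairing with \<open>d\<close> into the \<open>L\<^sup>1\<close> norm of \<open>d\<close> outside \<open>H\<close>.\<close>
  define \<psi> where "\<psi> x = indicator (- H) x * sgn (d x)" for x
  have dm [measurable]: "d \<in> borel_measurable borel" using di by auto
  have \<psi>: "test_function \<psi> 1"
    unfolding test_function_def \<psi>_def by (auto simp: indicator_def sgn_if)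
  have "(LINT x|lborel. \<psi> x * d x) = 0"
    using pairing[OF \<psi>] test_function_integrable[OF \<psi> vi[OF t0]] test_function_integrable[OF \<psi> poisson_walk_integrable[of t]]
    by (simp add: d_def right_diff_distrib)
  moreover have "\<psi> x * d x = indicator (- H) x * \<bar>d x\<bar>" for x by (simp add: \<psi>_def abs_sgn mult_ac)
  ultimately have "(LINT x|lborel. indicator (- H) x * \<bar>d x\<bar>) = 0" by simp
  moreover have "integrable lborel (\<lambda>x. indicator (- H) x * \<bar>d x\<bar>)"
    using test_function_integrable[OF \<psi> di] by (simp add: \<psi>_def abs_sgn mult_ac)
  ultimately have ae: "AE x in lborel. indicator (- H) x * \<bar>d x\<bar> = 0"
    by (subst (asm) integral_nonneg_eq_0_iff_AE) auto
  have pw0: "poisson_walk t x = 0" if "x \<in> H" for x using walk_H[OF that] by (simp add: poisson_walk_def)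
  have "AE x in lborel. v t x = poisson_walk t x"
    using ae vH[OF t] by eventually_elim (use pw0 in \<open>auto simp: d_def indicator_def split: if_splits\<close>)
  then have "AE x in lebesgue. v t x = poisson_walk t x" by (rule AE_completion)
  then show ?thesis using uv[OF t0] by eventually_elim simp
qed

end

section \<open>Poisson averaging\<close>

lemma abs_le_of_sums:
  fixes f g :: "nat \<Rightarrow> real"
  assumes f: "f sums a" and g: "g sums b" and le: "\<And>n. \<bar>f n\<bar> \<le> g n"
  shows "\<bar>a\<bar> \<le> b"
proof -
  have "a \<le> b" by (rule sums_le[OF _ f g]) (rule order_trans[OF abs_ge_self le])
  moreover have "- a \<le> b" by (rule sums_le[OF _ sums_minus[OF f] g]) (rule order_trans[OF abs_ge_minus_self le])
  ultimately show ?thesis by simp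
qed

text \<open>The Chernoff bound: the indicator of \<open>|n - t| > \<eta> t\<close> is dominated by the sum of the two exponentials
  \<open>exp (\<plusminus>l (n - t) - l \<eta> t)\<close>, whose Poisson averages are explicit. The exponent \<open>l\<^sup>2 - l \<eta>\<close> that results is
  minimal for \<open>l = \<eta>/2\<close>.\<close>
lemma poisson_average_bound:
  fixes a :: "nat \<Rightarrow> real" and t :: real
  assumes \<eta>: "0 < \<eta>" "\<eta> \<le> 1" and t: "0 < t" and A: "0 \<le> A" and D: "0 \<le> D"
    and near: "\<And>n. \<bar>real n - t\<bar> \<le> \<eta> * t \<Longrightarrow> \<bar>a n\<bar> \<le> A" and far: "\<And>n. \<bar>a n\<bar> \<le> D"
    and sums: "(\<lambda>n. t ^ n / fact n * a n) sums (exp t * b)"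
  shows "\<bar>b\<bar> \<le> A + 2 * D * exp (- (\<eta>\<^sup>2 / 4 * t))"
proof -
  define l where "l = \<eta> / 2"
  have l: "0 < l" "l \<le> 1" using \<eta> by (auto simp: l_def)
  let ?w = "\<lambda>c n. exp (c * (real n - t) - l * \<eta> * t)"
  have w_sums: "(\<lambda>n. t ^ n / fact n * ?w c n) sums (exp t * exp (t * (exp c - 1 - c - l * \<eta>)))" for c
  proof -
    have "(\<lambda>n. (t * exp c) ^ n /\<^sub>R fact n * exp (- c * t - l * \<eta> * t)) sums (exp (t * exp c) * exp (- c * t - l * \<eta> * t))"
      by (intro sums_mult2 exp_converges)
    moreover have "(t * exp c) ^ n /\<^sub>R fact n * exp (- c * t - l * \<eta> * t) = t ^ n / fact n * ?w c n" for n
    proof -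
      have "exp c ^ n * exp (- c * t - l * \<eta> * t) = ?w c n"
        unfolding exp_of_nat_mult[symmetric] exp_add[symmetric] by (simp add: algebra_simps)
      then have "t ^ n / fact n * (exp c ^ n * exp (- c * t - l * \<eta> * t)) = t ^ n / fact n * ?w c n" by simp
      then show ?thesis by (simp add: power_mult_distrib divide_inverse mult_ac)
    qed
    moreover have "exp (t * exp c) * exp (- c * t - l * \<eta> * t) = exp t * exp (t * (exp c - 1 - c - l * \<eta>))"
      unfolding exp_add[symmetric] by (simp add: algebra_simps)
    ultimately show ?thesis by simp
  qed
  have w_le: "exp (t * (exp c - 1 - c - l * \<eta>)) \<le> exp (- (\<eta>\<^sup>2 / 4 * t))" if "exp c - 1 - c \<le> l\<^sup>2" for c
  proof -
    have "exp c - 1 - c - l * \<eta> \<le> - (\<eta>\<^sup>2 / 4)" using that by (simp add: l_def power2_eq_square)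
    then have "t * (exp c - 1 - c - l * \<eta>) \<le> t * (- (\<eta>\<^sup>2 / 4))" using t by (intro mult_left_mono) auto
    then show ?thesis by (simp add: mult.commute)
  qed
  have c1: "exp l - 1 - l \<le> l\<^sup>2" using exp_bound[of l] l by simp
  have c2: "exp (- l) - 1 - (- l) \<le> l\<^sup>2" using exp_minus_le_quadratic[of l] l zero_le_power2[of l] by linarith
  have "\<bar>exp t * b\<bar> \<le> A * exp t + D * (exp t * exp (t * (exp l - 1 - l - l * \<eta>)) + exp t * exp (t * (exp (- l) - 1 - (- l) - l * \<eta>)))"
  proof (rule abs_le_of_sums[OF sums])
    have "(\<lambda>n. t ^ n / fact n) sums exp t" using exp_converges[of t] by (simp add: divide_inverse mult.commute)
    then show "(\<lambda>n. A * (t ^ n / fact n) + D * (t ^ n / fact n * ?w l n + t ^ n / fact n * ?w (- l) n)) sums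
      (A * exp t + D * (exp t * exp (t * (exp l - 1 - l - l * \<eta>)) + exp t * exp (t * (exp (- l) - 1 - (- l) - l * \<eta>))))"
      by (intro sums_add sums_mult w_sums)
    fix n
    have "\<bar>a n\<bar> \<le> A + D * (?w l n + ?w (- l) n)"
    proof (cases "\<bar>real n - t\<bar> \<le> \<eta> * t")
      case True
      have "0 \<le> D * (?w l n + ?w (- l) n)" using D by (intro mult_nonneg_nonneg add_nonneg_nonneg) auto
      then show ?thesis using near[OF True] by linarith
    next
      case False
      have one: "1 \<le> ?w l n + ?w (- l) n"
      proof (cases "0 \<le> real n - t")
        case True
        then have "l * (\<eta> * t) \<le> l * (real n - t)" using False l by (intro mult_left_mono) auto
        then have "1 \<le> ?w l n" by (simp add: mult.assoc)
        moreover have "0 \<le> ?w (- l) n" by simp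
        ultimately show ?thesis by linarith
      next
        case neg: False
        then have "l * (\<eta> * t) \<le> l * (- (real n - t))" using False l by (intro mult_left_mono) auto
        then have "0 \<le> - l * (real n - t) - l * \<eta> * t" by (simp add: algebra_simps)
        then have "1 \<le> ?w (- l) n" by (simp only: one_le_exp_iff)
        moreover have "0 \<le> ?w l n" by simp
        ultimately show ?thesis by linarith
      qed
      have "D * 1 \<le> D * (?w l n + ?w (- l) n)" using one D by (rule mult_left_mono)
      then show ?thesis using far[of n] A by linarith
    qed
    then have "t ^ n / fact n * \<bar>a n\<bar> \<le> t ^ n / fact n * (A + D * (?w l n + ?w (- l) n))"
      using t by (intro mult_left_mono) auto
    moreover have "\<bar>t ^ n / fact n * a n\<bar> = t ^ n / fact n * \<bar>a n\<bar>" using t by (simp add: abs_mult)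
    ultimately show "\<bar>t ^ n / fact n * a n\<bar> \<le> A * (t ^ n / fact n) + D * (t ^ n / fact n * ?w l n + t ^ n / fact n * ?w (- l) n)"
      by (simp only: distrib_left mult_ac)
  qed
  also have "\<dots> = exp t * (A + D * (exp (t * (exp l - 1 - l - l * \<eta>)) + exp (t * (exp (- l) - 1 - (- l) - l * \<eta>))))"
    by (simp only: distrib_left mult_ac)
  also have "\<dots> \<le> exp t * (A + D * (exp (- (\<eta>\<^sup>2 / 4 * t)) + exp (- (\<eta>\<^sup>2 / 4 * t))))"
    by (intro mult_left_mono add_left_mono add_mono w_le c1 c2 D) auto
  finally have "exp t * \<bar>b\<bar> \<le> exp t * (A + 2 * D * exp (- (\<eta>\<^sup>2 / 4 * t)))" by (simp add: abs_mult mult_ac)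
  then show ?thesis by simp
qed

context killed_walk_stationary
begin

text \<open>For step numbers with \<open>|n - t| \<le> \<eta> t\<close> the asymptotics of the walk apply with \<open>\<delta>/2\<close> in place of \<open>\<delta>\<close>, and
  replacing \<open>n\<close> by \<open>t\<close> costs little for small \<open>\<eta>\<close>. The remaining step numbers have exponentially small
  probability, which beats the factor \<open>t^(N/2)\<close>.\<close>
theorem poisson_walk_asymptotics:
  assumes \<delta>: "0 < \<delta>" and eps: "0 < \<epsilon>"
  obtains t0 where "0 < t0" "\<And>t x. t0 \<le> t \<Longrightarrow> \<delta> * t \<le> (norm x)\<^sup>2 \<Longrightarrow>
    \<bar>t powr (real DIM('a) / 2) * poisson_walk t x - M * profile x t\<bar> \<le> \<epsilon>"
proof -
  let ?d = "real DIM('a) / 2"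
  obtain C where C: "0 < C" "\<And>n x. 0 < n \<Longrightarrow> walk n x \<le> C * real n powr (- ?d)"
    by (rule walk_decay) blast
  obtain n0 where n0: "0 < n0" "\<And>n x. n0 \<le> n \<Longrightarrow> \<delta> / 2 * real n \<le> (norm x)\<^sup>2 \<Longrightarrow>
    \<bar>real n powr ?d * walk n x - M * profile x (real n)\<bar> \<le> \<epsilon> / 6"
    by (rule walk_asymptotics[of "\<delta> / 2" "\<epsilon> / 6"]) (use \<delta> eps in auto)
  have "isCont (\<lambda>r::real. r powr ?d) 1" by (intro continuous_intros) auto
  moreover have "0 < \<epsilon> / (6 * C)" using eps C by simp
  ultimately obtain \<kappa> where \<kappa>: "0 < \<kappa>" "\<And>r. \<bar>r - 1\<bar> < \<kappa> \<Longrightarrow> \<bar>r powr ?d - 1\<bar> < \<epsilon> / (6 * C)"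
    unfolding continuous_at_eps_delta by (auto simp: dist_real_def)
  \<comment> \<open>\<open>\<kappa>/3\<close> controls the factor \<open>(t/n)^(N/2)\<close>, the last bound the change of the profile.\<close>
  define \<eta> where "\<eta> = min (1 / 2) (min (\<kappa> / 3) (\<epsilon> / (12 * (M * gamma + 1))))"
  have Mg: "0 \<le> M * gamma" using M_nonneg gamma_pos by simp
  have \<eta>: "0 < \<eta>" "\<eta> \<le> 1 / 2" "2 * \<eta> < \<kappa>" "M * gamma * (2 * \<eta>) \<le> \<epsilon> / 6"
  proof -
    show "0 < \<eta>" using \<kappa>(1) eps Mg by (simp add: \<eta>_def)
    show "\<eta> \<le> 1 / 2" unfolding \<eta>_def by (rule min.cobounded1)
    have "\<eta> \<le> \<kappa> / 3" unfolding \<eta>_def by (rule min.coboundedI2) (rule min.cobounded1)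
    then show "2 * \<eta> < \<kappa>" using \<kappa>(1) by linarith
    have "\<eta> \<le> \<epsilon> / (12 * (M * gamma + 1))" unfolding \<eta>_def by (rule min.coboundedI2) (rule min.cobounded2)
    then have "(M * gamma + 1) * \<eta> \<le> (M * gamma + 1) * (\<epsilon> / (12 * (M * gamma + 1)))" using Mg by (intro mult_left_mono) auto
    also have "\<dots> = \<epsilon> / 12" using Mg by (simp add: divide_simps)
    finally have "M * gamma * \<eta> + \<eta> \<le> \<epsilon> / 12" by (simp add: distrib_right)
    then show "M * gamma * (2 * \<eta>) \<le> \<epsilon> / 6" using \<open>0 < \<eta>\<close> by simp
  qed
  define c where "c = \<eta>\<^sup>2 / 4"
  have c: "0 < c" using \<eta> by (simp add: c_def)
  have "((\<lambda>t::real. t powr ?d * exp (- (c * t))) \<longlongrightarrow> 0) at_top" "((\<lambda>t::real. exp (- (c * t))) \<longlongrightarrow> 0) at_top"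
    using c by real_asymp+
  then have "((\<lambda>t. 2 * B * (t powr ?d * exp (- (c * t))) + 2 * (M * gamma) * exp (- (c * t))) \<longlongrightarrow> 2 * B * 0 + 2 * (M * gamma) * 0) at_top"
    by (intro tendsto_intros)
  then have "((\<lambda>t. 2 * (t powr ?d * B + M * gamma) * exp (- (\<eta>\<^sup>2 / 4 * t))) \<longlongrightarrow> 0) at_top"
    by (simp add: c_def algebra_simps)
  then have "eventually (\<lambda>t. 2 * (t powr ?d * B + M * gamma) * exp (- (\<eta>\<^sup>2 / 4 * t)) < \<epsilon> / 2) at_top"
    using eps by (intro order_tendstoD) auto
  then obtain t1 where t1: "\<And>t. t1 \<le> t \<Longrightarrow> 2 * (t powr ?d * B + M * gamma) * exp (- (\<eta>\<^sup>2 / 4 * t)) < \<epsilon> / 2"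
    by (auto simp: eventually_at_top_linorder)
  show thesis
  proof
    show "0 < max t1 (2 * real n0)" using n0 by simp
    fix t and x :: 'a assume t: "max t1 (2 * real n0) \<le> t" and x: "\<delta> * t \<le> (norm x)\<^sup>2"
    have t0: "0 < t" using t n0(1) by linarith
    have "\<bar>t powr ?d * poisson_walk t x - M * profile x t\<bar>
        \<le> \<epsilon> / 2 + 2 * (t powr ?d * B + M * gamma) * exp (- (\<eta>\<^sup>2 / 4 * t))"
    proof (rule poisson_average_bound[where a="\<lambda>n. t powr ?d * walk n x - M * profile x t"])
      show "0 < \<eta>" "\<eta> \<le> 1" "0 < t" "0 \<le> \<epsilon> / 2" using \<eta> t0 eps by auto
      show "0 \<le> t powr ?d * B + M * gamma" using B_nonneg Mg by simp
      fix n
      have "0 \<le> t powr ?d * walk n x" "t powr ?d * walk n x \<le> t powr ?d * B"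
        using walk_nonneg walk_le by (auto intro: mult_left_mono)
      moreover have "0 \<le> M * profile x t" "M * profile x t \<le> M * gamma"
        using M_nonneg profile_nonneg profile_le[OF t0] by (auto intro: mult_left_mono)
      ultimately show "\<bar>t powr ?d * walk n x - M * profile x t\<bar> \<le> t powr ?d * B + M * gamma" by linarith
      assume near: "\<bar>real n - t\<bar> \<le> \<eta> * t"
      have "\<eta> * t \<le> 1 / 2 * t" using \<eta> t0 by (intro mult_right_mono) auto
      then have n: "t / 2 \<le> real n" "real n \<le> 2 * t" using near by linarith+
      have np: "0 < real n" using n t0 by linarith
      have "n0 \<le> n" using n t by linarith
      have "\<delta> / 2 * real n \<le> \<delta> / 2 * (2 * t)" using n \<delta> by (intro mult_left_mono) auto
      then have "\<delta> / 2 * real n \<le> (norm x)\<^sup>2" using x by simp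
      then have 1: "\<bar>real n powr ?d * walk n x - M * profile x (real n)\<bar> \<le> \<epsilon> / 6" using n0(2) \<open>n0 \<le> n\<close> by blast
      have ratio: "\<bar>t - real n\<bar> / s \<le> 2 * \<eta>" if "t / 2 \<le> s" for s
      proof -
        have "\<bar>t - real n\<bar> \<le> \<eta> * t" using near by linarith
        also have "\<dots> = 2 * \<eta> * (t / 2)" by simp
        also have "\<dots> \<le> 2 * \<eta> * s" using that \<eta> by (intro mult_left_mono) auto
        finally show ?thesis using that t0 by (simp add: pos_divide_le_eq)
      qed
      have 2: "\<bar>t powr ?d * walk n x - real n powr ?d * walk n x\<bar> \<le> \<epsilon> / 6"
      proof -
        have "t / real n - 1 = (t - real n) / real n" using np by (simp add: field_simps)
        then have "\<bar>t / real n - 1\<bar> = \<bar>t - real n\<bar> / real n" by simp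
        then have "\<bar>t / real n - 1\<bar> < \<kappa>" using ratio[OF n(1)] \<eta>(3) by linarith
        then have r: "\<bar>(t / real n) powr ?d - 1\<bar> \<le> \<epsilon> / (6 * C)" by (intro less_imp_le \<kappa>(2))
        have w: "real n powr ?d * walk n x \<le> C"
        proof -
          have "real n powr ?d * walk n x \<le> real n powr ?d * (C * real n powr (- ?d))"
            using C(2)[of n x] np by (intro mult_left_mono) auto
          also have "\<dots> = C * (real n powr ?d * real n powr (- ?d))" by (rule mult.left_commute)
          also have "real n powr ?d * real n powr (- ?d) = 1" using np by (simp add: powr_add[symmetric])
          finally show ?thesis by simp
        qed
        have "t powr ?d = (t / real n) powr ?d * real n powr ?d" using np by (simp add: powr_divide)
        then have "t powr ?d * walk n x - real n powr ?d * walk n x = ((t / real n) powr ?d - 1) * (real n powr ?d * walk n x)"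
          by (simp add: algebra_simps)
        then have "\<bar>t powr ?d * walk n x - real n powr ?d * walk n x\<bar> = \<bar>(t / real n) powr ?d - 1\<bar> * (real n powr ?d * walk n x)"
          using walk_nonneg by (simp add: abs_mult)
        also have "\<dots> \<le> \<epsilon> / (6 * C) * C"
          using r w walk_nonneg eps C by (intro mult_mono) auto
        also have "\<dots> = \<epsilon> / 6" using C by simp
        finally show ?thesis .
      qed
      have 3: "\<bar>M * profile x (real n) - M * profile x t\<bar> \<le> \<epsilon> / 6"
      proof -
        have "\<bar>profile x (real n) - profile x t\<bar> \<le> gamma * (2 * \<eta>)"
        proof (cases "real n \<le> t")
          case True
          have "\<bar>profile x (real n) - profile x t\<bar> \<le> gamma * ((t - real n) / real n)"
            using np True by (rule profile_time)
          also have "\<dots> \<le> gamma * (2 * \<eta>)" using ratio[OF n(1)] True gamma_pos by (intro mult_left_mono) auto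
          finally show ?thesis .
        next
          case False
          have "\<bar>profile x t - profile x (real n)\<bar> \<le> gamma * ((real n - t) / t)"
            using t0 False by (intro profile_time) auto
          also have "\<dots> \<le> gamma * (2 * \<eta>)" using ratio[of t] t0 False gamma_pos by (intro mult_left_mono) auto
          finally show ?thesis by (simp add: abs_minus_commute)
        qed
        then have "M * \<bar>profile x (real n) - profile x t\<bar> \<le> M * (gamma * (2 * \<eta>))" using M_nonneg by (rule mult_left_mono)
        also have "\<dots> \<le> \<epsilon> / 6" using \<eta>(4) by (simp add: mult.assoc)
        finally show ?thesis using M_nonneg by (simp add: right_diff_distrib[symmetric] abs_mult)
      qed
      show "\<bar>t powr ?d * walk n x - M * profile x t\<bar> \<le> \<epsilon> / 2" using 1 2 3 by linarith
    next
      have "(\<lambda>n. t ^ n / fact n * walk n x) sums (exp t * poisson_walk t x)"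
      proof -
        have "exp t * poisson_walk t x = (\<Sum>n. t ^ n / fact n * walk n x)"
          unfolding poisson_walk_def mult.assoc[symmetric] exp_add[symmetric] by simp
        then show ?thesis using summable_sums[OF summable_norm_cancel[OF summable_walk[of t x]]] by simp
      qed
      moreover have "(\<lambda>n. t ^ n / fact n) sums exp t" using exp_converges[of t] by (simp add: divide_inverse mult.commute)
      ultimately have "(\<lambda>n. t powr ?d * (t ^ n / fact n * walk n x) - M * profile x t * (t ^ n / fact n)) sums
        (t powr ?d * (exp t * poisson_walk t x) - M * profile x t * exp t)"
        by (intro sums_diff sums_mult)
      then show "(\<lambda>n. t ^ n / fact n * (t powr ?d * walk n x - M * profile x t)) sums
        (exp t * (t powr ?d * poisson_walk t x - M * profile x t))"
        by (simp only: right_diff_distrib mult_ac)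
    qed
    then show "\<bar>t powr ?d * poisson_walk t x - M * profile x t\<bar> \<le> \<epsilon>" using t1[of t] t by simp
  qed
qed

end

section \<open>Isotropy of radial kernels and the main result\<close>

definition swap_coordinates :: "'a::euclidean_space \<Rightarrow> 'a \<Rightarrow> 'a \<Rightarrow> 'a" where
  "swap_coordinates b c x = (\<Sum>i\<in>Basis. (x \<bullet> (if i = b then c else if i = c then b else i)) *\<^sub>R i)"

definition flip_coordinate :: "'a::euclidean_space \<Rightarrow> 'a \<Rightarrow> 'a" where
  "flip_coordinate b x = (\<Sum>i\<in>Basis. ((if i = b then - 1 else 1) * (x \<bullet> i)) *\<^sub>R i)"

lemma swap_coordinates_inner:
  "i \<in> Basis \<Longrightarrow> swap_coordinates b c x \<bullet> i = x \<bullet> (if i = b then c else if i = c then b else i)"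
  by (simp add: swap_coordinates_def inner_sum_left_Basis)

lemma flip_coordinate_inner:
  "i \<in> Basis \<Longrightarrow> flip_coordinate b x \<bullet> i = (if i = b then - (x \<bullet> i) else x \<bullet> i)"
  by (simp add: flip_coordinate_def inner_sum_left_Basis)

lemma swap_coordinates_measurable [measurable]: "swap_coordinates b c \<in> borel_measurable borel"
  unfolding swap_coordinates_def by measurable

lemma flip_coordinate_measurable [measurable]: "flip_coordinate b \<in> borel_measurable borel"
  unfolding flip_coordinate_def by measurable

lemma norm_square_Basis: "(norm x)\<^sup>2 = (\<Sum>b\<in>Basis. (x \<bullet> b)\<^sup>2)" for x :: "'a::euclidean_space"
  unfolding power2_norm_eq_inner by (subst euclidean_inner) (simp add: power2_eq_square)

lemma bij_betw_swap_Basis: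
  assumes "b \<in> (Basis :: 'a::euclidean_space set)" "c \<in> Basis"
  shows "bij_betw (\<lambda>i. if i = b then c else if i = c then b else i) (Basis :: 'a set) Basis"
  by (rule bij_betw_byWitness[where f'="\<lambda>i. if i = b then c else if i = c then b else i"]) (use assms in auto)

lemma norm_swap_coordinates:
  assumes "b \<in> Basis" "c \<in> Basis"
  shows "norm (swap_coordinates b c x) = norm x"
proof -
  have "(norm (swap_coordinates b c x))\<^sup>2 = (\<Sum>i\<in>Basis. (x \<bullet> (if i = b then c else if i = c then b else i))\<^sup>2)"
    by (simp add: norm_square_Basis swap_coordinates_inner cong: sum.cong)
  also have "\<dots> = (norm x)\<^sup>2"
    unfolding norm_square_Basis[of x] by (rule sum.reindex_bij_betw[OF bij_betw_swap_Basis[OF assms]])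
  finally show ?thesis by (simp add: power2_eq_iff_nonneg)
qed

lemma norm_flip_coordinate: "norm (flip_coordinate b x) = norm x"
proof -
  have "(norm (flip_coordinate b x))\<^sup>2 = (norm x)\<^sup>2"
    unfolding norm_square_Basis by (intro sum.cong refl) (simp add: flip_coordinate_inner)
  then show ?thesis by (simp add: power2_eq_iff_nonneg)
qed

lemma lborel_distr_swap_coordinates:
  fixes b c :: "'a::euclidean_space"
  assumes bc: "b \<in> Basis" "c \<in> Basis"
  shows "distr lborel borel (swap_coordinates b c) = lborel"
proof (rule lborel_eqI[symmetric])
  show "sets (distr lborel borel (swap_coordinates b c)) = sets borel" by simp
  fix l u :: 'a assume lu: "\<And>i. i \<in> Basis \<Longrightarrow> l \<bullet> i \<le> u \<bullet> i"
  let ?p = "\<lambda>i. if i = b then c else if i = c then b else i"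
  let ?T = "swap_coordinates b c"
  have p: "?p i \<in> Basis" "?p (?p i) = i" if "i \<in> Basis" for i using that bc by auto
  have "?T -` box l u = box (?T l) (?T u)"
  proof (intro set_eqI iffI)
    fix x assume x: "x \<in> ?T -` box l u"
    have "l \<bullet> ?p i < x \<bullet> i \<and> x \<bullet> i < u \<bullet> ?p i" if i: "i \<in> Basis" for i
    proof -
      have "l \<bullet> ?p i < ?T x \<bullet> ?p i \<and> ?T x \<bullet> ?p i < u \<bullet> ?p i" using x p(1)[OF i] by (simp only: vimage_eq mem_box)
      then show ?thesis unfolding swap_coordinates_inner[OF p(1)[OF i]] p(2)[OF i] .
    qed
    then show "x \<in> box (?T l) (?T u)" unfolding mem_box by (intro ballI) (simp only: swap_coordinates_inner)
  next
    fix x assume x: "x \<in> box (?T l) (?T u)"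
    have "l \<bullet> i < x \<bullet> ?p i \<and> x \<bullet> ?p i < u \<bullet> i" if i: "i \<in> Basis" for i
    proof -
      have "?T l \<bullet> ?p i < x \<bullet> ?p i \<and> x \<bullet> ?p i < ?T u \<bullet> ?p i" using x p(1)[OF i] by (simp only: mem_box)
      then show ?thesis unfolding swap_coordinates_inner[OF p(1)[OF i]] p(2)[OF i] .
    qed
    then show "x \<in> ?T -` box l u" unfolding vimage_eq mem_box by (intro ballI) (simp only: swap_coordinates_inner)
  qed
  then have "emeasure (distr lborel borel ?T) (box l u) = emeasure lborel (box (?T l) (?T u))"
    by (subst emeasure_distr) auto
  also have "\<dots> = (\<Prod>i\<in>Basis. (?T u - ?T l) \<bullet> i)"
  proof (rule emeasure_lborel_box)
    fix i :: 'a assume i: "i \<in> Basis"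
    show "?T l \<bullet> i \<le> ?T u \<bullet> i" unfolding swap_coordinates_inner[OF i] using lu[OF p(1)[OF i]] .
  qed
  also have "(\<Prod>i\<in>Basis. (?T u - ?T l) \<bullet> i) = (\<Prod>i\<in>Basis. (u - l) \<bullet> ?p i)"
    by (intro prod.cong refl) (simp only: inner_diff_left swap_coordinates_inner)
  also have "\<dots> = (\<Prod>i\<in>Basis. (u - l) \<bullet> i)"
    by (rule prod.reindex_bij_betw[OF bij_betw_swap_Basis[OF bc]])
  finally show "emeasure (distr lborel borel ?T) (box l u) = (\<Prod>i\<in>Basis. (u - l) \<bullet> i)" .
qed

lemma lborel_distr_flip_coordinate: "distr lborel borel (flip_coordinate b) = lborel"
proof -
  have "\<bar>if i = b then - 1 else 1 :: real\<bar> = 1" for i by simp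
  then show ?thesis
    using lborel_affine_euclidean[of "\<lambda>i. if i = b then - 1 else 1" "0::'a"]
    by (simp add: density_1 flip_coordinate_def[abs_def])
qed

text \<open>Reflecting one coordinate shows that mixed moments vanish, and exchanging two coordinates that the
  pure second moments agree; both maps preserve norms and Lebesgue measure.\<close>
lemma radial_second_moment:
  fixes J :: "'a::euclidean_space \<Rightarrow> real"
  assumes J [measurable]: "J \<in> borel_measurable borel"
    and radial: "\<And>x y. norm x = norm y \<Longrightarrow> J x = J y"
    and int: "\<And>b c. integrable lborel (\<lambda>x. (x \<bullet> b) * (x \<bullet> c) * J x)"
  shows "(LINT x|lborel. (x \<bullet> \<xi>)\<^sup>2 * J x)
    = 2 * ((LINT x|lborel. (norm x)\<^sup>2 * J x) / (2 * real DIM('a))) * (norm \<xi>)\<^sup>2"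
proof -
  let ?m = "\<lambda>b c. LINT x|lborel. (x \<bullet> b) * (x \<bullet> c) * J x"
  have diag: "?m b b = ?m c c" if bc: "b \<in> Basis" "c \<in> Basis" for b c :: 'a
  proof -
    let ?T = "swap_coordinates b c"
    have "?m b b = (LINT x|distr lborel borel ?T. (x \<bullet> b) * (x \<bullet> b) * J x)"
      by (simp add: lborel_distr_swap_coordinates[OF bc])
    also have "\<dots> = (LINT x|lborel. (?T x \<bullet> b) * (?T x \<bullet> b) * J (?T x))" by (rule integral_distr) auto
    also have "\<dots> = ?m c c"
      using bc radial[OF norm_swap_coordinates[OF bc]] by (simp add: swap_coordinates_inner)
    finally show ?thesis .
  qed
  have off: "?m b c = 0" if bc: "b \<in> Basis" "c \<in> Basis" "b \<noteq> c" for b c :: 'a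
  proof -
    let ?T = "flip_coordinate b"
    have "?m b c = (LINT x|distr lborel borel ?T. (x \<bullet> b) * (x \<bullet> c) * J x)"
      by (simp add: lborel_distr_flip_coordinate)
    also have "\<dots> = (LINT x|lborel. (?T x \<bullet> b) * (?T x \<bullet> c) * J (?T x))" by (rule integral_distr) auto
    also have "\<dots> = - ?m b c"
      using bc radial[OF norm_flip_coordinate] by (simp add: flip_coordinate_inner)
    finally show ?thesis by simp
  qed
  obtain b0 :: 'a where b0: "b0 \<in> Basis" using nonempty_Basis by blast
  have "(x \<bullet> \<xi>)\<^sup>2 * J x = (\<Sum>b\<in>Basis. \<Sum>c\<in>Basis. (\<xi> \<bullet> b) * (\<xi> \<bullet> c) * ((x \<bullet> b) * (x \<bullet> c) * J x))" for x
  proof -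
    have "x \<bullet> \<xi> = (\<Sum>b\<in>Basis. (x \<bullet> b) * (\<xi> \<bullet> b))" by (rule euclidean_inner)
    then have E: "(x \<bullet> \<xi>)\<^sup>2 * J x = (\<Sum>b\<in>Basis. (x \<bullet> b) * (\<xi> \<bullet> b)) * (\<Sum>c\<in>Basis. (x \<bullet> c) * (\<xi> \<bullet> c)) * J x"
      by (simp only: power2_eq_square)
    show ?thesis
      unfolding E sum_distrib_right sum_distrib_left by (intro sum.cong refl) (simp only: mult_ac)
  qed
  then have "(LINT x|lborel. (x \<bullet> \<xi>)\<^sup>2 * J x) = (\<Sum>b\<in>Basis. \<Sum>c\<in>Basis. (\<xi> \<bullet> b) * (\<xi> \<bullet> c) * ?m b c)"
    using int by (simp add: Bochner_Integration.integral_sum)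
  also have "\<dots> = (\<Sum>b\<in>Basis. (\<xi> \<bullet> b)\<^sup>2 * ?m b0 b0)"
  proof (rule sum.cong[OF refl])
    fix b :: 'a assume b: "b \<in> Basis"
    have "(\<Sum>c\<in>Basis. (\<xi> \<bullet> b) * (\<xi> \<bullet> c) * ?m b c) = (\<xi> \<bullet> b) * (\<xi> \<bullet> b) * ?m b b
        + (\<Sum>c\<in>Basis - {b}. (\<xi> \<bullet> b) * (\<xi> \<bullet> c) * ?m b c)"
      using b by (intro sum.remove) auto
    also have "(\<Sum>c\<in>Basis - {b}. (\<xi> \<bullet> b) * (\<xi> \<bullet> c) * ?m b c) = 0"
      using off[OF b] by (intro sum.neutral) auto
    finally show "(\<Sum>c\<in>Basis. (\<xi> \<bullet> b) * (\<xi> \<bullet> c) * ?m b c) = (\<xi> \<bullet> b)\<^sup>2 * ?m b0 b0"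
      using diag[OF b b0] by (simp add: power2_eq_square)
  qed
  also have "\<dots> = (norm \<xi>)\<^sup>2 * ?m b0 b0" by (simp add: norm_square_Basis sum_distrib_right)
  finally have main: "(LINT x|lborel. (x \<bullet> \<xi>)\<^sup>2 * J x) = (norm \<xi>)\<^sup>2 * ?m b0 b0" .
  have "(norm x)\<^sup>2 * J x = (\<Sum>b\<in>Basis. (x \<bullet> b) * (x \<bullet> b) * J x)" for x
    unfolding norm_square_Basis[of x] sum_distrib_right by (simp only: power2_eq_square)
  then have "(LINT x|lborel. (norm x)\<^sup>2 * J x) = (\<Sum>b\<in>Basis. ?m b b)"
    using int by (simp add: Bochner_Integration.integral_sum)
  also have "\<dots> = real DIM('a) * ?m b0 b0" using diag[OF _ b0] by simp
  finally show ?thesis unfolding main by simp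
qed

lemma nonlocal_kernel_isotropic:
  fixes J :: "'a::euclidean_space \<Rightarrow> real"
  assumes J: "nonlocal_kernel J"
  shows "isotropic_kernel J (diffusivity J)"
proof -
  have smooth: "smooth_on UNIV J" and nn: "\<And>x. 0 \<le> J x" and radial: "\<And>x y. norm x = norm y \<Longrightarrow> J x = J y"
    and supp: "closure {x. J x \<noteq> 0} \<subseteq> cball 0 1" and J0: "0 < J 0" and one: "(LINT x|lebesgue. J x) = 1"
    using J unfolding nonlocal_kernel_def by blast+
  have "Ck_on 0 J UNIV" using smooth unfolding smooth_on_def by blast
  then have cont: "continuous_on UNIV J" by simp
  have meas [measurable]: "J \<in> borel_measurable borel" using cont by (rule borel_measurable_continuous_onI)
  have zero: "J x = 0" if "1 < norm x" for x
  proof (rule ccontr)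
    assume "J x \<noteq> 0"
    then have "x \<in> closure {x. J x \<noteq> 0}" by (intro closure_subset[THEN subsetD]) simp
    then show False using supp that by auto
  qed
  have int: "integrable lborel (\<lambda>x. (x \<bullet> b) * (x \<bullet> c) * J x)" for b c
  proof -
    have "integrable lborel (\<lambda>x. indicator (cball 0 1) x *\<^sub>R ((x \<bullet> b) * (x \<bullet> c) * J x))"
      by (rule borel_integrable_compact) (auto intro!: continuous_intros continuous_on_subset[OF cont])
    moreover have "(\<lambda>x. indicator (cball 0 1) x *\<^sub>R ((x \<bullet> b) * (x \<bullet> c) * J x)) = (\<lambda>x. (x \<bullet> b) * (x \<bullet> c) * J x)"
      by (auto simp: indicator_def fun_eq_iff not_le intro!: zero)
    ultimately show ?thesis by simp
  qed
  have lb: "(LINT x|lebesgue. g x) = (LINT x|lborel. g x)" if "g \<in> borel_measurable borel" for g :: "'a \<Rightarrow> real"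
    using that by (intro integral_completion) simp
  show ?thesis
  proof
    show "continuous_on UNIV J" by fact
    show "0 \<le> J x" for x by (rule nn)
    show "J (- x) = J x" for x by (rule radial) simp
    show "1 < norm x \<Longrightarrow> J x = 0" for x by (rule zero)
    show "0 < J 0" by fact
    show "(LINT x|lborel. J x) = 1" using one lb[OF meas] by simp
    show "(LINT x|lborel. (x \<bullet> \<xi>)\<^sup>2 * J x) = 2 * diffusivity J * (norm \<xi>)\<^sup>2" for \<xi>
      using radial_second_moment[OF meas radial int, of \<xi>] lb[of "\<lambda>z. (norm z)\<^sup>2 * J z"]
      by (simp add: diffusivity_def)
  qed
qed

text \<open>The exceptional null sets are removed from the initial datum, so that its bounds hold everywhere.\<close>
lemma initial_datum_representative:
  fixes u0 :: "'a::euclidean_space \<Rightarrow> real"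
  assumes int: "integrable lebesgue u0" and bd: "Linf_norm UNIV u0 < \<infinity>"
    and nn: "AE x in lebesgue. 0 \<le> u0 x" and zero: "AE x in lebesgue. x \<in> H \<longrightarrow> u0 x = 0"
    and H: "H \<in> sets borel"
  obtains f0 B where "integrable lborel f0" "\<And>x. 0 \<le> f0 x" "\<And>x. f0 x \<le> B" "\<And>x. x \<in> H \<Longrightarrow> f0 x = 0"
    "AE x in lebesgue. u0 x = f0 x"
proof -
  obtain g where [measurable]: "g \<in> borel_measurable borel" and ug: "AE x in lebesgue. u0 x = g x"
    using borel_representative[OF borel_measurable_integrable[OF int]] .
  define B where "B = enn2real (Linf_norm UNIV u0)"
  have B0: "0 \<le> B" by (simp add: B_def)
  have "AE x in lebesgue. ennreal \<bar>u0 x\<bar> \<le> ennreal B"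
    using esssup_AE[of "\<lambda>x. ennreal \<bar>u0 x\<bar>" lebesgue] bd
    by (simp add: Linf_norm_def B_def lebesgue_on_UNIV_eq)
  then have ub: "AE x in lebesgue. \<bar>u0 x\<bar> \<le> B" using B0 by simp
  define f0 where "f0 x = (if x \<in> H \<or> g x < 0 \<or> B < g x then 0 else g x)" for x
  have [measurable]: "f0 \<in> borel_measurable borel" unfolding f0_def using H by measurable
  have uf: "AE x in lebesgue. u0 x = f0 x"
    using ug ub nn zero by eventually_elim (auto simp: f0_def)
  show thesis
  proof
    show "integrable lborel f0"
      using integrable_representative[OF _ uf borel_measurable_integrable[OF int]] int by simp
    show "0 \<le> f0 x" "f0 x \<le> B" "x \<in> H \<Longrightarrow> f0 x = 0" for x using B0 by (auto simp: f0_def)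
    show "AE x in lebesgue. u0 x = f0 x" by fact
  qed
qed

text \<open>Local integrability makes \<open>\<phi>\<close> measurable, as the limit of its restrictions to balls.\<close>
lemma stationary_solution_representative:
  fixes J \<phi> :: "'a::euclidean_space \<Rightarrow> real"
  assumes sol: "stationary_solution J H \<phi>" and J: "J \<in> borel_measurable borel"
  obtains g where "g \<in> borel_measurable borel" "AE x in lebesgue. \<phi> x = g x" "\<phi> \<in> borel_measurable lebesgue"
    "\<And>R. integrable lborel (\<lambda>x. indicator (cball 0 R) x * g x)"
    "AE x in lborel. x \<notin> H \<longrightarrow> cv J g x = g x" "AE x in lborel. x \<in> H \<longrightarrow> g x = 0"
    "\<And>e. 0 < e \<Longrightarrow> \<exists>R. AE x in lborel. R \<le> norm x \<longrightarrow> \<bar>g x - 1\<bar> < e"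
proof -
  have loc: "integrable lebesgue (\<lambda>x. indicator (cball 0 R) x * \<phi> x)" for R
    using sol unfolding stationary_solution_def set_integrable_def by (auto dest!: spec[of _ "cball 0 R"])
  have \<phi>m: "\<phi> \<in> borel_measurable lebesgue"
  proof (rule borel_measurable_LIMSEQ_real)
    show "(\<lambda>x. indicator (cball 0 (real i)) x * \<phi> x) \<in> borel_measurable lebesgue" for i
      using loc[of "real i"] by (rule borel_measurable_integrable)
    fix x :: 'a
    obtain N :: nat where N: "norm x \<le> real N" using real_arch_simple by blast
    have "eventually (\<lambda>i. indicator (cball 0 (real i)) x * \<phi> x = \<phi> x) sequentially"
      using eventually_ge_at_top[of N] by eventually_elim (use N in \<open>auto simp: indicator_def\<close>)
    then show "(\<lambda>i. indicator (cball 0 (real i)) x * \<phi> x) \<longlonglongrightarrow> \<phi> x" by (rule tendsto_eventually)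
  qed
  obtain g where g: "g \<in> borel_measurable borel" and \<phi>g: "AE x in lebesgue. \<phi> x = g x"
    using borel_representative[OF \<phi>m] .
  have st: "AE x in lebesgue. x \<in> - H \<longrightarrow> conv J \<phi> x = \<phi> x" and sH: "AE x in lebesgue. x \<in> H \<longrightarrow> \<phi> x = 0"
    and inf: "\<And>e. 0 < e \<Longrightarrow> \<exists>R. AE x in lebesgue. R \<le> norm x \<longrightarrow> \<bar>\<phi> x - 1\<bar> < e"
    using sol unfolding stationary_solution_def by blast+
  have conv: "conv J \<phi> x = cv J g x" for x using conv_eq_cv[OF J g \<phi>m \<phi>g] .
  show thesis
  proof
    show "g \<in> borel_measurable borel" "AE x in lebesgue. \<phi> x = g x" "\<phi> \<in> borel_measurable lebesgue" by fact+
    show "integrable lborel (\<lambda>x. indicator (cball 0 R) x * g x)" for R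
    proof (subst integrable_representative[symmetric])
      show "(\<lambda>x. indicator (cball 0 R) x * g x) \<in> borel_measurable borel" using g by (intro borel_measurable_times borel_measurable_indicator) auto
      show "AE x in lebesgue. indicator (cball 0 R) x * \<phi> x = indicator (cball 0 R) x * g x"
        using \<phi>g by eventually_elim simp
      show "(\<lambda>x. indicator (cball 0 R) x * \<phi> x) \<in> borel_measurable lebesgue"
        using loc by (rule borel_measurable_integrable)
      show "integrable lebesgue (\<lambda>x. indicator (cball 0 R) x * \<phi> x)" by (rule loc)
    qed
    have "AE x in lebesgue. x \<notin> H \<longrightarrow> cv J g x = g x" using st \<phi>g by eventually_elim (auto simp: conv)
    then show "AE x in lborel. x \<notin> H \<longrightarrow> cv J g x = g x" by (simp add: AE_completion_iff)
    have "AE x in lebesgue. x \<in> H \<longrightarrow> g x = 0" using sH \<phi>g by eventually_elim auto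
    then show "AE x in lborel. x \<in> H \<longrightarrow> g x = 0" by (simp add: AE_completion_iff)
    fix e :: real assume "0 < e"
    then obtain R where "AE x in lebesgue. R \<le> norm x \<longrightarrow> \<bar>\<phi> x - 1\<bar> < e" using inf by blast
    then have "AE x in lebesgue. R \<le> norm x \<longrightarrow> \<bar>g x - 1\<bar> < e" using \<phi>g by eventually_elim auto
    then show "\<exists>R. AE x in lborel. R \<le> norm x \<longrightarrow> \<bar>g x - 1\<bar> < e" by (auto simp: AE_completion_iff)
  qed
qed

theorem theorem5p1:
  fixes J :: "real ^ 'n \<Rightarrow> real"
    and H :: "(real ^ 'n) set"
    and u0 :: "real ^ 'n \<Rightarrow> real"
    and u :: "real \<Rightarrow> real ^ 'n \<Rightarrow> real"
    and \<phi> :: "real ^ 'n \<Rightarrow> real"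
    and Mstar \<delta> :: real
  assumes "3 \<le> CARD('n)"
    and "open H" "bounded H" "smooth_boundary H" "0 \<in> H"
    and "nonlocal_kernel J"
    and "integrable lebesgue u0" "Linf_norm UNIV u0 < \<infinity>"
    and "AE x in lebesgue. 0 \<le> u0 x"
    and "AE x in lebesgue. x \<in> H \<longrightarrow> u0 x = 0"
    and "nonlocal_solution J H u0 u"
    and "stationary_solution J H \<phi>"
    and "Mstar = (LINT x|lebesgue. u0 x * \<phi> x)"
    and "0 < \<delta>"
  shows "((\<lambda>t. ennreal (t powr (real CARD('n) / 2)) *
             Linf_norm {x. \<delta> * t \<le> (norm x)\<^sup>2}
               (\<lambda>x. u t x - Mstar * heat_kernel (diffusivity J) x t)) \<longlongrightarrow> 0) at_top"
proof -
  let ?\<alpha> = "diffusivity J" and ?d = "real CARD('n) / 2"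
  have iso: "isotropic_kernel J ?\<alpha>" using assms(6) by (rule nonlocal_kernel_isotropic)
  interpret isotropic_kernel J ?\<alpha> by (rule iso)
  have H: "H \<in> sets borel" using assms(2) by (rule borel_open)
  obtain f0 B where f0: "integrable lborel f0" "\<And>x. 0 \<le> f0 x" "\<And>x. f0 x \<le> B" "\<And>x. x \<in> H \<Longrightarrow> f0 x = 0"
    and uf: "AE x in lebesgue. u0 x = f0 x"
    using initial_datum_representative[OF assms(7-10) H] by blast
  obtain g where g: "g \<in> borel_measurable borel" "AE x in lebesgue. \<phi> x = g x" "\<phi> \<in> borel_measurable lebesgue"
    and g_loc: "\<And>R. integrable lborel (\<lambda>x. indicator (cball 0 R) x * g x)"
    and g_st: "AE x in lborel. x \<notin> H \<longrightarrow> cv J g x = g x" and g_H: "AE x in lborel. x \<in> H \<longrightarrow> g x = 0"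
    and g_inf: "\<And>e. 0 < e \<Longrightarrow> \<exists>R. AE x in lborel. R \<le> norm x \<longrightarrow> \<bar>g x - 1\<bar> < e"
    using stationary_solution_representative[OF assms(12) J_measurable] by blast
  obtain \<rho> where \<rho>: "0 < \<rho>" "\<And>x. x \<in> H \<Longrightarrow> norm x \<le> \<rho>" using assms(3) bounded_pos by blast
  interpret killed_walk_stationary J ?\<alpha> H \<rho> f0 B g
    by unfold_locales (use H \<rho> f0 g(1) g_loc g_st g_H g_inf in auto)
  have f0m: "f0 \<in> borel_measurable borel" using f0(1) by auto
  have Mstar: "Mstar = M"
    unfolding M_def assms(13)
  proof (rule integral_representative)
    show "(\<lambda>x. f0 x * g x) \<in> borel_measurable borel" using f0m g(1) by (rule borel_measurable_times)
    show "AE x in lebesgue. u0 x * \<phi> x = f0 x * g x" using uf g(2) by eventually_elim simp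
    show "(\<lambda>x. u0 x * \<phi> x) \<in> borel_measurable lebesgue"
      using borel_measurable_integrable[OF assms(7)] g(3) by (rule borel_measurable_times)
  qed
  let ?F = "\<lambda>t. ennreal (t powr ?d) * Linf_norm {x. \<delta> * t \<le> (norm x)\<^sup>2} (\<lambda>x. u t x - Mstar * heat_kernel ?\<alpha> x t)"
  have small: "eventually (\<lambda>t. ?F t \<le> ennreal e) at_top" if e: "0 < e" for e
  proof -
    obtain t0 where t0: "0 < t0" "\<And>t x. t0 \<le> t \<Longrightarrow> \<delta> * t \<le> (norm x)\<^sup>2 \<Longrightarrow>
      \<bar>t powr (real DIM(real ^ 'n) / 2) * poisson_walk t x - M * profile x t\<bar> \<le> e"
      using poisson_walk_asymptotics[OF assms(14) e] by blast
    show ?thesis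
      using eventually_ge_at_top[of t0]
    proof eventually_elim
      case (elim t)
      have t: "0 < t" using elim t0(1) by simp
      let ?S = "{x :: real ^ 'n. \<delta> * t \<le> (norm x)\<^sup>2}"
      let ?D = "\<lambda>x. u t x - Mstar * heat_kernel ?\<alpha> x t"
      have "closed ?S" by (intro closed_Collect_le continuous_intros)
      then have S: "?S \<in> sets lebesgue" using borel_closed by auto
      have ae: "AE x in lebesgue. u t x = poisson_walk t x"
        using assms(11) uf t by (rule nonlocal_solution_poisson_walk)
      have bound: "\<bar>?D x\<bar> \<le> e / t powr ?d" if "u t x = poisson_walk t x" "x \<in> ?S" for x
      proof -
        have "t powr ?d * ?D x = t powr ?d * poisson_walk t x - M * profile x t"
          using that(1) profile_heat_kernel[OF t, of x] by (simp add: Mstar right_diff_distrib mult.left_commute)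
        then have "\<bar>t powr ?d * ?D x\<bar> \<le> e" using t0(2)[OF elim, of x] that(2) by simp
        then have "\<bar>?D x\<bar> * t powr ?d \<le> e"
          unfolding abs_mult abs_of_nonneg[OF powr_ge_zero] by (simp only: mult.commute)
        moreover have "0 < t powr ?d" using t by simp
        ultimately show ?thesis by (simp only: pos_le_divide_eq)
      qed
      have "Linf_norm ?S ?D \<le> ennreal (e / t powr ?d)"
        unfolding Linf_norm_def
      proof (rule esssup_I)
        have "integrable lebesgue (u t)" using assms(11) t by (auto simp: nonlocal_solution_def L1_curve_def)
        then have "(\<lambda>x. ennreal \<bar>?D x\<bar>) \<in> borel_measurable lebesgue"
          using borel_imp_lebesgue_measurable[OF heat_kernel_measurable, of ?\<alpha> t] borel_measurable_integrable
          by (intro measurable_compose[OF _ measurable_ennreal] borel_measurable_abs borel_measurable_diff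
              borel_measurable_times borel_measurable_const) auto
        then show "(\<lambda>x. ennreal \<bar>?D x\<bar>) \<in> borel_measurable (lebesgue_on ?S)" by (rule measurable_restrict_space1)
        show "AE x in lebesgue_on ?S. ennreal \<bar>?D x\<bar> \<le> ennreal (e / t powr ?d)"
          using S ae bound by (subst AE_restrict_space_iff) (auto elim!: eventually_mono intro!: ennreal_leI)
      qed
      then have "?F t \<le> ennreal (t powr ?d) * ennreal (e / t powr ?d)" by (rule mult_left_mono) simp
      also have "\<dots> = ennreal e" using t e by (simp add: ennreal_mult[symmetric])
      finally show ?case .
    qed
  qed
  show ?thesis
  proof (rule order_tendstoI)
    fix a :: ennreal assume a: "0 < a"
    obtain e where e: "0 < e" "ennreal e < a"
    proof (cases a)
      case (real r)
      then show thesis using a by (intro that[of "r / 2"]) (auto simp: ennreal_less_iff)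
    qed (auto intro: that[of 1])
    show "eventually (\<lambda>t. ?F t < a) at_top"
      using small[OF e(1)] by eventually_elim (use e(2) in \<open>auto intro: le_less_trans\<close>)
  qed simp
qed

end
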